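(* For $t\in[2^n]$, let $\mathcal{F}^t=\{\mathcal{F}^t_\lambda\}$ with $\mathcal{F}^t_\lambda=\{f:\{0,1\}^n\to\{0,1\}\mid |f^{-1}(1)|=t\}$, $n=n(\lambda)$, and let $\mathcal{U}_{\mathcal{F}^t}$ be the uniform distribution on $\mathcal{F}^t$. Suppose that for $r=\mathrm{poly}(\lambda)$: (1) $\mathcal{F}^r$ is evasive with respect to $\mathcal{U}_{\mathcal{F}^r}$; (2) for every $t\in\{r-1,r\}$ there exists a keyed circuit implementation $(\mathcal{D}^t,\mathfrak{C}^t)$ of $(\mathcal{U}_{\mathcal{F}^t},\mathcal{F}^t)$. Then, assuming post-quantum indistinguishability obfuscation, $(\mathcal{U}_{\mathcal{F}^r},\mathcal{F}^r)$ is preimage-samplable evasive.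
   Context: QPT means quantum polynomial time; $\approx_c$ is computational indistinguishability against QPT adversaries. **Keyed circuit class.** $\mathfrak{C}=\{\mathfrak{C}_\lambda\}$, $\mathfrak{C}_\lambda=\{C_k:k\in\mathcal{K}_\lambda\}$, polynomial-size classical circuits of the same size, input length $n(\lambda)$, output length $m(\lambda)$. It is *generalized puncturable* if equipped with an efficient $\mathsf{GenPuncture}$ which on $k$, points $x_1,x_2$ and poly-size circuits $\mu_1,\mu_2:\{0,1\}^n\to\{0,1\}^m$ outputs a circuit $G$ such that $G(x)=C_k(x)$ for $x\notin\{x_1,x_2\}$, $G(x_1)=\mu_1(x_1)$ and, if $x_2\ne x_1$, $G(x_2)=\mu_2(x_2)$. Circuits may be padded so that punctured and unpunctured circuits have the same size. **Keyed circuit implementation.** $\mathfrak{C}$ implements $\mathcal{F}$ if the map $S_\lambda$ sending a circuit to its functionality maps $\mathfrak{C}_\lambda$ onto $\mathcal{F}_\lambda$. With an efficiently samplable distribution $\mathcal{D}$ on keys, $(\mathcal{D},\mathfrak{C})$ implements $(\mathcal{D}_{\mathcal F},\mathcal{F})$ if moreover $\{S_\lambda(C_k)\}_{k\leftarrow\mathcal{D}(1^\lambda)}\approx\{f\}_{f\leftarrow\mathcal{D}_{\mathcal F}(1^\lambda)}$ (the two distributions are statistically close). **Evasive.** A class of boolean functions on $n(\lambda)$ bits is evasive with respect to an efficiently samplable $\mathcal{D}_{\mathcal F}$ if for every fixed $x$, $\Pr_{f\leftarrow\mathcal{D}_{\mathcal F}(1^\lambda)}[f(x)=1]$ is negligible.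 **Preimage-samplable evasive.** An evasive $(\mathcal{D}_{\mathcal F},\mathcal{F})$ such that (1) there is a keyed circuit implementation $(\mathcal{D},\mathfrak{C}^{\mathcal F}=\{C^{\mathcal F}_k\}_{k\in\mathcal{K}})$ of $(\mathcal{D}_{\mathcal F},\mathcal{F})$; (2) there is an auxiliary generalized puncturable keyed circuit class $\mathfrak{C}=\{C_{k'}\}_{k'\in\mathcal{K}'}$ with generalized puncturing algorithm $\mathsf{P}$ and an efficiently samplable distribution $\mathcal{D}'$ on $\mathcal{K}'$ such that $$\{(C^{\mathcal F}_k,x)\}_{k\leftarrow\mathcal{D}(1^\lambda),\,x\leftarrow (C^{\mathcal F}_k)^{-1}(1)\text{ uniform}}\approx_c\{(C_{k',y,\vec 1},y)\}_{k'\leftarrow\mathcal{D}'(1^\lambda),\,y\leftarrow\{0,1\}^n\text{ uniform},\,C_{k',y,\vec 1}\leftarrow\mathsf{P}(k',y,y,\vec1,\vec1)},$$ with $\vec 1$ the constant-1 function. *)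

theory Defs
  imports "HOL-Probability.Probability"
begin

section \<open>Bit strings and growth rates\<close>

definition bits :: "nat \<Rightarrow> bool list set" where
  "bits n = {x. length x = n}"

definition unary :: "nat \<Rightarrow> bool list" where
  "unary n = replicate n True"

definition poly_bounded :: "(nat \<Rightarrow> nat) \<Rightarrow> bool" where
  "poly_bounded f \<longleftrightarrow> (\<exists>c. \<forall>\<kappa>. f \<kappa> \<le> \<kappa> ^ c + c)"

definition negligible :: "(nat \<Rightarrow> real) \<Rightarrow> bool" where
  "negligible f \<longleftrightarrow> (\<forall>c::nat. \<forall>\<^sub>F \<kappa> in sequentially. \<bar>f \<kappa>\<bar> < 1 / real \<kappa> ^ c)"

definition stat_dist :: "'a pmf \<Rightarrow> 'a pmf \<Rightarrow> real" where
  "stat_dist p q = (\<Sum>\<^sub>\<infinity>x. \<bar>pmf p x - pmf q x\<bar>) / 2"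

definition stat_close :: "(nat \<Rightarrow> 'a pmf) \<Rightarrow> (nat \<Rightarrow> 'a pmf) \<Rightarrow> bool" where
  "stat_close X Y \<longleftrightarrow> negligible (\<lambda>\<kappa>. stat_dist (X \<kappa>) (Y \<kappa>))"


section \<open>Probabilistic polynomial time\<close>

text \<open>
  The machine has registers holding bit strings, used as stacks, so that two of them make up one
  tape of a Turing machine. Every transition does a constant amount of work, hence step counts
  agree with those of probabilistic multitape Turing machines up to a polynomial.
  A configuration consists of the instructions still to be executed and the register contents;
  an empty instruction list means that the machine has halted.
\<close>

datatype instr =
    Push nat bool
  | Pop nat
  | Flip nat
  | Cond nat "instr list" "instr list"
  | Loop nat "instr list"

type_synonym config = "instr list \<times> (nat \<Rightarrow> bool list)"

text \<open>Cond branches on whether the top bit of the register exists and is True; Loop repeats its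
  body as long as the register is nonempty; Flip pushes a fair random bit.\<close>

fun step :: "config \<Rightarrow> config pmf" where
  "step ([], s) = return_pmf ([], s)"
| "step (Push r b # K, s) = return_pmf (K, s(r := b # s r))"
| "step (Pop r # K, s) = return_pmf (K, s(r := tl (s r)))"
| "step (Flip r # K, s) = map_pmf (\<lambda>b. (K, s(r := b # s r))) (bernoulli_pmf (1/2))"
| "step (Cond r c d # K, s) =
     return_pmf ((if s r \<noteq> [] \<and> hd (s r) then c else d) @ K, s)"
| "step (Loop r c # K, s) =
     return_pmf (if s r \<noteq> [] then (c @ Loop r c # K, s) else (K, s))"

primrec run :: "nat \<Rightarrow> config \<Rightarrow> config pmf" where
  "run 0 cf = return_pmf cf"
| "run (Suc t) cf = bind_pmf (step cf) (run t)"

text \<open>The arguments are put into registers 0, 1, 2, ...; all other registers start empty.\<close>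

definition load :: "bool list list \<Rightarrow> nat \<Rightarrow> bool list" where
  "load args r = (if r < length args then args ! r else [])"

text \<open>One program that, on the arguments attached to any index in \<open>I\<close>, always halts within time
  polynomial in the total length of the arguments and leaves in register 0 a string distributed
  exactly as prescribed by \<open>f\<close>.\<close>

definition ppt :: "'i set \<Rightarrow> ('i \<Rightarrow> bool list list) \<Rightarrow> ('i \<Rightarrow> bool list pmf) \<Rightarrow> bool" where
  "ppt I args f \<longleftrightarrow> (\<exists>prog c. \<forall>i\<in>I.
     let final = run (sum_list (map length (args i)) ^ c + c) (prog, load (args i)) in
       (\<forall>cf\<in>set_pmf final. fst cf = []) \<and> map_pmf (\<lambda>cf. snd cf 0) final = f i)"


section \<open>Classical circuits\<close>

text \<open>Wires are numbered: first the inputs, then one wire per gate in order of appearance.\<close>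

datatype gate = Zero | Nand nat nat

datatype circuit = Circuit (arity: nat) (gates: "gate list") (outs: "nat list")

fun gate_val :: "bool list \<Rightarrow> gate \<Rightarrow> bool" where
  "gate_val w Zero = False"
| "gate_val w (Nand i j) = (\<not> (w ! i \<and> w ! j))"

definition eval_circuit :: "circuit \<Rightarrow> bool list \<Rightarrow> bool list" where
  "eval_circuit C x =
     (let w = foldl (\<lambda>w g. w @ [gate_val w g]) x (gates C) in map (\<lambda>i. w ! i) (outs C))"

fun gate_ok :: "nat \<Rightarrow> gate \<Rightarrow> bool" where
  "gate_ok w Zero = True"
| "gate_ok w (Nand i j) = (i < w \<and> j < w)"

definition circuits :: "nat \<Rightarrow> nat \<Rightarrow> circuit set" where
  "circuits n m = {C. arity C = n \<and> length (outs C) = m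
     \<and> (\<forall>i < length (gates C). gate_ok (n + i) (gates C ! i))
     \<and> (\<forall>i \<in> set (outs C). i < n + length (gates C))}"

definition enc_nat :: "nat \<Rightarrow> bool list" where
  "enc_nat i = unary i @ [False]"

fun enc_gate :: "gate \<Rightarrow> bool list" where
  "enc_gate Zero = [False]"
| "enc_gate (Nand i j) = True # enc_nat i @ enc_nat j"

definition encode :: "circuit \<Rightarrow> bool list" where
  "encode C = enc_nat (arity C) @ enc_nat (length (outs C)) @ concat (map enc_nat (outs C))
     @ concat (map enc_gate (gates C))"

text \<open>Size is the bit length of the description. It is polynomially related to the number of wires and outputs,
  and appending Zero gates pads a circuit to any larger size.\<close>

definition circuit_size :: "circuit \<Rightarrow> nat" where
  "circuit_size C = length (encode C)"

definition const_one :: "nat \<Rightarrow> circuit" where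
  "const_one n = Circuit n [Zero, Nand n n] [Suc n]"

definition functionality :: "nat \<Rightarrow> circuit \<Rightarrow> bool list \<Rightarrow> bool list" where
  "functionality n C = restrict (eval_circuit C) (bits n)"


section \<open>Quantum polynomial time and computational indistinguishability\<close>

text \<open>Circuits over the universal gate set Hadamard, T and CNOT; a pure state of \<open>N\<close> qubits is given
  by its amplitudes on \<open>bits N\<close>.\<close>

datatype qgate = Had nat | Tgate nat | Cnot nat nat

fun qgate_ok :: "nat \<Rightarrow> qgate \<Rightarrow> bool" where
  "qgate_ok N (Had i) = (i < N)"
| "qgate_ok N (Tgate i) = (i < N)"
| "qgate_ok N (Cnot i j) = (i < N \<and> j < N \<and> i \<noteq> j)"

fun apply_qgate :: "qgate \<Rightarrow> (bool list \<Rightarrow> complex) \<Rightarrow> bool list \<Rightarrow> complex" where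
  "apply_qgate (Had i) \<psi> b =
     (\<psi> (b[i := False]) + (if b ! i then - 1 else 1) * \<psi> (b[i := True])) / complex_of_real (sqrt 2)"
| "apply_qgate (Tgate i) \<psi> b = (if b ! i then cis (pi / 4) else 1) * \<psi> b"
| "apply_qgate (Cnot i j) \<psi> b = \<psi> (if b ! i then b[j := \<not> b ! j] else b)"

datatype qcircuit = QCircuit (advice: "bool list") (qgates: "qgate list")

text \<open>The circuit is started in the basis state given by its input followed by its advice (which
  includes ancillas); qubit 0 is measured at the end, outcome 1 meaning acceptance.\<close>

definition qcircuit_ok :: "nat \<Rightarrow> qcircuit \<Rightarrow> bool" where
  "qcircuit_ok m Q \<longleftrightarrow> 0 < m + length (advice Q)
     \<and> (\<forall>g \<in> set (qgates Q). qgate_ok (m + length (advice Q)) g)"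

definition accept_prob :: "qcircuit \<Rightarrow> bool list \<Rightarrow> real" where
  "accept_prob Q w =
     (let \<psi> = fold apply_qgate (qgates Q) (\<lambda>b. if b = w @ advice Q then 1 else 0)
      in \<Sum>b \<in> {b \<in> bits (length w + length (advice Q)). b ! 0}. (cmod (\<psi> b))\<^sup>2)"

text \<open>A (non-uniform) QPT adversary is a family of circuits indexed by the security parameter and the
  input length, of size polynomial in both.\<close>

definition qpt_adversary :: "(nat \<Rightarrow> nat \<Rightarrow> qcircuit) \<Rightarrow> bool" where
  "qpt_adversary A \<longleftrightarrow> (\<forall>\<kappa> m. qcircuit_ok m (A \<kappa> m))
     \<and> (\<exists>c. \<forall>\<kappa> m. length (advice (A \<kappa> m)) + length (qgates (A \<kappa> m)) \<le> (\<kappa> + m) ^ c + c)"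

definition comp_indist :: "(nat \<Rightarrow> bool list pmf) \<Rightarrow> (nat \<Rightarrow> bool list pmf) \<Rightarrow> bool" where
  "comp_indist X Y \<longleftrightarrow> (\<forall>A. qpt_adversary A \<longrightarrow>
     negligible (\<lambda>\<kappa>. measure_pmf.expectation (X \<kappa>) (\<lambda>w. accept_prob (A \<kappa> (length w)) w)
                   - measure_pmf.expectation (Y \<kappa>) (\<lambda>w. accept_prob (A \<kappa> (length w)) w)))"


section \<open>Post-quantum indistinguishability obfuscation\<close>

definition post_quantum_iO :: "(nat \<Rightarrow> circuit \<Rightarrow> circuit pmf) \<Rightarrow> bool" where
  "post_quantum_iO obf \<longleftrightarrow>
     ppt {(\<kappa>, C). \<exists>n m. C \<in> circuits n m} (\<lambda>(\<kappa>, C). [unary \<kappa>, encode C])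
         (\<lambda>(\<kappa>, C). map_pmf encode (obf \<kappa> C))
   \<and> (\<forall>\<kappa> n m. \<forall>C \<in> circuits n m. \<forall>C' \<in> set_pmf (obf \<kappa> C).
        C' \<in> circuits n m \<and> (\<forall>x \<in> bits n. eval_circuit C' x = eval_circuit C x))
   \<and> (\<forall>n m C0 C1.
        (\<forall>\<kappa>. C0 \<kappa> \<in> circuits (n \<kappa>) (m \<kappa>) \<and> C1 \<kappa> \<in> circuits (n \<kappa>) (m \<kappa>)
           \<and> circuit_size (C0 \<kappa>) = circuit_size (C1 \<kappa>)
           \<and> (\<forall>x \<in> bits (n \<kappa>). eval_circuit (C0 \<kappa>) x = eval_circuit (C1 \<kappa>) x))
        \<and> poly_bounded (\<lambda>\<kappa>. circuit_size (C0 \<kappa>))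
        \<longrightarrow> comp_indist (\<lambda>\<kappa>. map_pmf encode (obf \<kappa> (C0 \<kappa>)))
                        (\<lambda>\<kappa>. map_pmf encode (obf \<kappa> (C1 \<kappa>))))"


section \<open>Keyed circuit classes\<close>

text \<open>Keys are bit strings; \<open>K \<kappa>\<close> is the key set and \<open>C \<kappa> k\<close> the circuit with key \<open>k\<close>, whose
  description can be computed from \<open>k\<close>.\<close>

definition keyed_circuit_class ::
    "(nat \<Rightarrow> nat) \<Rightarrow> (nat \<Rightarrow> nat) \<Rightarrow> (nat \<Rightarrow> bool list set) \<Rightarrow> (nat \<Rightarrow> bool list \<Rightarrow> circuit) \<Rightarrow> bool" where
  "keyed_circuit_class n m K C \<longleftrightarrow>
     (\<exists>s. poly_bounded s \<and>
        (\<forall>\<kappa>. \<forall>k \<in> K \<kappa>. C \<kappa> k \<in> circuits (n \<kappa>) (m \<kappa>) \<and> circuit_size (C \<kappa> k) = s \<kappa>))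
   \<and> ppt {(\<kappa>, k). k \<in> K \<kappa>} (\<lambda>(\<kappa>, k). [unary \<kappa>, k]) (\<lambda>(\<kappa>, k). return_pmf (encode (C \<kappa> k)))"

definition efficiently_samplable_on :: "(nat \<Rightarrow> bool list set) \<Rightarrow> (nat \<Rightarrow> bool list pmf) \<Rightarrow> bool" where
  "efficiently_samplable_on K D \<longleftrightarrow>
     (\<forall>\<kappa>. set_pmf (D \<kappa>) \<subseteq> K \<kappa>) \<and> ppt UNIV (\<lambda>\<kappa>. [unary \<kappa>]) D"

definition gen_puncturing ::
    "(nat \<Rightarrow> nat) \<Rightarrow> (nat \<Rightarrow> nat) \<Rightarrow> (nat \<Rightarrow> bool list set) \<Rightarrow> (nat \<Rightarrow> bool list \<Rightarrow> circuit)
      \<Rightarrow> (nat \<Rightarrow> bool list \<Rightarrow> bool list \<Rightarrow> bool list \<Rightarrow> circuit \<Rightarrow> circuit \<Rightarrow> circuit pmf) \<Rightarrow> bool" where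
  "gen_puncturing n m K C P \<longleftrightarrow>
     ppt {(\<kappa>, k, x1, x2, \<mu>1, \<mu>2). k \<in> K \<kappa> \<and> x1 \<in> bits (n \<kappa>) \<and> x2 \<in> bits (n \<kappa>)
            \<and> \<mu>1 \<in> circuits (n \<kappa>) (m \<kappa>) \<and> \<mu>2 \<in> circuits (n \<kappa>) (m \<kappa>)}
         (\<lambda>(\<kappa>, k, x1, x2, \<mu>1, \<mu>2). [unary \<kappa>, k, x1, x2, encode \<mu>1, encode \<mu>2])
         (\<lambda>(\<kappa>, k, x1, x2, \<mu>1, \<mu>2). map_pmf encode (P \<kappa> k x1 x2 \<mu>1 \<mu>2))
   \<and> (\<forall>\<kappa>. \<forall>k \<in> K \<kappa>. \<forall>x1 \<in> bits (n \<kappa>). \<forall>x2 \<in> bits (n \<kappa>).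
        \<forall>\<mu>1 \<in> circuits (n \<kappa>) (m \<kappa>). \<forall>\<mu>2 \<in> circuits (n \<kappa>) (m \<kappa>).
        \<forall>G \<in> set_pmf (P \<kappa> k x1 x2 \<mu>1 \<mu>2).
          G \<in> circuits (n \<kappa>) (m \<kappa>)
        \<and> (\<forall>x \<in> bits (n \<kappa>) - {x1, x2}. eval_circuit G x = eval_circuit (C \<kappa> k) x)
        \<and> eval_circuit G x1 = eval_circuit \<mu>1 x1
        \<and> (x2 \<noteq> x1 \<longrightarrow> eval_circuit G x2 = eval_circuit \<mu>2 x2))"

text \<open>Function classes consist of extensional functions from \<open>bits (n \<kappa>)\<close> to \<open>bits (m \<kappa>)\<close>.\<close>

definition implementation ::
    "(nat \<Rightarrow> nat) \<Rightarrow> (nat \<Rightarrow> nat) \<Rightarrow> (nat \<Rightarrow> bool list set) \<Rightarrow> (nat \<Rightarrow> bool list \<Rightarrow> circuit)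
      \<Rightarrow> (nat \<Rightarrow> bool list pmf)
      \<Rightarrow> (nat \<Rightarrow> (bool list \<Rightarrow> bool list) set) \<Rightarrow> (nat \<Rightarrow> (bool list \<Rightarrow> bool list) pmf) \<Rightarrow> bool" where
  "implementation n m K C D F DF \<longleftrightarrow>
     keyed_circuit_class n m K C
   \<and> efficiently_samplable_on K D
   \<and> (\<forall>\<kappa>. functionality (n \<kappa>) ` C \<kappa> ` K \<kappa> = F \<kappa>)
   \<and> stat_close (\<lambda>\<kappa>. map_pmf (\<lambda>k. functionality (n \<kappa>) (C \<kappa> k)) (D \<kappa>)) DF"


section \<open>Evasive function classes\<close>

text \<open>Boolean functions take their values in \<open>bits 1\<close>, the value 1 being \<open>[True]\<close>.\<close>

definition evasive ::
    "(nat \<Rightarrow> nat) \<Rightarrow> (nat \<Rightarrow> (bool list \<Rightarrow> bool list) set) \<Rightarrow> (nat \<Rightarrow> (bool list \<Rightarrow> bool list) pmf) \<Rightarrow> bool" where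
  "evasive n F DF \<longleftrightarrow>
     (\<forall>\<kappa>. F \<kappa> \<subseteq> (bits (n \<kappa>) \<rightarrow>\<^sub>E bits 1) \<and> set_pmf (DF \<kappa>) \<subseteq> F \<kappa>)
   \<and> (\<forall>x. (\<forall>\<kappa>. x \<kappa> \<in> bits (n \<kappa>)) \<longrightarrow>
        negligible (\<lambda>\<kappa>. measure_pmf.prob (DF \<kappa>) {f. f (x \<kappa>) = [True]}))"

definition preimage1 :: "nat \<Rightarrow> (bool list \<Rightarrow> bool list) \<Rightarrow> bool list set" where
  "preimage1 n f = {x \<in> bits n. f x = [True]}"

text \<open>A pair of a circuit and a point is handed to the adversary as one string; the circuit
  description starts with the length of the point, so that it can be parsed.\<close>

definition enc_pair :: "circuit \<times> bool list \<Rightarrow> bool list" where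
  "enc_pair p = encode (fst p) @ snd p"

definition preimage_samplable_evasive ::
    "(nat \<Rightarrow> nat) \<Rightarrow> (nat \<Rightarrow> (bool list \<Rightarrow> bool list) set) \<Rightarrow> (nat \<Rightarrow> (bool list \<Rightarrow> bool list) pmf) \<Rightarrow> bool" where
  "preimage_samplable_evasive n F DF \<longleftrightarrow>
     evasive n F DF \<and>
     (\<exists>K C D K' C' P D'.
        implementation n (\<lambda>_. 1) K C D F DF
      \<and> (\<forall>\<kappa>. \<forall>k \<in> set_pmf (D \<kappa>). preimage1 (n \<kappa>) (eval_circuit (C \<kappa> k)) \<noteq> {})
      \<and> keyed_circuit_class n (\<lambda>_. 1) K' C'
      \<and> gen_puncturing n (\<lambda>_. 1) K' C' P
      \<and> efficiently_samplable_on K' D'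
      \<and> comp_indist
          (\<lambda>\<kappa>. map_pmf enc_pair (do {
             k \<leftarrow> D \<kappa>;
             x \<leftarrow> pmf_of_set (preimage1 (n \<kappa>) (eval_circuit (C \<kappa> k)));
             return_pmf (C \<kappa> k, x) }))
          (\<lambda>\<kappa>. map_pmf enc_pair (do {
             k' \<leftarrow> D' \<kappa>;
             y \<leftarrow> pmf_of_set (bits (n \<kappa>));
             G \<leftarrow> P \<kappa> k' y y (const_one (n \<kappa>)) (const_one (n \<kappa>));
             return_pmf (G, y) })))"

definition weight_class :: "(nat \<Rightarrow> nat) \<Rightarrow> (nat \<Rightarrow> nat) \<Rightarrow> nat \<Rightarrow> (bool list \<Rightarrow> bool list) set" where
  "weight_class n t \<kappa> = {f \<in> bits (n \<kappa>) \<rightarrow>\<^sub>E bits 1. card (preimage1 (n \<kappa>) f) = t \<kappa>}"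

definition uniform_weight :: "(nat \<Rightarrow> nat) \<Rightarrow> (nat \<Rightarrow> nat) \<Rightarrow> nat \<Rightarrow> (bool list \<Rightarrow> bool list) pmf" where
  "uniform_weight n t \<kappa> = pmf_of_set (weight_class n t \<kappa>)"

end

theory Submission
  imports Defs
begin

text \<open>The circuits of the new implementation of the class of weight \<open>r\<close> are obfuscations of the given ones,
  padded to a common size before and after obfuscating; the encoding of such a circuit serves as its
  own key. The auxiliary class is the given implementation of weight \<open>r - 1\<close>, and puncturing
  hardwires the two values, pads, and obfuscates. A uniform function of weight \<open>r\<close> with a uniform
  preimage of 1 is distributed like \<open>(g(y := 1), y)\<close> for uniform \<open>g\<close> of weight \<open>r - 1\<close> and uniform
  \<open>y\<close> conditioned on \<open>g y = 0\<close>, and evasiveness makes \<open>r / 2^n\<close>, hence the conditioning, negligible.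
  It remains to replace circuits by equivalent ones: an average over pairs of a circuit and a
  point is dominated by a worst pair, whose point the non-uniform distinguisher against the
  obfuscator takes as advice.\<close>

section \<open>Polynomial bounds and the stack machine\<close>

text \<open>The obstacle: \<open>keyed_circuit_class\<close> asks for a deterministic map from keys
  to circuits of one size, while an obfuscator is randomized and its output length is controlled
  only through its running time. Using the obfuscated circuit itself as key moves all randomness
  into the key distribution and leaves only a projection to be computed. On the auxiliary side the
  obfuscation sits inside the puncturing algorithm, which may be randomized, so the given class
  stays as it is. Statistical closeness speaks of functions, whereas the adversary sees circuits.
  The bridge is a representative circuit that depends on the function only: once it replaces each
  circuit before obfuscation, acceptance depends on the pair (function, point) alone, and both
  closeness and counting apply. The choice of representatives needs no algorithm, as security of the
  obfuscator is stated for arbitrary sequences of circuits. Polynomial time refers to one concrete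
  machine, so padding, evaluating and patching are given as programs, which takes up much of the
  proof.\<close>

lemma poly_bounded_iff: "poly_bounded f \<longleftrightarrow> (\<exists>e. \<forall>k. f k \<le> (k + 2) ^ e)"
proof
  assume "poly_bounded f"
  then obtain c where c: "\<And>k. f k \<le> k ^ c + c" unfolding poly_bounded_def by auto
  \<comment> \<open>Both summands are at most \<open>(k + 2) ^ c\<close>; one more factor
    \<open>k + 2\<close>, being at least 2, absorbs their sum.\<close>
  have "f k \<le> (k + 2) ^ (c + 1)" for k
  proof -
    have "k ^ c \<le> (k + 2) ^ c" by (rule power_mono) auto
    moreover have "c \<le> (k + 2) ^ c"
    proof -
      have "c \<le> 2 ^ c" by (rule less_imp_le, rule less_exp)
      also have "(2::nat) ^ c \<le> (k + 2) ^ c" by (rule power_mono) auto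
      finally show ?thesis .
    qed
    ultimately have "f k \<le> 2 * (k + 2) ^ c" using c[of k] by linarith
    also have "\<dots> \<le> (k + 2) * (k + 2) ^ c" by (rule mult_right_mono) auto
    finally show ?thesis by simp
  qed
  then show "\<exists>e. \<forall>k. f k \<le> (k + 2) ^ e" by blast
next
  assume "\<exists>e. \<forall>k. f k \<le> (k + 2) ^ e"
  then obtain e where e: "\<And>k. f k \<le> (k + 2) ^ e" by auto
  \<comment> \<open>The additive part covers \<open>k < 2\<close>, where \<open>k + 2\<close> is at
    most 3. For larger \<open>k\<close>, \<open>k + 2\<close> is at most \<open>k ^ 2\<close>,
    whence the exponent \<open>2 * e\<close>.\<close>
  have "f k \<le> k ^ (3 ^ e + 2 * e) + (3 ^ e + 2 * e)" for k
  proof (cases "k < 2")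
    case True
    have "f k \<le> (k + 2) ^ e" by (rule e)
    also have "\<dots> \<le> 3 ^ e" by (rule power_mono) (use True in auto)
    finally show ?thesis by linarith
  next
    case False
    have "k + 2 \<le> k ^ 2"
    proof -
      have "k + 2 \<le> k + k" using False by simp
      also have "\<dots> = 2 * k" by simp
      also have "\<dots> \<le> k * k" using False by (intro mult_right_mono) auto
      finally show ?thesis by (simp add: power2_eq_square)
    qed
    have "f k \<le> (k + 2) ^ e" by (rule e)
    also have "\<dots> \<le> (k ^ 2) ^ e" by (rule power_mono) (use \<open>k + 2 \<le> k ^ 2\<close> in auto)
    also have "\<dots> = k ^ (2 * e)" by (simp add: power_mult)
    also have "\<dots> \<le> k ^ (3 ^ e + 2 * e)" by (rule power_increasing) (use False in auto)
    finally show ?thesis by linarith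
  qed
  then show "poly_bounded f" unfolding poly_bounded_def by blast
qed

lemma poly_bounded_mono:
  assumes "poly_bounded g" "\<And>k. f k \<le> g k"
  shows "poly_bounded f"
proof -
  obtain c where "\<And>k. g k \<le> k ^ c + c" using assms(1) unfolding poly_bounded_def by blast
  then have "f k \<le> k ^ c + c" for k using assms(2) le_trans by blast
  then show ?thesis unfolding poly_bounded_def by blast
qed

lemma poly_bounded_id [simp, intro]: "poly_bounded (\<lambda>k. k)"
  unfolding poly_bounded_iff by (rule exI[of _ 1]) auto

lemma poly_bounded_const [simp, intro]: "poly_bounded (\<lambda>k. c)"
  unfolding poly_bounded_def by (rule exI[of _ c]) auto

lemma poly_bounded_mult [intro]:
  assumes "poly_bounded f" "poly_bounded g"
  shows "poly_bounded (\<lambda>k. f k * g k)"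
proof -
  obtain e e' where "\<And>k. f k \<le> (k + 2) ^ e" "\<And>k. g k \<le> (k + 2) ^ e'"
    using assms unfolding poly_bounded_iff by blast
  then have "\<And>k. f k * g k \<le> (k + 2) ^ (e + e')"
    unfolding power_add by (intro mult_mono) auto
  then show ?thesis unfolding poly_bounded_iff by blast
qed

lemma poly_bounded_add [intro]:
  assumes "poly_bounded f" "poly_bounded g"
  shows "poly_bounded (\<lambda>k. f k + g k)"
proof (rule poly_bounded_mono)
  \<comment> \<open>A sum is dominated by the product of the successors, which reduces addition to
    multiplication.\<close>
  show "poly_bounded (\<lambda>k. (f k + 1) * (g k + 1))"
  proof (rule poly_bounded_mult)
    have "poly_bounded (\<lambda>k. f k + 1)" if pb: "poly_bounded f" for f
    proof -
      obtain e where e: "\<And>k. f k \<le> (k + 2) ^ e" using pb unfolding poly_bounded_iff by blast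
      have "f k + 1 \<le> (k + 2) ^ (e + 1)" for k
      proof -
        have "f k + 1 \<le> (k + 2) ^ e + (k + 2) ^ e" using e[of k] by (intro add_mono) auto
        also have "\<dots> = 2 * (k + 2) ^ e" by simp
        also have "\<dots> \<le> (k + 2) * (k + 2) ^ e" by (intro mult_right_mono) auto
        finally show ?thesis by simp
      qed
      then show ?thesis unfolding poly_bounded_iff by blast
    qed
    then show "poly_bounded (\<lambda>k. f k + 1)" "poly_bounded (\<lambda>k. g k + 1)" using assms by auto
  qed
qed simp

lemma poly_bounded_power [intro]: "poly_bounded f \<Longrightarrow> poly_bounded (\<lambda>k. f k ^ c)"
  by (induction c) auto

section \<open>Runs of the machine and their sequential composition\<close>

lemma run_halted [simp]: "run t ([], s) = return_pmf ([], s)"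
  by (induction t) (auto simp: bind_return_pmf)

lemma run_add: "run (t + u) cf = bind_pmf (run t cf) (run u)"
proof (induction t arbitrary: cf)
  case (Suc t)
  have "run (t + u) = (\<lambda>cf. bind_pmf (run t cf) (run u))" using Suc by (rule ext)
  then show ?case by (simp add: bind_assoc_pmf)
qed (simp add: bind_return_pmf)

text \<open>One equation records both that every branch has halted and the joint law of all
  registers. The time need not be exact, since a halted configuration stays put.\<close>

definition halts :: "nat \<Rightarrow> config \<Rightarrow> (nat \<Rightarrow> bool list) pmf \<Rightarrow> bool" where
  "halts t cf D \<longleftrightarrow> run t cf = map_pmf (Pair []) D"

lemma halts_mono: assumes "halts t cf D" "t \<le> t'" shows "halts t' cf D"
proof -
  obtain u where u: "t' = t + u" using assms(2) le_Suc_ex by blast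
  show ?thesis using assms(1) unfolding halts_def u run_add
    by (simp add: bind_assoc_pmf bind_return_pmf map_pmf_def)
qed

lemma halts_Nil [simp]: "halts t ([], s) (return_pmf s)"
  by (simp add: halts_def)

lemma halts_iff: "halts t cf D \<longleftrightarrow> (\<forall>cf' \<in> set_pmf (run t cf). fst cf' = []) \<and> D = map_pmf snd (run t cf)"
proof
  assume "halts t cf D"
  then have r: "run t cf = map_pmf (Pair []) D" by (simp add: halts_def)
  show "(\<forall>cf' \<in> set_pmf (run t cf). fst cf' = []) \<and> D = map_pmf snd (run t cf)"
    unfolding r by (auto simp: pmf.map_comp o_def)
next
  assume *: "(\<forall>cf' \<in> set_pmf (run t cf). fst cf' = []) \<and> D = map_pmf snd (run t cf)"
  have "map_pmf (Pair []) (map_pmf snd (run t cf)) = map_pmf id (run t cf)"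
    unfolding pmf.map_comp by (rule pmf.map_cong) (use * in \<open>auto simp: prod_eq_iff\<close>)
  with * show "halts t cf D" by (simp add: halts_def)
qed

lemma halts_Nil_unique: assumes "halts t ([], s) D" shows "D = return_pmf s"
  using assms by (simp add: halts_iff)

lemma step_append: assumes "c \<noteq> []"
  shows "step (c @ K, s) = map_pmf (\<lambda>(c', s'). (c' @ K, s')) (step (c, s))"
proof -
  obtain i c' where "c = i # c'" using assms by (cases c) auto
  then show ?thesis by (cases i) (auto simp: pmf.map_comp o_def)
qed

text \<open>The continuation \<open>K\<close> is inert until \<open>c\<close> is used up, so a run
  of \<open>c @ K\<close> is a run of \<open>c\<close> followed by one of \<open>K\<close>. Coin
  flips may let branches of \<open>c\<close> end at different times; a branch that ends early has
  time left over, which \<open>halts_mono\<close> absorbs.\<close>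

lemma halts_append:
  assumes "halts t (c, s) D" "\<And>s'. s' \<in> set_pmf D \<Longrightarrow> halts t' (K, s') (E s')"
  shows "halts (t + t') (c @ K, s) (bind_pmf D E)"
  using assms
proof (induction t arbitrary: c s D)
  case 0
  have c: "c = []" and D: "D = return_pmf s" using 0(1) by (auto simp: halts_iff)
  show ?case using 0(2) unfolding c D by (simp add: bind_return_pmf)
next
  case (Suc t)
  show ?case
  proof (cases "c = []")
    case True
    then have D: "D = return_pmf s" using Suc.prems(1) halts_Nil_unique by blast
    show ?thesis using Suc.prems(2) unfolding True D by (auto simp: bind_return_pmf intro: halts_mono)
  next
    case False
    define D' where "D' = (\<lambda>cf. map_pmf snd (run t cf))"
    have h: "halts t cf (D' cf)" if "cf \<in> set_pmf (step (c, s))" for cf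
      using Suc.prems(1) that by (auto simp: halts_iff D'_def)
    have D: "D = bind_pmf (step (c, s)) D'"
      using Suc.prems(1) by (simp add: halts_iff D'_def map_bind_pmf)
    have IH: "run (t + t') (c' @ K, s') = map_pmf (Pair []) (bind_pmf (D' (c', s')) E)"
      if "(c', s') \<in> set_pmf (step (c, s))" for c' s'
      using Suc.IH[OF h[OF that]] Suc.prems(2) that unfolding halts_def D by auto
    have "run (Suc t + t') (c @ K, s)
        = bind_pmf (step (c, s)) (\<lambda>(c', s'). run (t + t') (c' @ K, s'))"
      by (simp add: step_append[OF False] bind_map_pmf case_prod_unfold)
    also have "\<dots> = bind_pmf (step (c, s)) (\<lambda>cf. map_pmf (Pair []) (bind_pmf (D' cf) E))"
      by (rule bind_pmf_cong) (use IH in auto)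
    also have "\<dots> = map_pmf (Pair []) (bind_pmf D E)"
      by (simp add: D map_bind_pmf bind_assoc_pmf)
    finally show ?thesis by (simp add: halts_def)
  qed
qed

text \<open>For deterministic stretches. Equality of all later runs lets a stretch be followed by
  any continuation, also by one that flips coins. \<open>B\<close> is only a bound, so estimates can
  be rounded up.\<close>

definition reaches :: "nat \<Rightarrow> config \<Rightarrow> config \<Rightarrow> bool" where
  "reaches B cf cf' \<longleftrightarrow> (\<exists>t \<le> B. \<forall>u. run (t + u) cf = run u cf')"

lemma reaches_refl [simp]: "reaches B cf cf"
  unfolding reaches_def by (rule exI[of _ 0]) auto

lemma reaches_trans [trans]:
  assumes "reaches B a b" "reaches B' b c"
  shows "reaches (B + B') a c"
proof -
  obtain t t' where "t \<le> B" "\<And>u. run (t + u) a = run u b" "t' \<le> B'" "\<And>u. run (t' + u) b = run u c"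
    using assms unfolding reaches_def by auto
  then show ?thesis unfolding reaches_def
    by (intro exI[of _ "t + t'"]) (auto simp: add.assoc)
qed

lemma reaches_mono: "reaches B a b \<Longrightarrow> B \<le> B' \<Longrightarrow> reaches B' a b"
  unfolding reaches_def by (meson le_trans)

lemma reaches_step: assumes "step a = return_pmf b" "reaches B b c" shows "reaches (Suc B) a c"
proof -
  have "reaches 1 a b" unfolding reaches_def
    by (rule exI[of _ 1]) (auto simp: assms(1) bind_return_pmf)
  from reaches_trans[OF this assms(2)] show ?thesis by simp
qed

text \<open>Stated backwards with a decreasing budget, so that the simplifier can execute
  straight-line code symbolically.\<close>

lemma reaches_instr:
  "0 < B \<Longrightarrow> reaches (B - 1) (K, s(r := b # s r)) c \<Longrightarrow> reaches B (Push r b # K, s) c"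
  "0 < B \<Longrightarrow> reaches (B - 1) (K, s(r := tl (s r))) c \<Longrightarrow> reaches B (Pop r # K, s) c"
  "0 < B \<Longrightarrow> reaches (B - 1) ((if s r \<noteq> [] \<and> hd (s r) then p else q) @ K, s) c \<Longrightarrow> reaches B (Cond r p q # K, s) c"
  "0 < B \<Longrightarrow> s r \<noteq> [] \<Longrightarrow> reaches (B - 1) (p @ Loop r p # K, s) c \<Longrightarrow> reaches B (Loop r p # K, s) c"
  "0 < B \<Longrightarrow> s r = [] \<Longrightarrow> reaches (B - 1) (K, s) c \<Longrightarrow> reaches B (Loop r p # K, s) c"
  using reaches_step[of _ _ "B - 1" c] by fastforce+

lemma halts_reaches: assumes "reaches B a b" "halts t b D" shows "halts (B + t) a D"
proof -
  obtain t0 where t0: "t0 \<le> B" "\<And>u. run (t0 + u) a = run u b" using assms unfolding reaches_def by auto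
  have "halts (t0 + t) a D" using assms(2) t0(2) unfolding halts_def by simp
  then show ?thesis by (rule halts_mono) (use t0 in simp)
qed

section \<open>Renaming registers\<close>

primrec regs :: "instr \<Rightarrow> nat set" where
  "regs (Push r b) = {r}"
| "regs (Pop r) = {r}"
| "regs (Flip r) = {r}"
| "regs (Cond r c d) = insert r (\<Union>(set (map regs c)) \<union> \<Union>(set (map regs d)))"
| "regs (Loop r c) = insert r (\<Union>(set (map regs c)))"

primrec rename :: "(nat \<Rightarrow> nat) \<Rightarrow> instr \<Rightarrow> instr" where
  "rename \<rho> (Push r b) = Push (\<rho> r) b"
| "rename \<rho> (Pop r) = Pop (\<rho> r)"
| "rename \<rho> (Flip r) = Flip (\<rho> r)"
| "rename \<rho> (Cond r c d) = Cond (\<rho> r) (map (rename \<rho>) c) (map (rename \<rho>) d)"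
| "rename \<rho> (Loop r c) = Loop (\<rho> r) (map (rename \<rho>) c)"

lemma finite_regs: "finite (regs i)"
  by (induction i) auto

lemma rename_id: "rename (\<lambda>r. r) i = i"
  by (induction i) (auto simp: map_idI)

text \<open>The store of a renamed program inside a larger one: \<open>u\<close> lives on the
  renamed registers, and the bystander \<open>s\<close> keeps everything else.\<close>

definition embed_store :: "(nat \<Rightarrow> nat) \<Rightarrow> nat set \<Rightarrow> (nat \<Rightarrow> 'a) \<Rightarrow> (nat \<Rightarrow> 'a) \<Rightarrow> nat \<Rightarrow> 'a" where
  "embed_store \<rho> A s u = (\<lambda>x. if x \<in> \<rho> ` A then u (inv_into A \<rho> x) else s x)"

lemma embed_apply: "inj_on \<rho> A \<Longrightarrow> r \<in> A \<Longrightarrow> embed_store \<rho> A s u (\<rho> r) = u r"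
  by (simp add: embed_store_def)

lemma embed_upd: "inj_on \<rho> A \<Longrightarrow> r \<in> A \<Longrightarrow> embed_store \<rho> A s (u(r := v)) = (embed_store \<rho> A s u)(\<rho> r := v)"
  by (auto simp: embed_store_def fun_eq_iff inv_into_into)

lemma step_rename:
  assumes "inj_on \<rho> A" "\<Union>(set (map regs c)) \<subseteq> A"
  shows "step (map (rename \<rho>) c, embed_store \<rho> A s u)
    = map_pmf (\<lambda>(c', u'). (map (rename \<rho>) c', embed_store \<rho> A s u')) (step (c, u))"
proof (cases c)
  case (Cons i c')
  show ?thesis using assms unfolding Cons
    by (cases i) (auto simp: embed_apply embed_upd pmf.map_comp o_def)
qed simp

lemma step_regs: "cf \<in> set_pmf (step (c, u)) \<Longrightarrow> \<Union>(set (map regs (fst cf))) \<subseteq> \<Union>(set (map regs c))"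
proof (cases c)
  case (Cons i c')
  assume "cf \<in> set_pmf (step (c, u))"
  then show ?thesis unfolding Cons by (cases i) (auto split: if_splits)
qed simp

lemma run_rename:
  assumes "inj_on \<rho> A" "\<Union>(set (map regs c)) \<subseteq> A"
  shows "run t (map (rename \<rho>) c, embed_store \<rho> A s u)
    = map_pmf (\<lambda>(c', u'). (map (rename \<rho>) c', embed_store \<rho> A s u')) (run t (c, u))"
  using assms(2)
proof (induction t arbitrary: c u)
  case (Suc t)
  have "run (Suc t) (map (rename \<rho>) c, embed_store \<rho> A s u)
    = bind_pmf (step (c, u)) (\<lambda>(c', u'). run t (map (rename \<rho>) c', embed_store \<rho> A s u'))"
    by (simp add: step_rename[OF assms(1) Suc.prems] bind_map_pmf case_prod_unfold)
  also have "\<dots> = bind_pmf (step (c, u))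
      (\<lambda>cf. map_pmf (\<lambda>(c', u'). (map (rename \<rho>) c', embed_store \<rho> A s u')) (run t cf))"
  proof (rule bind_pmf_cong)
    fix cf assume "cf \<in> set_pmf (step (c, u))"
    then have "\<Union>(set (map regs (fst cf))) \<subseteq> A" using step_regs Suc.prems by blast
    then show "(case cf of (c', u') \<Rightarrow> run t (map (rename \<rho>) c', embed_store \<rho> A s u'))
      = map_pmf (\<lambda>(c', u'). (map (rename \<rho>) c', embed_store \<rho> A s u')) (run t cf)"
      using Suc.IH[of "fst cf" "snd cf"] by (simp add: case_prod_unfold)
  qed simp
  finally show ?case by (simp add: map_bind_pmf)
qed simp

text \<open>Used in two ways by \<open>ppt_call\<close>. A shift relocates a subroutine to fresh
  registers. The identity on an initial segment of registers is a frame rule: a program that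
  mentions only these registers is not disturbed by what others contain.\<close>

lemma halts_rename:
  assumes "inj_on \<rho> A" "\<Union>(set (map regs c)) \<subseteq> A" "halts t (c, u) D"
  shows "halts t (map (rename \<rho>) c, embed_store \<rho> A s u) (map_pmf (embed_store \<rho> A s) D)"
  using assms(3) unfolding halts_def run_rename[OF assms(1,2)] by (simp add: pmf.map_comp o_def)

lemma step_length:
  assumes "(c', s') \<in> set_pmf (step (c, s))"
  shows "length (s' r) \<le> Suc (length (s r))"
proof (cases c)
  case (Cons i c'')
  show ?thesis using assms unfolding Cons by (cases i) (auto split: if_splits)
qed (use assms in simp)

lemma run_length: "cf \<in> set_pmf (run t (c, s)) \<Longrightarrow> length (snd cf r) \<le> length (s r) + t"
proof (induction t arbitrary: c s)
  case (Suc t)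
  then obtain c' s' where *: "(c', s') \<in> set_pmf (step (c, s))" "cf \<in> set_pmf (run t (c', s'))" by auto
  show ?case using Suc.IH[OF *(2)] step_length[OF *(1), of r] by simp
qed simp

lemma halts_length: "halts t (c, s) D \<Longrightarrow> s' \<in> set_pmf D \<Longrightarrow> length (s' r) \<le> length (s r) + t"
  using run_length[of _ t c s r] by (auto simp: halts_iff)

section \<open>Polynomial time with arbitrary polynomial bounds\<close>

abbreviation args_size :: "bool list list \<Rightarrow> nat" where
  "args_size xs \<equiv> sum_list (map length xs)"

lemma ppt_iff: "ppt I args f \<longleftrightarrow> (\<exists>prog T. poly_bounded T \<and> (\<forall>i \<in> I. \<exists>D.
    halts (T (args_size (args i))) (prog, load (args i)) D \<and> map_pmf (\<lambda>s. s 0) D = f i))"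
proof
  assume "ppt I args f"
  then obtain prog c where *: "\<And>i. i \<in> I \<Longrightarrow>
     (let final = run (args_size (args i) ^ c + c) (prog, load (args i)) in
       (\<forall>cf\<in>set_pmf final. fst cf = []) \<and> map_pmf (\<lambda>cf. snd cf 0) final = f i)"
    unfolding ppt_def by metis
  show "\<exists>prog T. poly_bounded T \<and> (\<forall>i \<in> I. \<exists>D.
    halts (T (args_size (args i))) (prog, load (args i)) D \<and> map_pmf (\<lambda>s. s 0) D = f i)"
    by (rule exI[of _ prog], rule exI[of _ "\<lambda>L. L ^ c + c"])
      (use * in \<open>auto simp: Let_def halts_iff pmf.map_comp o_def intro!: poly_bounded_add poly_bounded_power\<close>)
next
  assume "\<exists>prog T. poly_bounded T \<and> (\<forall>i \<in> I. \<exists>D.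
    halts (T (args_size (args i))) (prog, load (args i)) D \<and> map_pmf (\<lambda>s. s 0) D = f i)"
  then obtain prog T c where T: "\<And>k. T k \<le> k ^ c + c" and
    h: "\<And>i. i \<in> I \<Longrightarrow> \<exists>D. halts (T (args_size (args i))) (prog, load (args i)) D \<and> map_pmf (\<lambda>s. s 0) D = f i"
    unfolding poly_bounded_def by metis
  show "ppt I args f" unfolding ppt_def
  proof (rule exI[of _ prog], rule exI[of _ c], intro ballI)
    fix i assume "i \<in> I"
    then obtain D where D: "halts (T (args_size (args i))) (prog, load (args i)) D" "map_pmf (\<lambda>s. s 0) D = f i"
      using h by blast
    have "halts (args_size (args i) ^ c + c) (prog, load (args i)) D" by (rule halts_mono[OF D(1) T])
    then show "let final = run (args_size (args i) ^ c + c) (prog, load (args i)) in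
       (\<forall>cf\<in>set_pmf final. fst cf = []) \<and> map_pmf (\<lambda>cf. snd cf 0) final = f i"
      using D(2) by (auto simp: Let_def halts_iff pmf.map_comp o_def)
  qed
qed

lemma pptI_det:
  assumes "poly_bounded T"
    and "\<And>i. i \<in> I \<Longrightarrow> \<exists>s. reaches (T (args_size (args i))) (prog, load (args i)) ([], s) \<and> s 0 = out i"
  shows "ppt I args (\<lambda>i. return_pmf (out i))"
  unfolding ppt_iff
proof (rule exI[of _ prog], rule exI[of _ T], intro conjI ballI)
  fix i assume "i \<in> I"
  then obtain s where s: "reaches (T (args_size (args i))) (prog, load (args i)) ([], s)" "s 0 = out i"
    using assms(2) by blast
  show "\<exists>D. halts (T (args_size (args i))) (prog, load (args i)) D \<and> map_pmf (\<lambda>s. s 0) D = return_pmf (out i)"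
    by (rule exI[of _ "return_pmf s"]) (use halts_reaches[OF s(1) halts_Nil[of 0]] s(2) in auto)
qed (rule assms(1))

lemma length_load_le: "length (load xs j) \<le> args_size xs"
  by (auto simp: load_def intro: member_le_sum_list)

text \<open>Time bounds length, as an instruction adds at most one bit to a register. The sizes of
  patched and of obfuscated circuits are bounded in this way; for the latter nothing but the running
  time is known.\<close>

lemma ppt_output_length:
  assumes "ppt I args f"
  shows "\<exists>e. \<forall>i \<in> I. \<forall>w \<in> set_pmf (f i). length w \<le> (args_size (args i) + 2) ^ e"
proof -
  obtain prog T where T: "poly_bounded T" and
    h: "\<And>i. i \<in> I \<Longrightarrow> \<exists>D. halts (T (args_size (args i))) (prog, load (args i)) D \<and> map_pmf (\<lambda>s. s 0) D = f i"
    using assms unfolding ppt_iff by metis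
  have "poly_bounded (\<lambda>k. k + T k)" using T by auto
  then obtain e where e: "\<And>k. k + T k \<le> (k + 2) ^ e" unfolding poly_bounded_iff by blast
  have "length w \<le> (args_size (args i) + 2) ^ e" if i: "i \<in> I" and w: "w \<in> set_pmf (f i)" for i w
  proof -
    obtain D where D: "halts (T (args_size (args i))) (prog, load (args i)) D" "map_pmf (\<lambda>s. s 0) D = f i"
      using h[OF i] by auto
    then obtain s where "s \<in> set_pmf D" "w = s 0" using w unfolding D(2)[symmetric] by auto
    then have "length w \<le> length (load (args i) 0) + T (args_size (args i))"
      using halts_length[OF D(1)] by simp
    then show ?thesis using length_load_le[of "args i" 0] e[of "args_size (args i)"] by linarith
  qed
  then show ?thesis by blast
qed

section \<open>Moving and copying registers\<close>

definition move :: "nat \<Rightarrow> nat \<Rightarrow> instr" where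
  "move r d = Loop r [Cond r [Pop r, Push d True] [Pop r, Push d False]]"

lemma reaches_move:
  assumes "r \<noteq> d"
  shows "reaches (4 * length (s r) + 1) (move r d # K, s) (K, s(r := [], d := rev (s r) @ s d))"
proof (induction "s r" arbitrary: s)
  case Nil
  then have eq: "s(r := [], d := rev (s r) @ s d) = s" by (auto simp: fun_eq_iff)
  then show ?case using Nil unfolding eq move_def by (simp add: reaches_instr(5))
next
  case (Cons b xs)
  define s1 where "s1 = s(r := xs, d := b # s d)"
  have r: "s r = b # xs" using Cons.hyps(2) by simp
  have "reaches 4 (move r d # K, s) (move r d # K, s1)"
    unfolding move_def
    using r assms by (cases b) (simp_all add: reaches_instr r s1_def)
  also have "reaches (4 * length (s1 r) + 1) (move r d # K, s1) (K, s(r := [], d := rev (s r) @ s d))"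
  proof -
    have "s1(r := [], d := rev (s1 r) @ s1 d) = s(r := [], d := rev (s r) @ s d)"
      using assms r by (auto simp: s1_def fun_eq_iff)
    moreover have "reaches (4 * length (s1 r) + 1) (move r d # K, s1) (K, s1(r := [], d := rev (s1 r) @ s1 d))"
      by (rule Cons.hyps(1)) (use assms in \<open>simp add: s1_def\<close>)
    ultimately show ?thesis by simp
  qed
  finally show ?case using r assms by (simp add: s1_def)
qed

definition move2 :: "nat \<Rightarrow> nat \<Rightarrow> nat \<Rightarrow> instr" where
  "move2 t r d = Loop t [Cond t [Pop t, Push r True, Push d True] [Pop t, Push r False, Push d False]]"

lemma reaches_move2:
  assumes "distinct [t, r, d]"
  shows "reaches (5 * length (s t) + 1) (move2 t r d # K, s)
    (K, s(t := [], r := rev (s t) @ s r, d := rev (s t) @ s d))"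
proof (induction "s t" arbitrary: s)
  case Nil
  then have eq: "s(t := [], r := rev (s t) @ s r, d := rev (s t) @ s d) = s" by (auto simp: fun_eq_iff)
  then show ?case using Nil unfolding eq move2_def by (simp add: reaches_instr(5))
next
  case (Cons b xs)
  define s1 where "s1 = s(t := xs, r := b # s r, d := b # s d)"
  have r: "s t = b # xs" using Cons.hyps(2) by simp
  have "reaches 5 (move2 t r d # K, s) (move2 t r d # K, s1)"
    unfolding move2_def
    using r assms by (cases b) (simp_all add: reaches_instr r s1_def)
  also have "reaches (5 * length (s1 t) + 1) (move2 t r d # K, s1)
      (K, s(t := [], r := rev (s t) @ s r, d := rev (s t) @ s d))"
  proof -
    have "s1(t := [], r := rev (s1 t) @ s1 r, d := rev (s1 t) @ s1 d)
      = s(t := [], r := rev (s t) @ s r, d := rev (s t) @ s d)"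
      using assms r by (auto simp: s1_def fun_eq_iff)
    moreover have "reaches (5 * length (s1 t) + 1) (move2 t r d # K, s1)
      (K, s1(t := [], r := rev (s1 t) @ s1 r, d := rev (s1 t) @ s1 d))"
      by (rule Cons.hyps(1)) (use assms in \<open>simp add: s1_def\<close>)
    ultimately show ?thesis by simp
  qed
  finally show ?case using r assms by (simp add: s1_def)
qed

text \<open>Moving a stack reverses it. The detour through the scratch register \<open>t\<close>
  therefore restores \<open>r\<close> and at the same time puts the bits on \<open>d\<close> in
  their original order.\<close>

definition copy :: "nat \<Rightarrow> nat \<Rightarrow> nat \<Rightarrow> instr list" where
  "copy r t d = [move r t, move2 t r d]"

lemma reaches_copy:
  assumes "distinct [t, r, d]" "s t = []"
  shows "reaches (9 * length (s r) + 2) (copy r t d @ K, s) (K, s(d := s r @ s d))"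
proof -
  have "reaches (4 * length (s r) + 1) (copy r t d @ K, s) (move2 t r d # K, s(r := [], t := rev (s r)))"
    using reaches_move[of r t s] assms by (simp add: copy_def)
  also have "reaches (5 * length (s r) + 1) \<dots> (K, s(d := s r @ s d))"
  proof -
    have "s(r := [], t := [], r := s r, d := s r @ s d) = s(d := s r @ s d)"
      using assms by (auto simp: fun_eq_iff)
    then show ?thesis
      using reaches_move2[OF assms(1), of "s(r := [], t := rev (s r))" K] assms by simp
  qed
  finally show ?thesis by (rule reaches_mono) simp
qed

lemma reaches_moveI:
  "r \<noteq> d \<Longrightarrow> length (s r) \<le> L \<Longrightarrow> 4 * L + 1 \<le> B \<Longrightarrow> s(r := [], d := rev (s r) @ s d) = s'
    \<Longrightarrow> reaches B (move r d # K, s) (K, s')"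
  using reaches_mono[OF reaches_move[of r d s K], of B] by auto

lemma reaches_copyI:
  "distinct [t, r, d] \<Longrightarrow> s t = [] \<Longrightarrow> length (s r) \<le> L \<Longrightarrow> 9 * L + 2 \<le> B \<Longrightarrow> s(d := s r @ s d) = s'
    \<Longrightarrow> reaches B (copy r t d @ K, s) (K, s')"
  using reaches_mono[OF reaches_copy[of t r d s K], of B] by auto

text \<open>The resulting store is the one in which a subroutine relocated by \<open>N + 1\<close>
  expects to start; register \<open>N\<close> is the scratch register of all copies.\<close>

lemma reaches_copies:
  assumes "\<And>j. j \<in> set sel \<Longrightarrow> j < N" "s N = []" "\<And>x. N < x \<Longrightarrow> s x = []"
    "\<And>j. length (s j) \<le> L"
  shows "reaches (length sel * (9 * L + 2)) (concat (map (\<lambda>p. copy (sel ! p) N (N + 1 + p)) [0..<length sel]) @ K, s)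
    (K, \<lambda>x. if N < x then load (map s sel) (x - (N + 1)) else s x)"
  using assms(1)
proof (induction sel arbitrary: K rule: rev_induct)
  case Nil
  have "(\<lambda>x. if N < x then load (map s []) (x - (N + 1)) else s x) = s"
    using assms(3) by (auto simp: load_def fun_eq_iff)
  then show ?case by (simp only:) simp
next
  case (snoc j sel)
  let ?st = "\<lambda>sel x. if N < x then load (map s sel) (x - (N + 1)) else s x"
  let ?k = "length sel"
  have st: "(?st sel)(N + 1 + ?k := ?st sel j @ ?st sel (N + 1 + ?k)) = ?st (sel @ [j])"
    using snoc.prems[of j] by (auto simp: load_def fun_eq_iff nth_append)
  have "concat (map (\<lambda>p. copy ((sel @ [j]) ! p) N (N + 1 + p)) [0..<length (sel @ [j])]) @ K
    = concat (map (\<lambda>p. copy (sel ! p) N (N + 1 + p)) [0..<?k]) @ copy j N (N + 1 + ?k) @ K"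
    by (auto simp: nth_append intro!: arg_cong[where f = concat] map_cong)
  moreover have "reaches (?k * (9 * L + 2)) (concat (map (\<lambda>p. copy (sel ! p) N (N + 1 + p)) [0..<?k]) @ copy j N (N + 1 + ?k) @ K, s)
    (copy j N (N + 1 + ?k) @ K, ?st sel)"
    by (rule snoc.IH) (use snoc.prems in auto)
  moreover have "reaches (9 * L + 2) (copy j N (N + 1 + ?k) @ K, ?st sel) (K, ?st (sel @ [j]))"
  proof -
    have "reaches (9 * length (?st sel j) + 2) (copy j N (N + 1 + ?k) @ K, ?st sel)
        (K, (?st sel)(N + 1 + ?k := ?st sel j @ ?st sel (N + 1 + ?k)))"
      by (rule reaches_copy) (use assms(2) snoc.prems[of j] in auto)
    then have "reaches (9 * length (?st sel j) + 2) (copy j N (N + 1 + ?k) @ K, ?st sel) (K, ?st (sel @ [j]))"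
      unfolding st .
    then show ?thesis
      by (rule reaches_mono) (use assms(4)[of j] snoc.prems[of j] in auto)
  qed
  ultimately show ?case using reaches_trans by (fastforce simp: algebra_simps)
qed

section \<open>Calling a subroutine\<close>

lemma args_size_select:
  assumes "\<And>j. j \<in> set sel \<Longrightarrow> j < length xs"
  shows "args_size (map ((!) xs) sel) \<le> length sel * args_size xs"
  using assms
proof (induction sel)
  case (Cons j sel)
  have "length (xs ! j) \<le> args_size xs" using Cons.prems[of j] by (intro member_le_sum_list) auto
  with Cons show ?case by auto
qed simp

text \<open>The subroutine runs on fresh registers, above those that the remaining program mentions.\<close>

theorem ppt_call:
  assumes sub: "ppt J sub_args g"
    and rest: "ppt {(i, w). i \<in> I \<and> w \<in> set_pmf (g (h i))} (\<lambda>(i, w). args i @ [w]) (\<lambda>(i, w). rest i w)"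
    and sel: "\<And>i. i \<in> I \<Longrightarrow> h i \<in> J \<and> sub_args (h i) = map ((!) (args i)) sel"
    and len: "\<And>i. i \<in> I \<Longrightarrow> length (args i) = m" "\<And>j. j \<in> set sel \<Longrightarrow> j < m"
  shows "ppt I args (\<lambda>i. bind_pmf (g (h i)) (rest i))"
proof -
  obtain p1 c1 where h1: "\<And>j. j \<in> J \<Longrightarrow> \<exists>D.
      halts (args_size (sub_args j) ^ c1 + c1) (p1, load (sub_args j)) D \<and> map_pmf (\<lambda>s. s 0) D = g j"
    using sub unfolding ppt_def Let_def halts_iff
    by (fastforce simp: pmf.map_comp o_def)
  obtain p2 c2 where h2: "\<And>i w. i \<in> I \<Longrightarrow> w \<in> set_pmf (g (h i)) \<Longrightarrow> \<exists>D.
      halts (args_size (args i @ [w]) ^ c2 + c2) (p2, load (args i @ [w])) D \<and> map_pmf (\<lambda>s. s 0) D = rest i w"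
    using rest unfolding ppt_def Let_def halts_iff
    by (fastforce simp: pmf.map_comp o_def)
  have "finite (\<Union>(set (map regs p2)) \<union> {..m})" using finite_regs by auto
  then obtain N where N: "\<And>x. x \<in> \<Union>(set (map regs p2)) \<union> {..m} \<Longrightarrow> x < N"
    by (metis finite_nat_set_iff_bounded)
  then have mN: "m < N" by auto
  define \<rho> where "\<rho> = (\<lambda>x. N + 1 + x)"
  have inj: "inj_on \<rho> UNIV" by (auto simp: \<rho>_def inj_on_def)
  have embed_\<rho>: "embed_store \<rho> UNIV s u = (\<lambda>x. if N < x then u (x - (N + 1)) else s x)" for s u :: "nat \<Rightarrow> bool list"
  proof
    fix x
    show "embed_store \<rho> UNIV s u x = (if N < x then u (x - (N + 1)) else s x)"
    proof (cases "N < x")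
      case True
      then have "x = \<rho> (x - (N + 1))" by (simp add: \<rho>_def)
      then show ?thesis using True embed_apply[OF inj, of "x - (N + 1)" s u] by auto
    next
      case False
      then have "x \<notin> \<rho> ` UNIV" by (auto simp: \<rho>_def)
      then show ?thesis using False by (simp add: embed_store_def)
    qed
  qed
  \<comment> \<open>The subroutine leaves its result in the relocated register 0, that is
    \<open>N + 1\<close>. It goes to register \<open>m\<close>, the first one behind the arguments;
    the detour through the empty register \<open>N\<close> cancels the reversal.\<close>
  define prog where "prog = concat (map (\<lambda>p. copy (sel ! p) N (N + 1 + p)) [0..<length sel])
    @ map (rename \<rho>) p1 @ [move (N + 1) N, move N m] @ p2"
  define k where "k = length sel"
  \<comment> \<open>\<open>T1\<close> bounds the subroutine on arguments of total length at most
    \<open>k * L\<close>, \<open>W\<close> the length of its result (input length plus time), and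
    \<open>T2\<close> the remaining program, whose input includes that result.\<close>
  define T1 where "T1 = (\<lambda>L. (k * L) ^ c1 + c1)"
  define W where "W = (\<lambda>L. k * L + T1 L)"
  define T2 where "T2 = (\<lambda>L. (L + W L) ^ c2 + c2)"
  define T where "T = (\<lambda>L. k * (9 * L + 2) + (T1 L + ((8 * W L + 2) + T2 L)))"
  have pbT1: "poly_bounded T1" unfolding T1_def by (intro poly_bounded_add poly_bounded_mult poly_bounded_power poly_bounded_id poly_bounded_const)
  have pbW: "poly_bounded W" unfolding W_def by (intro poly_bounded_add poly_bounded_mult poly_bounded_power poly_bounded_id poly_bounded_const pbT1)
  have pbT: "poly_bounded T" unfolding T_def T2_def by (intro poly_bounded_add poly_bounded_mult poly_bounded_power poly_bounded_id poly_bounded_const pbT1 pbW)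
  have "\<exists>D. halts (T (args_size (args i))) (prog, load (args i)) D \<and> map_pmf (\<lambda>s. s 0) D = bind_pmf (g (h i)) (rest i)"
    if i: "i \<in> I" for i
  proof -
    define L where "L = args_size (args i)"
    define s0 where "s0 = load (args i)"
    have lenm: "length (args i) = m" using len(1)[OF i] .
    have s0_empty: "s0 x = []" if "m \<le> x" for x using that lenm by (simp add: s0_def load_def)
    have sub_eq: "sub_args (h i) = map s0 sel"
      using sel[OF i] len(2) lenm by (auto simp: s0_def load_def)
    have hJ: "h i \<in> J" using sel[OF i] by simp
    have size1: "args_size (sub_args (h i)) \<le> k * L"
      using args_size_select[of sel "args i"] sel[OF i] len(2) lenm by (simp add: k_def L_def)
    obtain D1 where D1: "halts (args_size (sub_args (h i)) ^ c1 + c1) (p1, load (sub_args (h i))) D1"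
        "map_pmf (\<lambda>s. s 0) D1 = g (h i)"
      using h1[OF hJ] by blast
    have D1': "halts (T1 L) (p1, load (sub_args (h i))) D1"
      by (rule halts_mono[OF D1(1)]) (use size1 in \<open>auto simp: T1_def intro!: power_mono\<close>)
    define s1 where "s1 = embed_store \<rho> UNIV s0 (load (sub_args (h i)))"
    have "reaches (k * (9 * L + 2)) (prog, s0) (map (rename \<rho>) p1 @ [move (N + 1) N, move N m] @ p2, s1)"
      unfolding prog_def s1_def embed_\<rho> sub_eq k_def
      by (rule reaches_copies)
        (use len(2) mN s0_empty length_load_le in \<open>auto simp: L_def s0_def intro: less_trans\<close>)
    moreover
    have "halts (T1 L) (map (rename \<rho>) p1, s1) (map_pmf (embed_store \<rho> UNIV s0) D1)"
      unfolding s1_def by (rule halts_rename[OF inj _ D1']) auto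
    moreover
    have "\<forall>w \<in> set_pmf (g (h i)). \<exists>D. halts (args_size (args i @ [w]) ^ c2 + c2) (p2, load (args i @ [w])) D
        \<and> map_pmf (\<lambda>s. s 0) D = rest i w"
      using h2[OF i] by blast
    then obtain D2 where D2: "\<And>w. w \<in> set_pmf (g (h i)) \<Longrightarrow>
        halts (args_size (args i @ [w]) ^ c2 + c2) (p2, load (args i @ [w])) (D2 w)
        \<and> map_pmf (\<lambda>s. s 0) (D2 w) = rest i w"
      by metis
    define st where "st = (\<lambda>s. s(N + 1 := [], m := s (N + 1)) :: nat \<Rightarrow> bool list)"
    \<comment> \<open>The final law of \<open>p2\<close> started in the dirty store: below
      \<open>N\<close> as from a clean start, elsewhere as the subroutine left it.\<close>
    define E where "E = (\<lambda>s. map_pmf (embed_store (\<lambda>x. x) {..<N} (st s)) (D2 (s (N + 1))))"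
    have "halts ((8 * W L + 2) + T2 L) ([move (N + 1) N, move N m] @ p2, s) (E s)"
      if s: "s \<in> set_pmf (map_pmf (embed_store \<rho> UNIV s0) D1)" for s
    proof -
      obtain u where u: "u \<in> set_pmf D1" "s = embed_store \<rho> UNIV s0 u" using s by auto
      have sx: "s x = s0 x" if "x \<le> N" for x using that by (simp add: u(2) embed_\<rho>)
      have w: "s (N + 1) = u 0" by (simp add: u(2) embed_\<rho>)
      have wg: "u 0 \<in> set_pmf (g (h i))" unfolding D1(2)[symmetric] using u(1) by auto
      have lw: "length (u 0) \<le> W L"
        using halts_length[OF D1' u(1), of 0] length_load_le[of "sub_args (h i)" 0] size1 by (simp add: W_def)
      have "reaches (8 * W L + 2) ([move (N + 1) N, move N m] @ p2, s) (p2, st s)"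
      proof -
        have "reaches (4 * length (s (N + 1)) + 1) (move (N + 1) N # move N m # p2, s)
            (move N m # p2, s(N + 1 := [], N := rev (s (N + 1))))"
          using reaches_move[of "N + 1" N s] sx[of N] s0_empty[of N] mN by simp
        also have "reaches (4 * length (s (N + 1)) + 1) \<dots> (p2, st s)"
        proof -
          have "s(N + 1 := [], N := [], m := s (N + 1)) = st s"
            using sx[of N] s0_empty[of N] mN by (auto simp: st_def fun_eq_iff)
          then show ?thesis
            using reaches_move[of N m "s(N + 1 := [], N := rev (s (N + 1)))" p2] mN sx[of m] s0_empty[of m]
            by simp
        qed
        finally show ?thesis unfolding append.simps by (rule reaches_mono) (use lw w in simp)
      qed
      moreover have "halts (T2 L) (p2, st s) (E s)"
      proof -
        have "halts (T2 L) (p2, load (args i @ [u 0])) (D2 (u 0))"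
          by (rule halts_mono[OF conjunct1[OF D2[OF wg]]])
            (use lw in \<open>auto simp: T2_def L_def intro!: power_mono\<close>)
        then have "halts (T2 L) (map (rename (\<lambda>x. x)) p2, embed_store (\<lambda>x. x) {..<N} (st s) (load (args i @ [u 0])))
            (map_pmf (embed_store (\<lambda>x. x) {..<N} (st s)) (D2 (u 0)))"
          by (rule halts_rename[rotated 2]) (use N in \<open>auto simp: inj_on_def\<close>)
        \<comment> \<open>Below \<open>N\<close> the dirty store already is the clean one: the
          arguments are untouched, and the result sits in register \<open>m\<close>.\<close>
        moreover have "embed_store (\<lambda>x. x) {..<N} (st s) (load (args i @ [u 0])) = st s"
        proof
          fix x
          show "embed_store (\<lambda>x. x) {..<N} (st s) (load (args i @ [u 0])) x = st s x"
          proof (cases "x < N")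
            case True
            then have "embed_store (\<lambda>x. x) {..<N} (st s) (load (args i @ [u 0])) x = load (args i @ [u 0]) x"
              using embed_apply[of "\<lambda>x. x" "{..<N}" x] by (simp add: inj_on_def)
            also have "\<dots> = st s x"
              using True sx[of x] w lenm by (auto simp: st_def load_def s0_def nth_append)
            finally show ?thesis .
          qed (simp add: embed_store_def)
        qed
        ultimately show ?thesis using w by (simp add: rename_id E_def map_idI)
      qed
      ultimately show ?thesis by (rule halts_reaches)
    qed
    ultimately have "halts (T L) (prog, s0) (bind_pmf (map_pmf (embed_store \<rho> UNIV s0) D1) E)"
      unfolding T_def by (intro halts_reaches[OF _ halts_append])
    moreover have "map_pmf (\<lambda>s. s 0) (bind_pmf (map_pmf (embed_store \<rho> UNIV s0) D1) E) = bind_pmf (g (h i)) (rest i)"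
    proof -
      have "map_pmf (\<lambda>s. s 0) (bind_pmf (map_pmf (embed_store \<rho> UNIV s0) D1) E)
        = bind_pmf D1 (\<lambda>u. map_pmf (\<lambda>s. s 0) (E (embed_store \<rho> UNIV s0 u)))"
        by (simp add: map_bind_pmf bind_map_pmf)
      also have "\<dots> = bind_pmf D1 (\<lambda>u. rest i (u 0))"
      proof (rule bind_pmf_cong)
        fix u assume "u \<in> set_pmf D1"
        then have wg: "u 0 \<in> set_pmf (g (h i))" unfolding D1(2)[symmetric] by auto
        have "embed_store (\<lambda>x. x) {..<N} s v 0 = v 0" for s v :: "nat \<Rightarrow> bool list"
          using embed_apply[of "\<lambda>x. x" "{..<N}" 0] mN by (simp add: inj_on_def)
        then have "map_pmf (\<lambda>s. s 0) (E (embed_store \<rho> UNIV s0 u)) = map_pmf (\<lambda>s. s 0) (D2 (u 0))"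
          by (simp add: E_def pmf.map_comp o_def embed_\<rho>)
        then show "map_pmf (\<lambda>s. s 0) (E (embed_store \<rho> UNIV s0 u)) = rest i (u 0)"
          using D2[OF wg] by simp
      qed simp
      also have "\<dots> = bind_pmf (g (h i)) (rest i)" by (simp add: D1(2)[symmetric] bind_map_pmf)
      finally show ?thesis .
    qed
    ultimately show ?thesis unfolding s0_def L_def by blast
  qed
  then show ?thesis unfolding ppt_iff using pbT by blast
qed

lemma ppt_arg:
  assumes "\<And>i. i \<in> I \<Longrightarrow> length (args i) = m" "j < m"
  shows "ppt I args (\<lambda>i. return_pmf (args i ! j))"
proof (rule pptI_det)
  show "poly_bounded (\<lambda>L. (9 * L + 2) + (4 * L + 1) + (4 * L + 1) + (4 * L + 1))"
    by (intro poly_bounded_add poly_bounded_mult poly_bounded_id poly_bounded_const)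
next
  fix i assume "i \<in> I"
  define s0 where "s0 = load (args i)"
  define L where "L = args_size (args i)"
  have l: "length (s0 x) \<le> L" for x unfolding s0_def L_def by (rule length_load_le)
  have e: "s0 x = []" if "m \<le> x" for x using that assms(1)[OF \<open>i \<in> I\<close>] by (simp add: s0_def load_def)
  \<comment> \<open>Copying precedes the clearing of register 0, so \<open>j = 0\<close> is
    included. The last two moves cancel each other's reversal.\<close>
  have "reaches (9 * L + 2) (copy j m (m + 1) @ [move 0 (m + 2), move (m + 1) m, move m 0], s0)
    ([move 0 (m + 2), move (m + 1) m, move m 0], s0(m + 1 := s0 j))"
    by (rule reaches_copyI[OF _ _ l]) (use assms(2) in \<open>auto simp: e\<close>)
  also have "reaches (4 * L + 1) \<dots> ([move (m + 1) m, move m 0], s0(m + 1 := s0 j, 0 := [], m + 2 := rev (s0 0)))"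
    by (rule reaches_moveI[where L = L]) (use assms(2) l in \<open>auto simp: e fun_eq_iff\<close>)
  also have "reaches (4 * L + 1) \<dots> ([move m 0], s0(0 := [], m + 2 := rev (s0 0), m := rev (s0 j)))"
    by (rule reaches_moveI[where L = L]) (use assms(2) l in \<open>auto simp: e fun_eq_iff\<close>)
  also have "reaches (4 * L + 1) \<dots> ([], s0(m + 2 := rev (s0 0), 0 := s0 j))"
    by (rule reaches_moveI[where L = L]) (use assms(2) l in \<open>auto simp: e fun_eq_iff\<close>)
  finally show "\<exists>s. reaches ((9 * args_size (args i) + 2) + (4 * args_size (args i) + 1)
      + (4 * args_size (args i) + 1) + (4 * args_size (args i) + 1))
      (copy j m (m + 1) @ [move 0 (m + 2), move (m + 1) m, move m 0], load (args i)) ([], s) \<and> s 0 = args i ! j"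
    using assms \<open>i \<in> I\<close>
    by (intro exI[of _ "s0(m + 2 := rev (s0 0), 0 := s0 j)"] conjI) (simp_all add: L_def s0_def load_def)
qed

section \<open>Patching circuits\<close>

definition wires :: "bool list \<Rightarrow> gate list \<Rightarrow> bool list" where
  "wires w gs = foldl (\<lambda>w g. w @ [gate_val w g]) w gs"

lemma wires_simps [simp]:
  "wires w [] = w"
  "wires w (g # gs) = wires (w @ [gate_val w g]) gs"
  "wires w (gs @ hs) = wires (wires w gs) hs"
  by (simp_all add: wires_def)

lemma length_wires [simp]: "length (wires w gs) = length w + length gs"
  by (induction gs arbitrary: w) auto

lemma nth_wires [simp]: "i < length w \<Longrightarrow> wires w gs ! i = w ! i"
  by (induction gs arbitrary: w) (auto simp: nth_append)

lemma eval_circuit_wires: "eval_circuit C x = map ((!) (wires x (gates C))) (outs C)"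
  by (simp add: eval_circuit_def wires_def Let_def)

fun gates_ok :: "nat \<Rightarrow> gate list \<Rightarrow> bool" where
  "gates_ok k [] = True"
| "gates_ok k (g # gs) = (gate_ok k g \<and> gates_ok (Suc k) gs)"

lemma gates_ok_iff: "gates_ok k gs \<longleftrightarrow> (\<forall>i < length gs. gate_ok (k + i) (gs ! i))"
  by (induction gs arbitrary: k) (auto simp: less_Suc_eq_0_disj)

lemma gates_ok_append [simp]: "gates_ok k (gs @ hs) \<longleftrightarrow> gates_ok k gs \<and> gates_ok (k + length gs) hs"
  by (induction gs arbitrary: k) auto

lemma gates_ok_Zeros [simp]: "gates_ok k (replicate j Zero)"
  by (induction j arbitrary: k) auto

lemma circuits_iff: "C \<in> circuits n m \<longleftrightarrow> arity C = n \<and> length (outs C) = m \<and> gates_ok n (gates C)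
    \<and> (\<forall>i \<in> set (outs C). i < n + length (gates C))"
  by (auto simp: circuits_def gates_ok_iff)

lemma circuits_1E:
  assumes "C \<in> circuits n 1"
  obtains gs j where "C = Circuit n gs [j]" "gates_ok n gs" "j < n + length gs"
proof -
  obtain j where "outs C = [j]" using assms by (auto simp: circuits_iff length_Suc_conv)
  then show ?thesis using that[of "gates C" j] assms by (cases C) (auto simp: circuits_iff)
qed

section \<open>Encodings of circuits and padding\<close>

abbreviation enc_gates :: "gate list \<Rightarrow> bool list" where
  "enc_gates gs \<equiv> concat (map enc_gate gs)"

lemma encode_1: "encode (Circuit n gs [j]) = enc_nat n @ enc_nat 1 @ enc_nat j @ enc_gates gs"
  by (simp add: encode_def)

text \<open>The final False makes the unary code prefix-free, so concatenated codes can be taken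
  apart one by one.\<close>

lemma enc_nat_append_inject: "enc_nat i @ u = enc_nat j @ v \<longleftrightarrow> i = j \<and> u = v"
proof (induction i arbitrary: j)
  case 0
  then show ?case by (cases j) (auto simp: enc_nat_def unary_def)
next
  case (Suc i)
  then show ?case by (cases j) (auto simp: enc_nat_def unary_def)
qed

lemma enc_gate_append_inject: "enc_gate g @ u = enc_gate h @ v \<longleftrightarrow> g = h \<and> u = v"
  by (cases g; cases h) (auto simp: enc_nat_append_inject)

lemma enc_gates_inject: "enc_gates gs = enc_gates hs \<Longrightarrow> gs = hs"
proof (induction gs arbitrary: hs)
  case Nil
  then show ?case by (cases hs; cases "hd hs") auto
next
  case (Cons g gs)
  obtain h hs' where "hs = h # hs'" using Cons.prems by (cases hs; cases g) auto
  then show ?case using Cons by (auto simp: enc_gate_append_inject)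
qed

text \<open>Makes it possible to use encodings as keys: the circuit is recovered by inverting
  \<open>encode\<close>.\<close>

lemma inj_on_encode: "inj_on encode (circuits n 1)"
proof (rule inj_onI)
  fix C C' assume "C \<in> circuits n 1" "C' \<in> circuits n 1" and eq: "encode C = encode C'"
  then obtain gs j gs' j' where C: "C = Circuit n gs [j]" "C' = Circuit n gs' [j']"
    by (metis circuits_1E)
  then show "C = C'" using eq enc_gates_inject
    by (auto simp: encode_1 enc_nat_append_inject simp del: One_nat_def)
qed

definition pad_circuit :: "nat \<Rightarrow> circuit \<Rightarrow> circuit" where
  "pad_circuit T C = Circuit (arity C) (gates C @ replicate (T - circuit_size C) Zero) (outs C)"

definition pad_string :: "nat \<Rightarrow> bool list \<Rightarrow> bool list" where
  "pad_string T w = w @ replicate (T - length w) False"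

text \<open>A \<open>Zero\<close> gate is encoded by a single bit and gates come last. Hence a
  program can pad without parsing, and every larger size is hit exactly.\<close>

lemma encode_pad_circuit: "encode (pad_circuit T C) = pad_string T (encode C)"
proof -
  have "enc_gates (replicate j Zero) = replicate j False" for j by (induction j) auto
  then show ?thesis by (simp add: pad_circuit_def encode_def pad_string_def circuit_size_def)
qed

lemma circuit_size_pad_circuit: "circuit_size (pad_circuit T C) = max T (circuit_size C)"
  by (simp add: circuit_size_def encode_pad_circuit pad_string_def)

lemma pad_circuit_in_circuits: "C \<in> circuits n m \<Longrightarrow> pad_circuit T C \<in> circuits n m"
  by (auto simp: circuits_iff pad_circuit_def)

lemma eval_pad_circuit:
  assumes "C \<in> circuits n m" "x \<in> bits n"
  shows "eval_circuit (pad_circuit T C) x = eval_circuit C x"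
  using assms by (auto simp: eval_circuit_wires pad_circuit_def circuits_iff bits_def)

text \<open>The arity is written in unary. This is where a polynomial bound on the input length
  comes from, given one on the circuit sizes.\<close>

lemma arity_le_circuit_size: "C \<in> circuits n m \<Longrightarrow> n \<le> circuit_size C"
  by (auto simp: circuits_def circuit_size_def encode_def enc_nat_def unary_def)

text \<open>Wire \<open>a\<close>, the last one so far, says whether the inputs before \<open>i\<close> agree with the given string;
  each further bit updates this with three gates.\<close>

fun cmp_gates :: "nat \<Rightarrow> nat \<Rightarrow> bool list \<Rightarrow> gate list" where
  "cmp_gates i a [] = []"
| "cmp_gates i a (b # bs) = [Nand i i, Nand a (if b then i else a + 1), Nand (a + 2) (a + 2)]
    @ cmp_gates (i + 1) (a + 3) bs"

lemma length_cmp_gates [simp]: "length (cmp_gates i a bs) = 3 * length bs"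
  by (induction i a bs rule: cmp_gates.induct) auto

lemma gates_ok_cmp_gates: "i + length bs \<le> a \<Longrightarrow> gates_ok (Suc a) (cmp_gates i a bs)"
proof (induction i a bs rule: cmp_gates.induct)
  case (2 i a b bs)
  have "gates_ok (Suc (a + 3)) (cmp_gates (i + 1) (a + 3) bs)" using 2 by auto
  moreover have "Suc (a + 3) = Suc (Suc (Suc (Suc a)))" by simp
  ultimately show ?case using 2 by auto
qed simp

lemma wires_cmp_gates:
  assumes "length w = Suc a" "i + length bs \<le> a"
  shows "wires w (cmp_gates i a bs) ! (a + 3 * length bs) \<longleftrightarrow> w ! a \<and> take (length bs) (drop i w) = bs"
  using assms
proof (induction bs arbitrary: i a w)
  case (Cons b bs)
  let ?g = "[Nand i i, Nand a (if b then i else a + 1), Nand (a + 2) (a + 2)]"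
  let ?w = "wires w ?g"
  have lw: "length ?w = Suc (a + 3)" using Cons.prems by simp
  \<comment> \<open>The first gate negates input \<open>i\<close>, the second is the NAND of wire
    \<open>a\<close> with the literal that is true if the input equals \<open>b\<close>, and the
    third negates this to a conjunction.\<close>
  have a: "?w ! (a + 3) \<longleftrightarrow> w ! a \<and> w ! i = b"
    using Cons.prems by (auto simp: nth_append)
  have d: "take (length bs) (drop (i + 1) ?w) = take (length bs) (drop (i + 1) w)"
    using Cons.prems by simp
  have "wires ?w (cmp_gates (i + 1) (a + 3) bs) ! (a + 3 + 3 * length bs)
    \<longleftrightarrow> ?w ! (a + 3) \<and> take (length bs) (drop (i + 1) ?w) = bs"
    by (rule Cons.IH[OF lw]) (use Cons.prems in simp)
  then have "wires w (cmp_gates i a (b # bs)) ! (a + 3 + 3 * length bs)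
    \<longleftrightarrow> w ! a \<and> w ! i = b \<and> take (length bs) (drop (i + 1) w) = bs"
    unfolding cmp_gates.simps wires_simps(3) a d by simp
  moreover have "drop i w = w ! i # drop (i + 1) w"
    using Cons.prems by (simp add: Cons_nth_drop_Suc)
  ultimately show ?case by (auto simp: algebra_simps)
qed simp

text \<open>\<open>N\<close> is the number of wires so far and \<open>j\<close> the old output. Wire
  \<open>N + 1\<close> is constantly true and starts the comparison; wire \<open>a\<close> holds its
  result. The last three gates compute "\<open>j\<close> or \<open>a\<close>" if the new value is
  True, and "\<open>j\<close> and not \<open>a\<close>" otherwise; in both cases the output is wire
  \<open>a + 3\<close>.\<close>

definition patch_gates :: "nat \<Rightarrow> nat \<Rightarrow> bool list \<Rightarrow> bool \<Rightarrow> gate list" where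
  "patch_gates N j x b = (let a = N + 1 + 3 * length x in
     [Zero, Nand N N] @ cmp_gates 0 (N + 1) x @
     (if b then [Nand j j, Nand a a, Nand (a + 1) (a + 2)]
      else [Nand a a, Nand j (a + 1), Nand (a + 2) (a + 2)]))"

definition patch :: "circuit \<Rightarrow> bool list \<Rightarrow> bool \<Rightarrow> circuit" where
  "patch C x b = (let N = arity C + length (gates C) in
     Circuit (arity C) (gates C @ patch_gates N (hd (outs C)) x b) [N + 1 + 3 * length x + 3])"

lemma patch_in_circuits:
  assumes "C \<in> circuits n 1" "x \<in> bits n"
  shows "patch C x b \<in> circuits n 1"
proof -
  obtain gs j where C: "C = Circuit n gs [j]" "gates_ok n gs" "j < n + length gs"
    using circuits_1E[OF assms(1)] .
  have "gates_ok (Suc (n + length gs + 1)) (cmp_gates 0 (n + length gs + 1) x)"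
    by (rule gates_ok_cmp_gates) (use assms(2) in \<open>simp add: bits_def\<close>)
  then show ?thesis using C by (auto simp: circuits_iff patch_def patch_gates_def Let_def)
qed

lemma eval_patch:
  assumes "C \<in> circuits n 1" "x \<in> bits n" "z \<in> bits n"
  shows "eval_circuit (patch C x b) z = (if z = x then [b] else eval_circuit C z)"
proof -
  obtain gs j where C: "C = Circuit n gs [j]" "gates_ok n gs" "j < n + length gs"
    using circuits_1E[OF assms(1)] .
  have lx: "length x = n" "length z = n" using assms by (auto simp: bits_def)
  define N where "N = n + length gs"
  define a where "a = N + 1 + 3 * n"
  define w where "w = wires z gs"
  define w1 where "w1 = wires w ([Zero, Nand N N] @ cmp_gates 0 (N + 1) x)"
  have lw: "length w = N" by (simp add: w_def N_def lx)
  have lw1: "length w1 = Suc a" by (simp add: w1_def a_def lw lx)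
  have "w1 ! (N + 1 + 3 * length x) \<longleftrightarrow> wires w [Zero, Nand N N] ! (N + 1)
      \<and> take (length x) (drop 0 (wires w [Zero, Nand N N])) = x"
    unfolding w1_def wires_simps(3)
    by (rule wires_cmp_gates) (use lw lx in \<open>auto simp: N_def\<close>)
  moreover have "wires w [Zero, Nand N N] ! (N + 1)" by (simp add: lw nth_append)
  moreover have "take n w = z"
    using lx by (intro nth_equalityI) (auto simp: lw w_def)
  ultimately have a: "w1 ! a \<longleftrightarrow> z = x"
    using lw by (simp add: a_def lx N_def)
  have j: "w1 ! j = w ! j" using C(3) by (simp add: w1_def lw N_def nth_append)
  have jN: "j < N" using C(3) by (simp add: N_def)
  have "eval_circuit (patch C x b) z = [wires w1 (if b then [Nand j j, Nand a a, Nand (a + 1) (a + 2)]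
      else [Nand a a, Nand j (a + 1), Nand (a + 2) (a + 2)]) ! (a + 3)]"
    by (simp add: eval_circuit_wires patch_def patch_gates_def Let_def C lx w1_def w_def N_def a_def add.assoc)
  also have "\<dots> = (if z = x then [b] else [w ! j])"
    using lw1 jN a[unfolded a_def] j by (auto simp: nth_append a_def)
  finally show ?thesis by (simp add: eval_circuit_wires C w_def)
qed

section \<open>Parsing unary numbers on the machine\<close>

definition read_nat :: "nat \<Rightarrow> nat \<Rightarrow> instr \<Rightarrow> instr list" where
  "read_nat e f J = [Push f True, Loop f [Cond e [Pop e, J] [Pop e, Pop f]]]"

text \<open>\<open>Loop\<close> tests only for emptiness and cannot be left from inside, so a flag
  in \<open>f\<close> keeps it going until the final False of the number is popped. \<open>J\<close>
  is executed once per unit, whatever it does to register \<open>d\<close>.\<close>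

lemma reaches_read_nat:
  assumes J: "\<And>K s. step (J # K, s) = return_pmf (K, s(d := \<phi> (s d)))"
    and "distinct [e, f, d]" "s e = enc_nat i @ u" "s f = []"
  shows "reaches (4 * i + 6) (read_nat e f J @ K, s) (K, s(e := u, d := (\<phi> ^^ i) (s d)))"
proof -
  let ?L = "Loop f [Cond e [Pop e, J] [Pop e, Pop f]]"
  have "reaches (4 * i + 5) (?L # K, s) (K, s(e := u, d := (\<phi> ^^ i) (s d), f := []))"
    if "s f = [True]" "s e = enc_nat i @ u" for s i
    using that
  proof (induction i arbitrary: s)
    case 0
    have eq: "s(e := u, d := (\<phi> ^^ 0) (s d), f := []) = s(e := u, f := [])"
      using assms(2) by (auto simp: fun_eq_iff)
    have "reaches (4 * 0 + 5) (?L # K, s) (K, s(e := u, f := []))"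
      using 0 assms(2) by (simp add: reaches_instr enc_nat_def unary_def)
    then show ?case unfolding eq .
  next
    case (Suc i)
    define s' where "s' = s(e := u, d := (\<phi> ^^ Suc i) (s d), f := [])"
    have "reaches (4 * Suc i + 4) (Cond e [Pop e, J] [Pop e, Pop f] # ?L # K, s) (K, s')"
    proof -
      let ?s = "s(e := enc_nat i @ u, d := \<phi> (s d))"
      have "reaches (4 * i + 5) (?L # K, ?s) (K, ?s(e := u, d := (\<phi> ^^ i) (?s d), f := []))"
        by (rule Suc.IH) (use Suc.prems assms(2) in auto)
      moreover have "?s(e := u, d := (\<phi> ^^ i) (?s d), f := []) = s(e := u, d := (\<phi> ^^ Suc i) (s d), f := [])"
        using assms(2) by (auto simp: fun_eq_iff funpow_swap1)
      ultimately have "reaches (4 * i + 5) (?L # K, ?s) (K, s')"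
        by (simp add: s'_def)
      then have "reaches (Suc (4 * i + 5)) (J # ?L # K, s(e := enc_nat i @ u)) (K, s')"
        by (rule reaches_step[rotated]) (use assms(2) in \<open>simp add: J\<close>)
      then show ?thesis using Suc.prems
        by (simp add: reaches_instr enc_nat_def unary_def)
    qed
    then show ?case using Suc.prems unfolding s'_def[symmetric] by (simp add: reaches_instr)
  qed
  from this[of "s(f := [True])" i] have "reaches (4 * i + 5) (?L # K, s(f := [True]))
      (K, s(f := [True], e := u, d := (\<phi> ^^ i) (s d), f := []))"
    using assms by simp
  moreover have "s(f := [True], e := u, d := (\<phi> ^^ i) (s d), f := []) = s(e := u, d := (\<phi> ^^ i) (s d))"
    using assms by (auto simp: fun_eq_iff)
  ultimately have r: "reaches (4 * i + 5) (?L # K, s(f := [True])) (K, s(e := u, d := (\<phi> ^^ i) (s d)))"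
    by simp
  have "reaches (Suc (4 * i + 5)) (read_nat e f J @ K, s) (K, s(e := u, d := (\<phi> ^^ i) (s d)))"
    by (rule reaches_step[OF _ r]) (simp add: read_nat_def assms(4))
  then show ?thesis by (rule reaches_mono) simp
qed

lemma reaches_read_push:
  assumes "distinct [e, f, d]" "s e = enc_nat i @ u" "s f = []" "i \<le> M" "4 * M + 6 \<le> B"
    "s(e := u, d := unary i @ s d) = s'"
  shows "reaches B (read_nat e f (Push d True) @ K, s) (K, s')"
proof -
  have "((#) True ^^ i) xs = unary i @ xs" for xs by (induction i) (auto simp: unary_def)
  then have "reaches (4 * i + 6) (read_nat e f (Push d True) @ K, s) (K, s')"
    using reaches_read_nat[of "Push d True" d "(#) True", OF _ assms(1-3)] assms(6) by simp
  then show ?thesis by (rule reaches_mono) (use assms in simp)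
qed

text \<open>One pop per unit turns the number into an index: the entry at position \<open>i\<close>
  comes to the top. If \<open>d\<close> is empty, the number is merely skipped.\<close>

lemma reaches_read_pop:
  assumes "distinct [e, f, d]" "s e = enc_nat i @ u" "s f = []" "i \<le> M" "4 * M + 6 \<le> B"
    "s(e := u, d := drop i (s d)) = s'"
  shows "reaches B (read_nat e f (Pop d) @ K, s) (K, s')"
proof -
  have "(tl ^^ i) xs = drop i xs" for xs :: "bool list"
    by (induction i arbitrary: xs) (auto simp: drop_Suc tl_drop)
  then have "reaches (4 * i + 6) (read_nat e f (Pop d) @ K, s) (K, s')"
    using reaches_read_nat[of "Pop d" d tl, OF _ assms(1-3)] assms(6) by simp
  then show ?thesis by (rule reaches_mono) (use assms in simp)
qed

lemma reaches_clear: "reaches (2 * length (s r) + 1) (Loop r [Pop r] # K, s) (K, s(r := []))"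
proof (induction "s r" arbitrary: s)
  case Nil
  then have "s(r := []) = s" by auto
  then show ?case using Nil by (simp add: reaches_instr)
next
  case (Cons b xs)
  have "reaches (2 * length xs + 1) (Loop r [Pop r] # K, s(r := xs)) (K, s(r := []))"
    using Cons.hyps(1)[of "s(r := xs)"] by simp
  then show ?case using Cons.hyps(2)[symmetric] by (simp add: reaches_instr)
qed

lemma reaches_clearI: "length (s r) \<le> L \<Longrightarrow> 2 * L + 1 \<le> B \<Longrightarrow> s(r := []) = s'
    \<Longrightarrow> reaches B (Loop r [Pop r] # K, s) (K, s')"
  using reaches_mono[OF reaches_clear[of s r K], of B] by auto

section \<open>Efficient programs\<close>

lemma length_unary [simp]: "length (unary k) = k" by (simp add: unary_def)

lemma rev_unary [simp]: "rev (unary k) = unary k" by (simp add: unary_def)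

lemma unary_Suc: "unary (Suc k) = True # unary k" by (simp add: unary_def)

lemma unary_append: "unary a @ unary b = unary (a + b)" by (simp add: unary_def replicate_add)

lemma enc_nat_unary: "enc_nat k = unary k @ [False]" by (simp add: enc_nat_def)

lemma rev_enc_nat: "rev (enc_nat k) = False # unary k" by (simp add: enc_nat_def)

lemma load_simps:
  "load [a] = (\<lambda>_. [])(0 := a)"
  "load [a, b] = (\<lambda>_. [])(0 := a, 1 := b)"
  "load [a, b, c] = (\<lambda>_. [])(0 := a, 1 := b, 2 := c)"
  by (auto simp: load_def fun_eq_iff less_Suc_eq numeral_eq_Suc)

text \<open>An index only labels an argument list and an output law, so one program serves every
  family whose pairs of these occur in the given one.\<close>

lemma ppt_reindex:
  assumes "ppt I args f" "\<And>j. j \<in> J \<Longrightarrow> \<phi> j \<in> I \<and> args (\<phi> j) = args' j \<and> f (\<phi> j) = f' j"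
  shows "ppt J args' f'"
proof -
  obtain prog c where *: "\<And>i. i \<in> I \<Longrightarrow>
     (let final = run (args_size (args i) ^ c + c) (prog, load (args i)) in
       (\<forall>cf\<in>set_pmf final. fst cf = []) \<and> map_pmf (\<lambda>cf. snd cf 0) final = f i)"
    using assms(1) unfolding ppt_def by blast
  show ?thesis unfolding ppt_def
  proof (rule exI[of _ prog], rule exI[of _ c], rule ballI)
    fix j assume "j \<in> J"
    then show "let final = run (args_size (args' j) ^ c + c) (prog, load (args' j)) in
       (\<forall>cf\<in>set_pmf final. fst cf = []) \<and> map_pmf (\<lambda>cf. snd cf 0) final = f' j"
      using *[of "\<phi> j"] assms(2)[of j] by simp
  qed
qed

text \<open>Intermediate results are appended to the argument list. An algorithm in several steps is
  thus a list that grows by one entry per call.\<close>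

lemma ppt_call_det:
  assumes "ppt J sub_args (\<lambda>j. return_pmf (g j))"
    and rest: "ppt I (\<lambda>i. args i @ [g (h i)]) rest"
    and "\<And>i. i \<in> I \<Longrightarrow> h i \<in> J \<and> sub_args (h i) = map ((!) (args i)) sel"
    and "\<And>i. i \<in> I \<Longrightarrow> length (args i) = m" "\<And>j. j \<in> set sel \<Longrightarrow> j < m"
  shows "ppt I args rest"
proof -
  have "ppt {(i, w). i \<in> I \<and> w \<in> set_pmf (return_pmf (g (h i)))} (\<lambda>(i, w). args i @ [w]) (\<lambda>(i, w). rest i)"
    by (rule ppt_reindex[OF rest, of _ fst]) auto
  from ppt_call[OF assms(1) this assms(3-5)] show ?thesis by (simp add: bind_return_pmf)
qed

section \<open>Unary arithmetic and padding of strings\<close>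

lemma ppt_succ2: "ppt UNIV (\<lambda>a. [unary a]) (\<lambda>a. return_pmf (unary (a + 2)))"
proof (rule pptI_det)
  show "poly_bounded (\<lambda>L. 2)" by auto
  fix a
  have r: "reaches 2 ([Push 0 True, Push 0 True], load [unary a]) ([], load [unary (a + 2)])"
    by (simp add: reaches_instr load_simps unary_Suc)
  show "\<exists>s. reaches 2 ([Push 0 True, Push 0 True], load [unary a]) ([], s) \<and> s 0 = unary (a + 2)"
    by (rule exI, rule conjI, rule r) (simp add: load_simps)
qed

lemma ppt_one: "ppt UNIV (\<lambda>a. [unary a]) (\<lambda>a. return_pmf (unary 1))"
proof (rule pptI_det)
  show "poly_bounded (\<lambda>L. (2 * L + 1) + 1)"
    by (intro poly_bounded_add poly_bounded_mult poly_bounded_id poly_bounded_const)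
  fix a
  let ?p = "[Loop 0 [Pop 0], Push 0 True]"
  have "reaches (2 * a + 1) (?p, load [unary a]) ([Push 0 True], (load [unary a])(0 := []))"
    by (rule reaches_clearI[where L = a]) (simp_all add: load_simps)
  also have "reaches 1 \<dots> ([], (load [unary a])(0 := [True]))" by (simp add: reaches_instr)
  finally have r: "reaches ((2 * a + 1) + 1) (?p, load [unary a]) ([], (load [unary a])(0 := [True]))" .
  show "\<exists>s. reaches ((2 * args_size [unary a] + 1) + 1) (?p, load [unary a]) ([], s) \<and> s 0 = unary 1"
    by (rule exI, rule conjI, rule reaches_mono[OF r]) (simp_all add: unary_def)
qed

lemma ppt_mult: "ppt UNIV (\<lambda>(a, b). [unary a, unary b]) (\<lambda>(a, b). return_pmf (unary (a * b)))"
proof -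
  let ?p = "[Loop 0 (Pop 0 # copy 1 3 2), move 2 0]"
  define T where "T = (\<lambda>L. L * (9 * L + 4) + 1 + (4 * (L * L) + 1) :: nat)"
  \<comment> \<open>Multiplication as repeated addition: a copy of \<open>b\<close> for each unit of
    \<open>a\<close>.\<close>
  have loop: "reaches (a * (9 * b + 4) + 1) (Loop 0 (Pop 0 # copy 1 3 2) # K, s)
      (K, s(0 := [], 2 := unary (a * b) @ s 2))"
    if "s 0 = unary a" "s 1 = unary b" "s 3 = []" for a b s K
    using that
  proof (induction a arbitrary: s)
    case 0
    then have eq: "s(0 := [], 2 := unary (0 * b) @ s 2) = s" by (auto simp: unary_def fun_eq_iff)
    show ?case unfolding eq using 0 by (simp add: reaches_instr unary_def)
  next
    case (Suc a)
    let ?L = "Loop 0 (Pop 0 # copy 1 3 2)"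
    let ?s = "s(0 := unary a, 2 := unary b @ s 2)"
    have "reaches 2 (?L # K, s) (copy 1 3 2 @ ?L # K, s(0 := unary a))"
      using Suc.prems by (simp add: reaches_instr unary_Suc)
    also have "reaches (9 * b + 2) \<dots> (?L # K, ?s)"
      by (rule reaches_copyI[where L = b]) (use Suc.prems in auto)
    also have "reaches (a * (9 * b + 4) + 1) (?L # K, ?s) (K, ?s(0 := [], 2 := unary (a * b) @ ?s 2))"
      by (rule Suc.IH) (use Suc.prems in auto)
    finally have "reaches (2 + (9 * b + 2) + (a * (9 * b + 4) + 1)) (?L # K, s) (K, ?s(0 := [], 2 := unary (a * b) @ ?s 2))" .
    moreover have eq: "?s(0 := [], 2 := unary (a * b) @ ?s 2) = s(0 := [], 2 := unary (Suc a * b) @ s 2)"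
      by (auto simp: fun_eq_iff) (simp add: unary_append add.commute flip: append_assoc)
    ultimately show ?case unfolding eq by (elim reaches_mono) (simp add: algebra_simps)
  qed
  have "ppt UNIV (\<lambda>(a, b). [unary a, unary b]) (\<lambda>i. return_pmf (case i of (a, b) \<Rightarrow> unary (a * b)))"
  proof (rule pptI_det)
    show "poly_bounded T" unfolding T_def
      by (intro poly_bounded_add poly_bounded_mult poly_bounded_id poly_bounded_const)
    fix i :: "nat \<times> nat"
    obtain a b where i: "i = (a, b)" by force
    have "reaches (a * (9 * b + 4) + 1) (?p, load [unary a, unary b])
        ([move 2 0], (load [unary a, unary b])(0 := [], 2 := unary (a * b)))"
      using loop[of "load [unary a, unary b]" a b "[move 2 0]"] by (simp add: load_simps)
    also have "reaches (4 * (a * b) + 1) \<dots> ([], (load [unary a, unary b])(0 := unary (a * b), 2 := []))"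
      by (rule reaches_moveI[where L = "a * b"]) (auto simp: fun_eq_iff)
    finally have r: "reaches (T (a + b)) (?p, load [unary a, unary b]) ([], (load [unary a, unary b])(0 := unary (a * b), 2 := []))"
      by (rule reaches_mono) (auto simp: T_def intro!: add_mono mult_mono)
    show "\<exists>s. reaches (T (args_size (case i of (a, b) \<Rightarrow> [unary a, unary b])))
        (?p, load (case i of (a, b) \<Rightarrow> [unary a, unary b])) ([], s) \<and> s 0 = (case i of (a, b) \<Rightarrow> unary (a * b))"
      unfolding i prod.case by (rule exI, rule conjI, rule reaches_mono[OF r]) simp_all
  qed
  then show ?thesis by (simp add: case_prod_unfold)
qed

text \<open>The padding lengths must be computed from the security parameter. This is the reason for
  bringing all size bounds into the form \<open>(k + 2) ^ e\<close>.\<close>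

lemma ppt_unary_power: "ppt UNIV (\<lambda>a. [unary a]) (\<lambda>a. return_pmf (unary ((a + 2) ^ e)))"
proof (induction e)
  case 0
  show ?case using ppt_one by simp
next
  case (Suc e)
  have "ppt UNIV (\<lambda>a. ([unary a] @ [unary ((a + 2) ^ e)]) @ [unary (a + 2)] @ [unary ((a + 2) * (a + 2) ^ e)])
    (\<lambda>a. return_pmf ((([unary a] @ [unary ((a + 2) ^ e)]) @ [unary (a + 2)] @ [unary ((a + 2) * (a + 2) ^ e)]) ! 3))"
    by (rule ppt_arg[of _ _ 4]) auto
  then have 3: "ppt UNIV (\<lambda>a. (([unary a] @ [unary ((a + 2) ^ e)]) @ [unary (a + 2)]) @ [case (a + 2, (a + 2) ^ e) of (a, b) \<Rightarrow> unary (a * b)])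
    (\<lambda>a. return_pmf (unary ((a + 2) ^ Suc e)))" by simp
  have "ppt UNIV (\<lambda>(a, b). [unary a, unary b]) (\<lambda>i. return_pmf (case i of (a, b) \<Rightarrow> unary (a * b)))"
    using ppt_mult by (simp add: case_prod_unfold)
  then have 2: "ppt UNIV (\<lambda>a. ([unary a] @ [unary ((a + 2) ^ e)]) @ [unary (a + 2)]) (\<lambda>a. return_pmf (unary ((a + 2) ^ Suc e)))"
    by (rule ppt_call_det[where h = "\<lambda>a. (a + 2, (a + 2) ^ e)" and g = "\<lambda>(a, b). unary (a * b)" and sel = "[2, 1]" and m = 3, OF _ 3]) auto
  have 1: "ppt UNIV (\<lambda>a. [unary a] @ [unary ((a + 2) ^ e)]) (\<lambda>a. return_pmf (unary ((a + 2) ^ Suc e)))"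
    by (rule ppt_call_det[where h = "\<lambda>a. a" and sel = "[0]" and m = 2, OF ppt_succ2 2]) auto
  show ?case
    by (rule ppt_call_det[where h = "\<lambda>a. a" and sel = "[0]" and m = 1, OF Suc.IH 1]) auto
qed

text \<open>While the string is moved, one unit of \<open>T\<close> is dropped per bit, so what
  remains is exactly the number of missing bits. Popping an empty register has no effect, which
  matches truncated subtraction for strings longer than \<open>T\<close>.\<close>

lemma ppt_pad_string: "ppt UNIV (\<lambda>(w, T). [w, unary T]) (\<lambda>(w, T). return_pmf (pad_string T w))"
proof -
  let ?l1 = "Loop 0 [Cond 0 [Pop 0, Push 2 True, Pop 1] [Pop 0, Push 2 False, Pop 1]]"
  let ?l2 = "Loop 1 [Pop 1, Push 2 False]"
  let ?p = "[?l1, ?l2, move 2 0]"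
  define B where "B = (\<lambda>L. (5 * L + 1) + (3 * L + 1) + (4 * (2 * L) + 1) :: nat)"
  have loop1: "reaches (5 * length (s 0) + 1) (?l1 # K, s)
      (K, s(0 := [], 1 := drop (length (s 0)) (s 1), 2 := rev (s 0) @ s 2))" for s K
  proof (induction "s 0" arbitrary: s)
    case Nil
    have eq: "s(0 := [], 1 := drop (length (s 0)) (s 1), 2 := rev (s 0) @ s 2) = s"
      using Nil[symmetric] by (auto simp: fun_eq_iff)
    show ?case unfolding eq using Nil[symmetric] by (simp add: reaches_instr)
  next
    case (Cons b xs)
    let ?s = "s(0 := xs, 2 := b # s 2, 1 := tl (s 1))"
    have s0: "s 0 = b # xs" using Cons.hyps(2) by simp
    have "reaches 5 (?l1 # K, s) (?l1 # K, ?s)"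
      using s0 by (cases b) (simp_all add: reaches_instr)
    also have "reaches (5 * length (?s 0) + 1) (?l1 # K, ?s)
        (K, ?s(0 := [], 1 := drop (length (?s 0)) (?s 1), 2 := rev (?s 0) @ ?s 2))"
      by (rule Cons.hyps(1)) simp
    finally have "reaches (5 + (5 * length (?s 0) + 1)) (?l1 # K, s)
        (K, ?s(0 := [], 1 := drop (length (?s 0)) (?s 1), 2 := rev (?s 0) @ ?s 2))" .
    moreover have "?s(0 := [], 1 := drop (length (?s 0)) (?s 1), 2 := rev (?s 0) @ ?s 2)
        = s(0 := [], 1 := drop (length (s 0)) (s 1), 2 := rev (s 0) @ s 2)"
      using s0 by (auto simp: fun_eq_iff drop_Suc tl_drop)
    ultimately have "reaches (5 + (5 * length (?s 0) + 1)) (?l1 # K, s)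
        (K, s(0 := [], 1 := drop (length (s 0)) (s 1), 2 := rev (s 0) @ s 2))" by (simp only:)
    then show ?case by (rule reaches_mono) (simp add: s0)
  qed
  have loop2: "reaches (3 * length (s 1) + 1) (?l2 # K, s)
      (K, s(1 := [], 2 := replicate (length (s 1)) False @ s 2))" for s K
  proof (induction "s 1" arbitrary: s)
    case Nil
    have eq: "s(1 := [], 2 := replicate (length (s 1)) False @ s 2) = s"
      using Nil[symmetric] by (auto simp: fun_eq_iff)
    show ?case unfolding eq using Nil[symmetric] by (simp add: reaches_instr)
  next
    case (Cons b xs)
    let ?s = "s(1 := xs, 2 := False # s 2)"
    have s0: "s 1 = b # xs" using Cons.hyps(2) by simp
    have "reaches 3 (?l2 # K, s) (?l2 # K, ?s)"
      using s0 by (simp add: reaches_instr)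
    also have "reaches (3 * length (?s 1) + 1) (?l2 # K, ?s)
        (K, ?s(1 := [], 2 := replicate (length (?s 1)) False @ ?s 2))"
      by (rule Cons.hyps(1)) simp
    finally have "reaches (3 + (3 * length (?s 1) + 1)) (?l2 # K, s)
        (K, ?s(1 := [], 2 := replicate (length (?s 1)) False @ ?s 2))" .
    moreover have "?s(1 := [], 2 := replicate (length (?s 1)) False @ ?s 2)
        = s(1 := [], 2 := replicate (length (s 1)) False @ s 2)"
      using s0 by (auto simp: fun_eq_iff replicate_append_same[symmetric])
    ultimately have "reaches (3 + (3 * length (?s 1) + 1)) (?l2 # K, s)
        (K, s(1 := [], 2 := replicate (length (s 1)) False @ s 2))" by (simp only:)
    then show ?case by (rule reaches_mono) (simp add: s0[simplified])
  qed
  have "ppt UNIV (\<lambda>(w, T). [w, unary T]) (\<lambda>i. return_pmf (case i of (w, T) \<Rightarrow> pad_string T w))"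
  proof (rule pptI_det)
    show "poly_bounded B" unfolding B_def
      by (intro poly_bounded_add poly_bounded_mult poly_bounded_id poly_bounded_const)
    fix i :: "bool list \<times> nat"
    obtain w T where i: "i = (w, T)" by force
    let ?s = "load [w, unary T]"
    define L where "L = length w + T"
    have "reaches (5 * L + 1) (?p, ?s) ([?l2, move 2 0], ?s(0 := [], 1 := drop (length w) (unary T), 2 := rev w))"
      by (rule reaches_mono[where B = "5 * length w + 1"])
        (use loop1[of ?s "[?l2, move 2 0]"] in \<open>simp_all add: load_simps L_def\<close>)
    also have "reaches (3 * L + 1) \<dots> ([move 2 0], ?s(0 := [], 1 := [], 2 := replicate (T - length w) False @ rev w))"
    proof (rule reaches_mono)
      let ?s' = "?s(0 := [], 1 := drop (length w) (unary T), 2 := rev w)"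
      have "?s'(1 := [], 2 := replicate (length (?s' 1)) False @ ?s' 2)
          = ?s(0 := [], 1 := [], 2 := replicate (T - length w) False @ rev w)"
        by (auto simp: fun_eq_iff)
      then show "reaches (3 * (T - length w) + 1) ([?l2, move 2 0], ?s')
          ([move 2 0], ?s(0 := [], 1 := [], 2 := replicate (T - length w) False @ rev w))"
        using loop2[of ?s' "[move 2 0]"] by simp
    qed (simp add: L_def)
    also have "reaches (4 * (2 * L) + 1) \<dots> ([], ?s(0 := pad_string T w, 1 := [], 2 := []))"
      by (rule reaches_moveI[where L = "2 * L"]) (auto simp: fun_eq_iff L_def pad_string_def)
    finally have r: "reaches (B L) (?p, ?s) ([], ?s(0 := pad_string T w, 1 := [], 2 := []))"
      by (simp add: B_def)
    show "\<exists>s. reaches (B (args_size (case i of (w, T) \<Rightarrow> [w, unary T])))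
        (?p, load (case i of (w, T) \<Rightarrow> [w, unary T])) ([], s) \<and> s 0 = (case i of (w, T) \<Rightarrow> pad_string T w)"
      unfolding i prod.case by (rule exI, rule conjI, rule reaches_mono[OF r]) (simp_all add: L_def)
  qed
  then show ?thesis by (simp add: case_prod_unfold)
qed

section \<open>A program that evaluates circuits\<close>

text \<open>Register 0 holds the rest of the encoded circuit and register 1 the wire values so far.\<close>

definition look :: "nat \<Rightarrow> instr list" where
  "look d = copy 1 7 6 @ read_nat 0 2 (Pop 6) @ [Cond 6 [Push d True] [Push d False], Loop 6 [Pop 6]]"

text \<open>Random access to a stack: the wire values are copied to register 6, and the index, while
  it is parsed, pops the entries in front of the wanted one.\<close>

lemma reaches_look:
  assumes "s 0 = enc_nat i @ u" "i < length (s 1)" "length (s 1) \<le> M"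
    "s 2 = []" "s 6 = []" "s 7 = []" "d \<in> {4, 5}" "15 * M + 11 \<le> B"
    "s(0 := u, d := (s 1 ! i) # s d) = s'"
  shows "reaches B (look d @ K, s) (K, s')"
proof -
  let ?c = "Cond 6 [Push d True] [Push d False]"
  define w where "w = s 1"
  have i: "i < length w" using assms by (simp add: w_def)
  have "reaches (9 * M + 2) (look d @ K, s) (read_nat 0 2 (Pop 6) @ ?c # Loop 6 [Pop 6] # K, s(6 := w))"
    unfolding look_def append_assoc append_Cons append_Nil
    by (rule reaches_copyI[where L = M]) (use assms in \<open>auto simp: w_def\<close>)
  also have "reaches (4 * M + 6) \<dots> (?c # Loop 6 [Pop 6] # K, s(0 := u, 6 := drop i w))"
    by (rule reaches_read_pop[where M = M and i = i and u = u]) (use assms in \<open>auto simp: fun_eq_iff\<close>)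
  also have "reaches 2 \<dots> (Loop 6 [Pop 6] # K, s(0 := u, 6 := drop i w, d := (w ! i) # s d))"
    using i assms(7) by (cases "w ! i") (auto simp: reaches_instr hd_drop_conv_nth)
  also have "reaches (2 * M + 1) \<dots> (K, s')"
    by (rule reaches_clearI[where L = M])
      (use assms(1-8) in \<open>auto simp: assms(9)[symmetric] fun_eq_iff w_def\<close>)
  finally show ?thesis by (rule reaches_mono) (use assms(8) in simp)
qed

text \<open>Wire 0 is on top of register 1, so a new value belongs at the bottom: the stack is
  reversed into register 7, the value is pushed, and the stack is reversed back. Registers 4 and 5
  hold the operands, 8 the value.\<close>

definition eval_gate_prog :: "instr list" where
  "eval_gate_prog = [Cond 0
     (Pop 0 # look 4 @ look 5 @
       [Cond 4 [Cond 5 [Push 8 False] [Push 8 True]] [Push 8 True], Pop 4, Pop 5])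
     [Pop 0, Push 8 False],
     move 1 7, Cond 8 [Push 7 True] [Push 7 False], Pop 8, move 7 1]"

lemma reaches_eval_gate:
  assumes "s 0 = enc_gate g @ u" "gate_ok (length (s 1)) g" "length (s 1) < M"
    "\<And>r. r \<in> {2, 4, 5, 6, 7, 8} \<Longrightarrow> s r = []"
  shows "reaches (40 * M + 40) (eval_gate_prog @ K, s) (K, s(0 := u, 1 := s 1 @ [gate_val (s 1) g]))"
proof -
  define w where "w = s 1"
  let ?K = "[move 1 7, Cond 8 [Push 7 True] [Push 7 False], Pop 8, move 7 1] @ K"
  let ?b = "gate_val w g"
  have e: "s 2 = []" "s 4 = []" "s 5 = []" "s 6 = []" "s 7 = []" "s 8 = []" using assms(4) by auto
  have "reaches (30 * M + 29) (eval_gate_prog @ K, s) (?K, s(0 := u, 8 := [?b]))"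
  proof (cases g)
    case Zero
    have "reaches 3 (eval_gate_prog @ K, s) (?K, s(0 := u, 8 := [?b]))"
      using assms(1) e by (simp add: Zero eval_gate_prog_def reaches_instr)
    then show ?thesis by (rule reaches_mono) simp
  next
    case (Nand i j)
    let ?c = "Cond 4 [Cond 5 [Push 8 False] [Push 8 True]] [Push 8 True]"
    have ij: "i < length w" "j < length w" using assms(2) by (auto simp: Nand w_def)
    have "reaches 2 (eval_gate_prog @ K, s) (look 4 @ look 5 @ ?c # Pop 4 # Pop 5 # ?K, s(0 := enc_nat i @ enc_nat j @ u))"
      using assms(1) by (simp add: Nand eval_gate_prog_def reaches_instr)
    also have "reaches (15 * M + 11) \<dots> (look 5 @ ?c # Pop 4 # Pop 5 # ?K, s(0 := enc_nat j @ u, 4 := [w ! i]))"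
      by (rule reaches_look[where M = M and i = i and u = "enc_nat j @ u"])
        (use ij assms(3) in \<open>auto simp: e w_def fun_eq_iff\<close>)
    also have "reaches (15 * M + 11) \<dots> (?c # Pop 4 # Pop 5 # ?K, s(0 := u, 4 := [w ! i], 5 := [w ! j]))"
      by (rule reaches_look[where M = M and i = j and u = u])
        (use ij assms(3) in \<open>auto simp: e w_def fun_eq_iff\<close>)
    also have "reaches 5 \<dots> (?K, s(0 := u, 8 := [?b]))"
    proof -
      have eq: "s(0 := u, 4 := [w ! i], 5 := [w ! j], 8 := [?b], 4 := [], 5 := []) = s(0 := u, 8 := [?b])"
        using e by (auto simp: fun_eq_iff)
      have "reaches 5 (?c # Pop 4 # Pop 5 # ?K, s(0 := u, 4 := [w ! i], 5 := [w ! j]))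
          (?K, s(0 := u, 4 := [w ! i], 5 := [w ! j], 8 := [?b], 4 := [], 5 := []))"
        using e by (cases "w ! i"; cases "w ! j") (simp_all add: reaches_instr Nand)
      then show ?thesis unfolding eq .
    qed
    finally show ?thesis by (rule reaches_mono) simp
  qed
  also have "reaches (4 * M + 1) \<dots> ([Cond 8 [Push 7 True] [Push 7 False], Pop 8, move 7 1] @ K,
      s(0 := u, 8 := [?b], 1 := [], 7 := rev w))"
    unfolding append_Cons by (rule reaches_moveI[where L = M]) (use assms(3) in \<open>auto simp: w_def e fun_eq_iff\<close>)
  also have "reaches 3 \<dots> (move 7 1 # K, s(0 := u, 8 := [?b], 1 := [], 7 := ?b # rev w, 8 := []))"
    by (cases ?b) (simp_all add: reaches_instr)
  also have "reaches (4 * M + 1) \<dots> (K, s(0 := u, 1 := s 1 @ [gate_val (s 1) g]))"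
    by (rule reaches_moveI[where L = M]) (use assms(3) in \<open>auto simp: w_def e fun_eq_iff\<close>)
  finally show ?thesis by (rule reaches_mono) simp
qed

text \<open>Gates end the encoding, and none has an empty code, so emptiness of register 0 is the
  right loop test.\<close>

lemma reaches_eval_gates:
  assumes "s 0 = enc_gates gs" "gates_ok (length (s 1)) gs" "length (s 1) + length gs \<le> M"
    "\<And>r. r \<in> {2, 4, 5, 6, 7, 8} \<Longrightarrow> s r = []"
  shows "reaches (length gs * (40 * M + 41) + 1) (Loop 0 eval_gate_prog # K, s) (K, s(0 := [], 1 := wires (s 1) gs))"
  using assms
proof (induction gs arbitrary: s)
  case Nil
  then have eq: "s(0 := [], 1 := wires (s 1) []) = s" by (auto simp: fun_eq_iff)
  show ?case unfolding eq using Nil by (simp add: reaches_instr)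
next
  case (Cons g gs)
  let ?s = "s(0 := enc_gates gs, 1 := s 1 @ [gate_val (s 1) g])"
  have ne: "s 0 \<noteq> []" using Cons.prems(1) by (cases g) auto
  have "reaches 1 (Loop 0 eval_gate_prog # K, s) (eval_gate_prog @ Loop 0 eval_gate_prog # K, s)"
    using ne by (simp add: reaches_instr)
  also have "reaches (40 * M + 40) \<dots> (Loop 0 eval_gate_prog # K, ?s)"
    by (rule reaches_eval_gate) (use Cons.prems in auto)
  also have "reaches (length gs * (40 * M + 41) + 1) \<dots> (K, ?s(0 := [], 1 := wires (?s 1) gs))"
  proof (rule Cons.IH[of ?s])
    show "gates_ok (length (?s 1)) gs" "length (?s 1) + length gs \<le> M" using Cons.prems(2,3) by auto
    show "?s r = []" if "r \<in> {2, 4, 5, 6, 7, 8}" for r using Cons.prems(4)[OF that] that by auto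
  qed simp
  finally have r: "reaches (1 + (40 * M + 40) + (length gs * (40 * M + 41) + 1)) (Loop 0 eval_gate_prog # K, s)
      (K, ?s(0 := [], 1 := wires (?s 1) gs))" .
  have eq: "?s(0 := [], 1 := wires (?s 1) gs) = s(0 := [], 1 := wires (s 1) (g # gs))"
    by (auto simp: fun_eq_iff)
  show ?case by (rule reaches_mono[OF r[unfolded eq]]) simp
qed

lemma length_enc_gates: "length gs \<le> length (enc_gates gs)"
proof (induction gs)
  case (Cons g gs)
  have "1 \<le> length (enc_gate g)" by (cases g) auto
  with Cons show ?case by simp
qed simp

lemma ppt_eval_circuit:
  "ppt {(C, x). \<exists>n. C \<in> circuits n 1 \<and> x \<in> bits n} (\<lambda>(C, x). [encode C, x]) (\<lambda>(C, x). return_pmf (eval_circuit C x))"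
proof -
  \<comment> \<open>Arity and number of outputs are parsed into register 9 and left there. The
    output index waits in register 3 during the loop and is then written back to register 0 as an
    encoded number, so that \<open>look\<close> can fetch the wire.\<close>
  let ?tail = "[Push 0 False, move 3 0] @ look 4 @ [Cond 4 [Push 0 True] [Push 0 False]]"
  let ?p = "read_nat 0 2 (Push 9 True) @ read_nat 0 2 (Push 9 True) @ read_nat 0 2 (Push 3 True) @
    Loop 0 eval_gate_prog # ?tail"
  define T where "T = (\<lambda>M. 3 * (4 * M + 6) + (M * (40 * M + 41) + 1) + (1 + (4 * M + 1) + (15 * M + 11) + 2) :: nat)"
  have "ppt {(C, x). \<exists>n. C \<in> circuits n 1 \<and> x \<in> bits n} (\<lambda>(C, x). [encode C, x])
      (\<lambda>i. return_pmf (case i of (C, x) \<Rightarrow> eval_circuit C x))"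
  proof (rule pptI_det)
    show "poly_bounded T" unfolding T_def
      by (intro poly_bounded_add poly_bounded_mult poly_bounded_id poly_bounded_const)
    fix i :: "circuit \<times> bool list" assume "i \<in> {(C, x). \<exists>n. C \<in> circuits n 1 \<and> x \<in> bits n}"
    then obtain C x n where i: "i = (C, x)" and "C \<in> circuits n 1" and lx: "length x = n"
      by (auto simp: bits_def)
    then obtain gs j where C: "C = Circuit n gs [j]" "gates_ok n gs" "j < n + length gs"
      using circuits_1E by metis
    define s where "s = load [encode C, x]"
    define M where "M = args_size [encode C, x]"
    have enc: "encode C = enc_nat n @ enc_nat 1 @ enc_nat j @ enc_gates gs"
      unfolding C(1) by (rule encode_1)
    have lM: "n + length gs \<le> M" "j \<le> M" "1 \<le> M" "n \<le> M" "length gs \<le> M"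
      using length_enc_gates[of gs] by (auto simp: M_def enc enc_nat_def)
    have s: "s 0 = encode C" "s 1 = x" "\<And>r. 2 \<le> r \<Longrightarrow> s r = []" by (auto simp: s_def load_def)
    have "reaches (4 * M + 6) (?p, s) (read_nat 0 2 (Push 9 True) @ read_nat 0 2 (Push 3 True) @
        Loop 0 eval_gate_prog # ?tail, s(0 := enc_nat 1 @ enc_nat j @ enc_gates gs, 9 := unary n))"
      by (rule reaches_read_push[where i = n and u = "enc_nat 1 @ enc_nat j @ enc_gates gs" and M = M])
        (use lM in \<open>auto simp: s enc\<close>)
    also have "reaches (4 * M + 6) \<dots> (read_nat 0 2 (Push 3 True) @
        Loop 0 eval_gate_prog # ?tail, s(0 := enc_nat j @ enc_gates gs, 9 := unary (n + 1)))"
      by (rule reaches_read_push[where i = 1 and u = "enc_nat j @ enc_gates gs" and M = M])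
        (use lM in \<open>auto simp: s fun_eq_iff unary_append\<close>)
    also have "reaches (4 * M + 6) \<dots> (Loop 0 eval_gate_prog # ?tail,
        s(0 := enc_gates gs, 9 := unary (n + 1), 3 := unary j))"
      by (rule reaches_read_push[where i = j and u = "enc_gates gs" and M = M])
        (use lM in \<open>auto simp: s fun_eq_iff\<close>)
    also have "reaches (M * (40 * M + 41) + 1) \<dots>
        (?tail, s(0 := [], 1 := wires x gs, 9 := unary (n + 1), 3 := unary j))"
    proof -
      let ?s = "s(0 := enc_gates gs, 9 := unary (n + 1), 3 := unary j)"
      have eq: "?s(0 := [], 1 := wires (?s 1) gs) = s(0 := [], 1 := wires x gs, 9 := unary (n + 1), 3 := unary j)"
        using s(2) by (auto simp: fun_eq_iff)
      have "reaches (length gs * (40 * M + 41) + 1) (Loop 0 eval_gate_prog # ?tail, ?s)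
          (?tail, ?s(0 := [], 1 := wires (?s 1) gs))"
        by (rule reaches_eval_gates) (use lM C(2) s(2) in \<open>auto simp: s(3) lx\<close>)
      then show ?thesis unfolding eq
        by (rule reaches_mono) (use lM in \<open>auto intro!: mult_mono\<close>)
    qed
    also have "reaches 1 \<dots> (move 3 0 # look 4 @ [Cond 4 [Push 0 True] [Push 0 False]],
        s(0 := [], 1 := wires x gs, 9 := unary (n + 1), 3 := unary j, 0 := [False]))"
      by (simp add: reaches_instr)
    also have "reaches (4 * M + 1) \<dots> (look 4 @ [Cond 4 [Push 0 True] [Push 0 False]],
        s(0 := enc_nat j @ [], 1 := wires x gs, 9 := unary (n + 1), 3 := []))"
      by (rule reaches_moveI[where L = M]) (use lM in \<open>auto simp: fun_eq_iff enc_nat_unary\<close>)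
    also have "reaches (15 * M + 11) \<dots> ([Cond 4 [Push 0 True] [Push 0 False]],
        s(0 := [], 1 := wires x gs, 9 := unary (n + 1), 3 := [], 4 := [wires x gs ! j]))"
      by (rule reaches_look[where M = M and i = j and u = "[]"])
        (use lM C(3) in \<open>auto simp: fun_eq_iff s lx\<close>)
    also have "reaches 2 \<dots> ([],
        s(0 := [], 1 := wires x gs, 9 := unary (n + 1), 3 := [], 4 := [wires x gs ! j], 0 := [wires x gs ! j]))"
      by (cases "wires x gs ! j") (simp_all add: reaches_instr)
    finally have r: "reaches (4 * M + 6 + (4 * M + 6) + (4 * M + 6) + (M * (40 * M + 41) + 1) + 1 + (4 * M + 1) + (15 * M + 11) + 2)
      (?p, s) ([], s(0 := [], 1 := wires x gs, 9 := unary (n + 1), 3 := [], 4 := [wires x gs ! j], 0 := [wires x gs ! j]))" .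
    show "\<exists>s. reaches (T (args_size (case i of (C, x) \<Rightarrow> [encode C, x])))
        (?p, load (case i of (C, x) \<Rightarrow> [encode C, x])) ([], s) \<and> s 0 = (case i of (C, x) \<Rightarrow> eval_circuit C x)"
      unfolding i prod.case
      by (rule exI, rule conjI, rule reaches_mono[OF r[unfolded s_def M_def]])
        (simp_all add: T_def eval_circuit_wires C(1))
  qed
  then show ?thesis by (simp add: case_prod_unfold)
qed

section \<open>A program that patches encoded circuits\<close>

text \<open>Register 7 collects the encoded gates in reverse. Registers 3, 4, 8 and 9 hold in unary the arity,
  the output wire, the input being compared and the last wire; 1 and 2 hold the point and its new value.\<close>

definition emit :: "nat \<Rightarrow> nat \<Rightarrow> instr list" where
  "emit e k = copy e 10 7 @ replicate k (Push 7 True) @ [Push 7 False]"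

lemma reaches_replicate_Push: "reaches k (replicate k (Push d True) @ K, s) (K, s(d := unary k @ s d))"
proof (induction k arbitrary: s)
  case 0
  then show ?case by (simp add: unary_def)
next
  case (Suc k)
  have eq: "unary k @ True # xs = unary (Suc k) @ xs" for xs
    by (simp add: unary_def replicate_app_Cons_same)
  have eq': "(s(d := True # s d))(d := unary k @ (s(d := True # s d)) d) = s(d := unary (Suc k) @ s d)"
    by (auto simp: fun_eq_iff eq)
  show ?case
    by (rule reaches_step[OF _ Suc[of "s(d := True # s d)", unfolded eq']]) (simp add: fun_eq_iff)
qed

text \<open>The offset \<open>k\<close> lets one register name several neighbouring wires, such as
  \<open>a\<close>, \<open>a + 1\<close> and \<open>a + 2\<close>.\<close>

lemma reaches_emit:
  assumes "s e = unary v" "s 10 = []" "e \<notin> {7, 10}" "v \<le> M" "k \<le> 3" "9 * M + 6 \<le> B"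
    "s(7 := rev (enc_nat (v + k)) @ s 7) = s'"
  shows "reaches B (emit e k @ K, s) (K, s')"
proof -
  have "reaches (9 * M + 2) (emit e k @ K, s) (replicate k (Push 7 True) @ Push 7 False # K, s(7 := unary v @ s 7))"
    unfolding emit_def append_assoc append_Cons append_Nil
    by (rule reaches_copyI[where L = M]) (use assms(1-6) in auto)
  also have "reaches k \<dots> (Push 7 False # K, s(7 := unary (v + k) @ s 7))"
    using reaches_replicate_Push[of k 7 "Push 7 False # K" "s(7 := unary v @ s 7)"]
    by (simp add: unary_append add.commute flip: append_assoc)
  also have "reaches 1 \<dots> (K, s')"
    by (simp add: reaches_instr rev_enc_nat flip: assms(7))
  finally show ?thesis by (rule reaches_mono) (use assms(5,6) in simp)
qed

definition emit_nand :: "nat \<Rightarrow> nat \<Rightarrow> nat \<Rightarrow> nat \<Rightarrow> instr list" where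
  "emit_nand e k f l = Push 7 True # emit e k @ emit f l"

lemma reaches_emit_nand:
  assumes "s e = unary v" "s f = unary w" "s 10 = []" "e \<notin> {7, 10}" "f \<notin> {7, 10}"
    "v \<le> M" "w \<le> M" "k \<le> 3" "l \<le> 3" "18 * M + 13 \<le> B"
    "s(7 := rev (enc_gate (Nand (v + k) (w + l))) @ s 7) = s'"
  shows "reaches B (emit_nand e k f l @ K, s) (K, s')"
proof -
  have "reaches 1 (emit_nand e k f l @ K, s) (emit e k @ emit f l @ K, s(7 := True # s 7))"
    by (simp add: emit_nand_def reaches_instr)
  also have "reaches (9 * M + 6) \<dots> (emit f l @ K, s(7 := rev (enc_nat (v + k)) @ True # s 7))"
    by (rule reaches_emit[where v = v and M = M]) (use assms(1-10) in auto)
  also have "reaches (9 * M + 6) \<dots> (K, s')"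
    by (rule reaches_emit[where v = w and M = M]) (use assms(1-10) in \<open>auto simp flip: assms(11)\<close>)
  finally show ?thesis by (rule reaches_mono) (use assms(10) in simp)
qed

text \<open>One unfolding of \<open>cmp_gates\<close>: the bit on top of register 1 selects the
  second operand of the middle gate; afterwards the last wire advances by 3 and the input by
  1.\<close>

definition cmp_prog :: "instr list" where
  "cmp_prog = emit_nand 8 0 8 0 @ Push 7 True # emit 9 0 @ Cond 1 (emit 8 0) (emit 9 1) #
     emit_nand 9 2 9 2 @ [Push 9 True, Push 9 True, Push 9 True, Push 8 True, Pop 1]"

lemma reaches_cmp_step:
  assumes "s 1 = x # xs" "s 8 = unary i" "s 9 = unary a" "s 10 = []" "i \<le> M" "a \<le> M"
  shows "reaches (60 * M + 60) (cmp_prog @ K, s)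
    (K, s(1 := xs, 8 := unary (i + 1), 9 := unary (a + 3), 7 := rev (enc_gates
      [Nand i i, Nand a (if x then i else a + 1), Nand (a + 2) (a + 2)]) @ s 7))"
proof -
  let ?g1 = "Nand i i" and ?g2 = "Nand a (if x then i else a + 1)" and ?g3 = "Nand (a + 2) (a + 2)"
  let ?K3 = "[Push 9 True, Push 9 True, Push 9 True, Push 8 True, Pop 1] @ K"
  let ?K2 = "emit_nand 9 2 9 2 @ ?K3"
  have "reaches (18 * M + 13) (cmp_prog @ K, s)
      ((Push 7 True # emit 9 0 @ Cond 1 (emit 8 0) (emit 9 1) # ?K2), s(7 := rev (enc_gate ?g1) @ s 7))"
    unfolding cmp_prog_def append_assoc append_Cons
    by (rule reaches_emit_nand[where v = i and w = i and M = M]) (use assms in auto)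
  also have "reaches 1 \<dots> (emit 9 0 @ Cond 1 (emit 8 0) (emit 9 1) # ?K2, s(7 := True # rev (enc_gate ?g1) @ s 7))"
    by (simp add: reaches_instr)
  also have "reaches (9 * M + 6) \<dots> (Cond 1 (emit 8 0) (emit 9 1) # ?K2,
      s(7 := rev (enc_nat a) @ True # rev (enc_gate ?g1) @ s 7))"
    by (rule reaches_emit[where v = a and M = M]) (use assms in auto)
  also have "reaches (9 * M + 7) \<dots> (?K2, s(7 := rev (enc_gates [?g1, ?g2]) @ s 7))"
  proof -
    let ?s = "s(7 := rev (enc_nat a) @ True # rev (enc_gate ?g1) @ s 7)"
    have "reaches (9 * M + 6) ((if x then emit 8 0 else emit 9 1) @ ?K2, ?s) (?K2, s(7 := rev (enc_gates [?g1, ?g2]) @ s 7))"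
    proof (cases x)
      case True
      have "reaches (9 * M + 6) (emit 8 0 @ ?K2, ?s) (?K2, s(7 := rev (enc_gates [?g1, ?g2]) @ s 7))"
        by (rule reaches_emit[where v = i and M = M]) (use assms True in auto)
      then show ?thesis using True by simp
    next
      case False
      have "reaches (9 * M + 6) (emit 9 1 @ ?K2, ?s) (?K2, s(7 := rev (enc_gates [?g1, ?g2]) @ s 7))"
        by (rule reaches_emit[where v = a and M = M]) (use assms False in auto)
      then show ?thesis using False by simp
    qed
    then have "reaches (Suc (9 * M + 6)) (Cond 1 (emit 8 0) (emit 9 1) # ?K2, ?s) (?K2, s(7 := rev (enc_gates [?g1, ?g2]) @ s 7))"
      by (rule reaches_step[rotated]) (use assms(1) in simp)
    then show ?thesis by (rule reaches_mono) simp
  qed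
  also have "reaches (18 * M + 13) \<dots> (?K3, s(7 := rev (enc_gates [?g1, ?g2, ?g3]) @ s 7))"
    by (rule reaches_emit_nand[where v = a and w = a and M = M]) (use assms in auto)
  also have "reaches 5 \<dots> (K, s(1 := xs, 8 := unary (i + 1), 9 := unary (a + 3), 7 := rev (enc_gates [?g1, ?g2, ?g3]) @ s 7))"
  proof -
    let ?s = "s(7 := rev (enc_gates [?g1, ?g2, ?g3]) @ s 7)"
    define s' where "s' = s(1 := xs, 8 := unary (i + 1), 9 := unary (a + 3), 7 := rev (enc_gates [?g1, ?g2, ?g3]) @ s 7)"
    have eq: "?s(9 := True # ?s 9, 9 := True # True # ?s 9, 9 := True # True # True # ?s 9, 8 := True # ?s 8, 1 := tl (?s 1)) = s'"
      using assms by (auto simp: s'_def fun_eq_iff unary_Suc numeral_eq_Suc)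
    have "reaches 5 (?K3, ?s) (K, ?s(9 := True # ?s 9, 9 := True # True # ?s 9, 9 := True # True # True # ?s 9, 8 := True # ?s 8, 1 := tl (?s 1)))"
      by (simp add: reaches_instr)
    then show ?thesis unfolding eq s'_def .
  qed
  finally show ?thesis by (rule reaches_mono) simp
qed

lemma reaches_cmp:
  assumes "s 1 = xs" "s 8 = unary i" "s 9 = unary a" "s 10 = []" "i + length xs \<le> M" "a + 3 * length xs \<le> M"
  shows "reaches (length xs * (60 * M + 61) + 1) (Loop 1 cmp_prog # K, s)
    (K, s(1 := [], 8 := unary (i + length xs), 9 := unary (a + 3 * length xs),
      7 := rev (enc_gates (cmp_gates i a xs)) @ s 7))"
  using assms
proof (induction xs arbitrary: s i a)
  case Nil
  then have eq: "s(1 := [], 8 := unary (i + length []), 9 := unary (a + 3 * length []),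
      7 := rev (enc_gates (cmp_gates i a [])) @ s 7) = s"
    by (auto simp: fun_eq_iff)
  show ?case unfolding eq using Nil by (simp add: reaches_instr)
next
  case (Cons x xs)
  let ?s = "s(1 := xs, 8 := unary (i + 1), 9 := unary (a + 3), 7 := rev (enc_gates
      [Nand i i, Nand a (if x then i else a + 1), Nand (a + 2) (a + 2)]) @ s 7)"
  have "reaches 1 (Loop 1 cmp_prog # K, s) (cmp_prog @ Loop 1 cmp_prog # K, s)"
    using Cons.prems(1) by (simp add: reaches_instr)
  also have "reaches (60 * M + 60) \<dots> (Loop 1 cmp_prog # K, ?s)"
    by (rule reaches_cmp_step) (use Cons.prems in auto)
  also have "reaches (length xs * (60 * M + 61) + 1) \<dots> (K, ?s(1 := [], 8 := unary (i + 1 + length xs),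
      9 := unary (a + 3 + 3 * length xs), 7 := rev (enc_gates (cmp_gates (i + 1) (a + 3) xs)) @ ?s 7))"
    by (rule Cons.IH[of ?s "i + 1" "a + 3"]) (use Cons.prems in auto)
  finally have r: "reaches (1 + (60 * M + 60) + (length xs * (60 * M + 61) + 1)) (Loop 1 cmp_prog # K, s)
    (K, ?s(1 := [], 8 := unary (i + 1 + length xs),
      9 := unary (a + 3 + 3 * length xs), 7 := rev (enc_gates (cmp_gates (i + 1) (a + 3) xs)) @ ?s 7))" .
  have eq: "?s(1 := [], 8 := unary (i + 1 + length xs),
      9 := unary (a + 3 + 3 * length xs), 7 := rev (enc_gates (cmp_gates (i + 1) (a + 3) xs)) @ ?s 7)
    = s(1 := [], 8 := unary (i + length (x # xs)), 9 := unary (a + 3 * length (x # xs)),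
      7 := rev (enc_gates (cmp_gates i a (x # xs))) @ s 7)"
    by (auto simp: fun_eq_iff add.assoc)
  show ?case by (rule reaches_mono[OF r[unfolded eq]]) simp
qed

text \<open>The tag bit tells whether two numbers follow; they are skipped by popping the empty
  register 12. As register 6 starts with the arity, it ends with the number of wires.\<close>

definition count_prog :: "instr list" where
  "count_prog = [Cond 5 (Pop 5 # read_nat 5 11 (Pop 12) @ read_nat 5 11 (Pop 12)) [Pop 5], Push 6 True]"

lemma reaches_count:
  assumes "s 5 = enc_gates gs" "s 11 = []" "s 12 = []" "length (enc_gates gs) \<le> M"
  shows "reaches (length gs * (8 * M + 16) + 1) (Loop 5 count_prog # K, s)
    (K, s(5 := [], 6 := unary (length gs) @ s 6))"
  using assms
proof (induction gs arbitrary: s)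
  case Nil
  then have eq: "s(5 := [], 6 := unary (length []) @ s 6) = s"
    by (auto simp: fun_eq_iff unary_def)
  show ?case unfolding eq using Nil by (simp add: reaches_instr)
next
  case (Cons g gs)
  let ?s = "s(5 := enc_gates gs, 6 := True # s 6)"
  have ne: "s 5 \<noteq> []" using Cons.prems(1) by (cases g) auto
  have "reaches 1 (Loop 5 count_prog # K, s) (count_prog @ Loop 5 count_prog # K, s)"
    using ne by (simp add: reaches_instr)
  also have "reaches (8 * M + 15) \<dots> (Loop 5 count_prog # K, ?s)"
  proof (cases g)
    case Zero
    have "reaches 3 (count_prog @ Loop 5 count_prog # K, s) (Loop 5 count_prog # K, ?s)"
      using Cons.prems(1) by (simp add: Zero count_prog_def reaches_instr)
    then show ?thesis by (rule reaches_mono) simp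
  next
    case (Nand i j)
    let ?K = "Push 6 True # Loop 5 count_prog # K"
    have ij: "i \<le> M" "j \<le> M" using Cons.prems(4) by (auto simp: Nand enc_nat_def)
    have "reaches 2 (count_prog @ Loop 5 count_prog # K, s)
        (read_nat 5 11 (Pop 12) @ read_nat 5 11 (Pop 12) @ ?K, s(5 := enc_nat i @ enc_nat j @ enc_gates gs))"
      using Cons.prems(1) by (simp add: Nand count_prog_def reaches_instr)
    also have "reaches (4 * M + 6) \<dots> (read_nat 5 11 (Pop 12) @ ?K, s(5 := enc_nat j @ enc_gates gs))"
      by (rule reaches_read_pop[where i = i and M = M and u = "enc_nat j @ enc_gates gs"])
        (use Cons.prems ij in \<open>auto simp: fun_eq_iff\<close>)
    also have "reaches (4 * M + 6) \<dots> (?K, s(5 := enc_gates gs))"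
      by (rule reaches_read_pop[where i = j and M = M and u = "enc_gates gs"])
        (use Cons.prems ij in \<open>auto simp: fun_eq_iff\<close>)
    also have "reaches 1 \<dots> (Loop 5 count_prog # K, ?s)" by (simp add: reaches_instr)
    finally show ?thesis by (rule reaches_mono) simp
  qed
  also have "reaches (length gs * (8 * M + 16) + 1) \<dots> (K, ?s(5 := [], 6 := unary (length gs) @ ?s 6))"
    by (rule Cons.IH[of ?s]) (use Cons.prems in auto)
  finally have r: "reaches (1 + (8 * M + 15) + (length gs * (8 * M + 16) + 1)) (Loop 5 count_prog # K, s)
    (K, ?s(5 := [], 6 := unary (length gs) @ ?s 6))" .
  have eq: "?s(5 := [], 6 := unary (length gs) @ ?s 6) = s(5 := [], 6 := unary (length (g # gs)) @ s 6)"
    by (auto simp: fun_eq_iff unary_def replicate_app_Cons_same)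
  show ?case by (rule reaches_mono[OF r[unfolded eq]]) simp
qed

definition select_prog :: "instr list" where
  "select_prog = [Cond 2 (emit_nand 4 0 4 0 @ emit_nand 9 0 9 0 @ emit_nand 9 1 9 2)
     (emit_nand 9 0 9 0 @ emit_nand 4 0 9 1 @ emit_nand 9 2 9 2)]"

lemma reaches_select:
  assumes "s 2 = [b]" "s 4 = unary j" "s 9 = unary a" "s 10 = []" "j \<le> M" "a \<le> M"
  shows "reaches (54 * M + 40) (select_prog @ K, s) (K, s(7 := rev (enc_gates
    (if b then [Nand j j, Nand a a, Nand (a + 1) (a + 2)]
     else [Nand a a, Nand j (a + 1), Nand (a + 2) (a + 2)])) @ s 7))"
proof (cases b)
  case True
  have "reaches 1 (select_prog @ K, s) (emit_nand 4 0 4 0 @ emit_nand 9 0 9 0 @ emit_nand 9 1 9 2 @ K, s)"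
    using assms(1) True by (simp add: select_prog_def reaches_instr)
  also have "reaches (18 * M + 13) \<dots> (emit_nand 9 0 9 0 @ emit_nand 9 1 9 2 @ K, s(7 := rev (enc_gates [Nand j j]) @ s 7))"
    by (rule reaches_emit_nand[where v = j and w = j and M = M]) (use assms in auto)
  also have "reaches (18 * M + 13) \<dots> (emit_nand 9 1 9 2 @ K, s(7 := rev (enc_gates [Nand j j, Nand a a]) @ s 7))"
    by (rule reaches_emit_nand[where v = a and w = a and M = M]) (use assms in auto)
  also have "reaches (18 * M + 13) \<dots> (K, s(7 := rev (enc_gates [Nand j j, Nand a a, Nand (a + 1) (a + 2)]) @ s 7))"
    by (rule reaches_emit_nand[where v = a and w = a and M = M]) (use assms in auto)
  finally show ?thesis unfolding if_P[OF True] by (rule reaches_mono) simp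
next
  case False
  have "reaches 1 (select_prog @ K, s) (emit_nand 9 0 9 0 @ emit_nand 4 0 9 1 @ emit_nand 9 2 9 2 @ K, s)"
    using assms(1) False by (simp add: select_prog_def reaches_instr)
  also have "reaches (18 * M + 13) \<dots> (emit_nand 4 0 9 1 @ emit_nand 9 2 9 2 @ K, s(7 := rev (enc_gates [Nand a a]) @ s 7))"
    by (rule reaches_emit_nand[where v = a and w = a and M = M]) (use assms in auto)
  also have "reaches (18 * M + 13) \<dots> (emit_nand 9 2 9 2 @ K, s(7 := rev (enc_gates [Nand a a, Nand j (a + 1)]) @ s 7))"
    by (rule reaches_emit_nand[where v = j and w = a and M = M]) (use assms in auto)
  also have "reaches (18 * M + 13) \<dots> (K, s(7 := rev (enc_gates [Nand a a, Nand j (a + 1), Nand (a + 2) (a + 2)]) @ s 7))"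
    by (rule reaches_emit_nand[where v = a and w = a and M = M]) (use assms in auto)
  finally show ?thesis unfolding if_not_P[OF False] by (rule reaches_mono) simp
qed

text \<open>A gate refers to earlier wires, in unary, hence a quadratic bound. It pays for the final
  reversal of the collected gates.\<close>

lemma length_enc_gates_le: "gates_ok k gs \<Longrightarrow> length (enc_gates gs) \<le> length gs * (2 * (k + length gs) + 1)"
proof (induction gs arbitrary: k)
  case (Cons g gs)
  have "length (enc_gate g) \<le> 2 * k + 1" using Cons.prems by (cases g) (auto simp: enc_nat_def)
  moreover have "length (enc_gates gs) \<le> length gs * (2 * (Suc k + length gs) + 1)"
    by (rule Cons.IH) (use Cons.prems in simp)
  ultimately show ?case by (simp add: algebra_simps)
qed simp

lemma ppt_patch:
  "ppt {(C, x, b). \<exists>n. C \<in> circuits n 1 \<and> x \<in> bits n} (\<lambda>(C, x, b). [encode C, x, [b]])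
    (\<lambda>(C, x, b). return_pmf (encode (patch C x b)))"
proof -
  \<comment> \<open>The code is completed from the back: moving register 7 puts the gates in order;
    the output wire, the number 1 of outputs and the arity then go in front, for each of them its
    final False first.\<close>
  let ?p5 = "[move 7 0, Push 0 False, move 9 0, Push 0 False, Push 0 True, Push 0 False, move 3 0]"
  let ?p4 = "select_prog @ [Push 9 True, Push 9 True, Push 9 True] @ ?p5"
  let ?p3 = "copy 6 10 9 @ Push 9 True # Loop 1 cmp_prog # ?p4"
  let ?p2 = "copy 3 10 6 @ copy 0 10 5 @ Loop 5 count_prog # move 0 7 # Push 7 False # emit_nand 6 0 6 0 @ ?p3"
  let ?p1 = "read_nat 0 11 (Push 3 True) @ read_nat 0 11 (Pop 12) @ read_nat 0 11 (Push 4 True) @ ?p2"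
  \<comment> \<open>To be taken at \<open>4 * L + 5\<close>, which bounds the largest wire index
    \<open>a + 3 = length gs + 4 * n + 4\<close>. The running time is quadratic in this bound, and
    1000 leaves room for the sum of all phases.\<close>
  define T where "T = (\<lambda>M. 1000 * M * M + 1000 * M + 1000 :: nat)"
  have "ppt {(C, x, b). \<exists>n. C \<in> circuits n 1 \<and> x \<in> bits n} (\<lambda>(C, x, b). [encode C, x, [b]])
      (\<lambda>i. return_pmf (case i of (C, x, b) \<Rightarrow> encode (patch C x b)))"
  proof (rule pptI_det)
    show "poly_bounded (\<lambda>L. T (4 * L + 5))" unfolding T_def
      by (intro poly_bounded_add poly_bounded_mult poly_bounded_id poly_bounded_const)
    fix i :: "circuit \<times> bool list \<times> bool" assume "i \<in> {(C, x, b). \<exists>n. C \<in> circuits n 1 \<and> x \<in> bits n}"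
    then obtain C x b n where i: "i = (C, x, b)" and "C \<in> circuits n 1" and lx: "length x = n"
      by (auto simp: bits_def)
    then obtain gs j where C: "C = Circuit n gs [j]" "gates_ok n gs" "j < n + length gs"
      using circuits_1E by metis
    define s where "s = load [encode C, x, [b]]"
    define M where "M = 4 * args_size [encode C, x, [b]] + 5"
    define N where "N = n + length gs"
    define a where "a = N + 1 + 3 * n"
    have enc: "encode C = enc_nat n @ enc_nat 1 @ enc_nat j @ enc_gates gs"
      unfolding C(1) by (rule encode_1)
    have lM: "N \<le> M" "a + 3 \<le> M" "j \<le> M" "1 \<le> M" "n \<le> M" "length (enc_gates gs) \<le> M" "length gs \<le> M" "N + 1 \<le> M"
      using length_enc_gates[of gs] by (auto simp: M_def enc enc_nat_def N_def a_def lx)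
    have s: "s 0 = encode C" "s (Suc 0) = x" "s 2 = [b]" "\<And>r. 3 \<le> r \<Longrightarrow> s r = []"
      by (auto simp: s_def load_def)
    let ?n = "unary n" and ?j = "unary j" and ?N = "unary N"
    define G1 where "G1 = gs @ [Zero, Nand N N]"
    define G2 where "G2 = G1 @ cmp_gates 0 (N + 1) x"
    define G3 where "G3 = G2 @ (if b then [Nand j j, Nand a a, Nand (a + 1) (a + 2)]
      else [Nand a a, Nand j (a + 1), Nand (a + 2) (a + 2)])"
    have "reaches (4 * M + 6) (?p1, s) (read_nat 0 11 (Pop 12) @ read_nat 0 11 (Push 4 True) @ ?p2,
        s(0 := enc_nat 1 @ enc_nat j @ enc_gates gs, 3 := unary n))"
      by (rule reaches_read_push[where i = n and u = "enc_nat 1 @ enc_nat j @ enc_gates gs" and M = M])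
        (use lM in \<open>auto simp: s enc\<close>)
    also have "reaches (4 * M + 6) \<dots> (read_nat 0 11 (Push 4 True) @ ?p2, s(0 := enc_nat j @ enc_gates gs, 3 := unary n))"
      by (rule reaches_read_pop[where i = 1 and u = "enc_nat j @ enc_gates gs" and M = M])
        (use lM in \<open>auto simp: s fun_eq_iff\<close>)
    also have "reaches (4 * M + 6) \<dots> (?p2, s(0 := enc_gates gs, 3 := ?n, 4 := ?j))"
      by (rule reaches_read_push[where i = j and u = "enc_gates gs" and M = M])
        (use lM in \<open>auto simp: s fun_eq_iff\<close>)
    also have "reaches (9 * M + 2) \<dots> (copy 0 10 5 @ Loop 5 count_prog # move 0 7 # Push 7 False # emit_nand 6 0 6 0 @ ?p3,
        s(0 := enc_gates gs, 3 := ?n, 4 := ?j, 6 := unary n))"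
      by (rule reaches_copyI[where L = M]) (use lM in \<open>auto simp: s fun_eq_iff\<close>)
    also have "reaches (9 * M + 2) \<dots> (Loop 5 count_prog # move 0 7 # Push 7 False # emit_nand 6 0 6 0 @ ?p3,
        s(0 := enc_gates gs, 3 := ?n, 4 := ?j, 6 := unary n, 5 := enc_gates gs))"
      by (rule reaches_copyI[where L = M]) (use lM in \<open>auto simp: s fun_eq_iff\<close>)
    also have "reaches (M * (8 * M + 16) + 1) \<dots> (move 0 7 # Push 7 False # emit_nand 6 0 6 0 @ ?p3,
        s(0 := enc_gates gs, 3 := ?n, 4 := ?j, 6 := ?N))"
    proof -
      let ?s = "s(0 := enc_gates gs, 3 := ?n, 4 := ?j, 6 := unary n, 5 := enc_gates gs)"
      let ?K = "move 0 7 # Push 7 False # emit_nand 6 0 6 0 @ ?p3"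
      have eq: "?s(5 := [], 6 := unary (length gs) @ ?s 6) = s(0 := enc_gates gs, 3 := ?n, 4 := ?j, 6 := ?N)"
        by (auto simp: fun_eq_iff s N_def unary_append add.commute)
      have "reaches (length gs * (8 * M + 16) + 1) (Loop 5 count_prog # ?K, ?s)
          (?K, ?s(5 := [], 6 := unary (length gs) @ ?s 6))"
        by (rule reaches_count) (use lM in \<open>auto simp: s\<close>)
      then show ?thesis unfolding eq
        by (rule reaches_mono) (use lM in \<open>auto intro!: mult_mono\<close>)
    qed
    also have "reaches (4 * M + 1) \<dots> (Push 7 False # emit_nand 6 0 6 0 @ ?p3,
        s(0 := [], 3 := ?n, 4 := ?j, 6 := ?N, 7 := rev (enc_gates gs)))"
      by (rule reaches_moveI[where L = M]) (use lM in \<open>auto simp: s fun_eq_iff\<close>)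
    also have "reaches 1 \<dots> (emit_nand 6 0 6 0 @ ?p3,
        s(0 := [], 3 := ?n, 4 := ?j, 6 := ?N, 7 := False # rev (enc_gates gs)))"
      by (simp add: reaches_instr)
    also have "reaches (18 * M + 13) \<dots> (?p3,
        s(0 := [], 3 := ?n, 4 := ?j, 6 := ?N, 7 := rev (enc_gates G1)))"
      by (rule reaches_emit_nand[where v = N and w = N and M = M]) (use lM in \<open>auto simp: s G1_def\<close>)
    also have "reaches (9 * M + 2) \<dots> (Push 9 True # Loop 1 cmp_prog # ?p4,
        s(0 := [], 3 := ?n, 4 := ?j, 6 := ?N, 7 := rev (enc_gates G1), 9 := unary N))"
      by (rule reaches_copyI[where L = M]) (use lM in \<open>auto simp: s fun_eq_iff\<close>)
    also have "reaches 1 \<dots> (Loop 1 cmp_prog # ?p4,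
        s(0 := [], 3 := ?n, 4 := ?j, 6 := ?N, 7 := rev (enc_gates G1), 9 := unary (N + 1)))"
      by (simp add: reaches_instr unary_Suc)
    also have "reaches (M * (60 * M + 61) + 1) \<dots> (?p4,
        s(0 := [], 1 := [], 3 := ?n, 4 := ?j, 6 := ?N, 7 := rev (enc_gates G2), 8 := ?n, 9 := unary a))"
    proof -
      let ?s = "s(0 := [], 3 := ?n, 4 := ?j, 6 := ?N, 7 := rev (enc_gates G1), 9 := unary (N + 1))"
      have eq: "?s(1 := [], 8 := unary (0 + length x), 9 := unary (N + 1 + 3 * length x),
          7 := rev (enc_gates (cmp_gates 0 (N + 1) x)) @ ?s 7)
        = s(0 := [], 1 := [], 3 := ?n, 4 := ?j, 6 := ?N, 7 := rev (enc_gates G2), 8 := ?n, 9 := unary a)"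
        by (auto simp: fun_eq_iff lx a_def G2_def)
      have "reaches (length x * (60 * M + 61) + 1) (Loop 1 cmp_prog # ?p4, ?s)
          (?p4, ?s(1 := [], 8 := unary (0 + length x), 9 := unary (N + 1 + 3 * length x),
            7 := rev (enc_gates (cmp_gates 0 (N + 1) x)) @ ?s 7))"
        by (rule reaches_cmp) (use lM in \<open>auto simp: s lx a_def unary_def\<close>)
      then show ?thesis unfolding eq
        by (rule reaches_mono) (use lM lx in \<open>auto intro!: mult_mono\<close>)
    qed
    also have "reaches (54 * M + 40) \<dots> ([Push 9 True, Push 9 True, Push 9 True] @ ?p5,
        s(0 := [], 1 := [], 3 := ?n, 4 := ?j, 6 := ?N, 7 := rev (enc_gates G3), 8 := ?n, 9 := unary a))"
    proof -
      let ?s = "s(0 := [], 1 := [], 3 := ?n, 4 := ?j, 6 := ?N, 7 := rev (enc_gates G2), 8 := ?n, 9 := unary a)"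
      let ?gs = "if b then [Nand j j, Nand a a, Nand (a + 1) (a + 2)]
        else [Nand a a, Nand j (a + 1), Nand (a + 2) (a + 2)]"
      have eq: "?s(7 := rev (enc_gates ?gs) @ ?s 7) =
          s(0 := [], 1 := [], 3 := ?n, 4 := ?j, 6 := ?N, 7 := rev (enc_gates G3), 8 := ?n, 9 := unary a)"
        unfolding G3_def map_append concat_append rev_append by (auto simp: fun_eq_iff)
      have "reaches (54 * M + 40) (?p4, ?s) ([Push 9 True, Push 9 True, Push 9 True] @ ?p5,
          ?s(7 := rev (enc_gates ?gs) @ ?s 7))"
        by (rule reaches_select) (use lM in \<open>auto simp: s\<close>)
      then show ?thesis unfolding eq .
    qed
    also have "reaches 3 \<dots> (?p5,
        s(0 := [], 1 := [], 3 := ?n, 4 := ?j, 6 := ?N, 7 := rev (enc_gates G3), 8 := ?n, 9 := unary (a + 3)))"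
      by (simp add: reaches_instr unary_Suc numeral_eq_Suc)
    also have "reaches (4 * length (enc_gates G3) + 1) \<dots> ([Push 0 False, move 9 0, Push 0 False, Push 0 True, Push 0 False, move 3 0],
        s(1 := [], 3 := ?n, 4 := ?j, 6 := ?N, 7 := [], 8 := ?n, 9 := unary (a + 3), 0 := enc_gates G3))"
      by (rule reaches_moveI[where L = "length (enc_gates G3)"]) (auto simp: s fun_eq_iff)
    also have "reaches 1 \<dots> ([move 9 0, Push 0 False, Push 0 True, Push 0 False, move 3 0],
        s(1 := [], 3 := ?n, 4 := ?j, 6 := ?N, 7 := [], 8 := ?n, 9 := unary (a + 3), 0 := False # enc_gates G3))"
      by (simp add: reaches_instr)
    also have "reaches (4 * M + 1) \<dots> ([Push 0 False, Push 0 True, Push 0 False, move 3 0],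
        s(1 := [], 3 := ?n, 4 := ?j, 6 := ?N, 7 := [], 8 := ?n, 9 := [], 0 := enc_nat (a + 3) @ enc_gates G3))"
      by (rule reaches_moveI[where L = M]) (use lM in \<open>auto simp: s fun_eq_iff enc_nat_unary\<close>)
    also have "reaches 3 \<dots> ([move 3 0],
        s(1 := [], 3 := ?n, 4 := ?j, 6 := ?N, 7 := [], 8 := ?n, 9 := [],
          0 := False # enc_nat 1 @ enc_nat (a + 3) @ enc_gates G3))"
      by (simp add: reaches_instr enc_nat_def unary_def)
    also have "reaches (4 * M + 1) \<dots> ([],
        s(1 := [], 3 := [], 4 := ?j, 6 := ?N, 7 := [], 8 := ?n, 9 := [],
          0 := enc_nat n @ enc_nat 1 @ enc_nat (a + 3) @ enc_gates G3))"
      by (rule reaches_moveI[where L = M]) (use lM in \<open>auto simp: s fun_eq_iff enc_nat_unary\<close>)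
    also note r = calculation
    have P: "patch C x b = Circuit n G3 [a + 3]"
      by (simp add: patch_def patch_gates_def Let_def C(1) lx G3_def G2_def G1_def N_def a_def add.assoc)
    have lG3: "length (enc_gates G3) \<le> (M + 1) * (2 * (M + 1) + 1)"
    proof -
      have "x \<in> bits n" using lx by (simp add: bits_def)
      from patch_in_circuits[OF \<open>C \<in> circuits n 1\<close> this, of b]
      have "gates_ok n G3" by (simp add: circuits_iff P)
      then have "length (enc_gates G3) \<le> length G3 * (2 * (n + length G3) + 1)"
        by (rule length_enc_gates_le)
      also have "n + length G3 = a + 4" by (simp add: G3_def G2_def G1_def lx a_def N_def)
      also have "length G3 * (2 * (a + 4) + 1) \<le> (M + 1) * (2 * (M + 1) + 1)"
        by (intro mult_mono) (use lM \<open>n + length G3 = a + 4\<close> in auto)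
      finally show ?thesis .
    qed
    show "\<exists>s. reaches (T (4 * args_size (case i of (C, x, b) \<Rightarrow> [encode C, x, [b]]) + 5))
        (?p1, load (case i of (C, x, b) \<Rightarrow> [encode C, x, [b]])) ([], s) \<and> s 0 = (case i of (C, x, b) \<Rightarrow> encode (patch C x b))"
      unfolding i prod.case
    proof (rule exI, rule conjI, rule reaches_mono[OF r[unfolded s_def]])
      show "4 * M + 6 + (4 * M + 6) + (4 * M + 6) + (9 * M + 2) + (9 * M + 2) + (M * (8 * M + 16) + 1) + (4 * M + 1)
        + 1 + (18 * M + 13) + (9 * M + 2) + 1 + (M * (60 * M + 61) + 1) + (54 * M + 40) + 3
        + (4 * length (enc_gates G3) + 1) + 1 + (4 * M + 1) + 3 + (4 * M + 1)
        \<le> T (4 * args_size [encode C, x, [b]] + 5)"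
        using lG3 unfolding T_def M_def[symmetric] by (simp add: algebra_simps)
    qed (simp add: P encode_1 del: One_nat_def)
  qed
  then show ?thesis by (simp add: case_prod_unfold)
qed

section \<open>Obfuscating padded circuits\<close>

text \<open>A call as the last step: the result of the subroutine is the output.\<close>

lemma ppt_select:
  assumes "ppt J sub_args g"
    and "\<And>i. i \<in> I \<Longrightarrow> h i \<in> J \<and> sub_args (h i) = map ((!) (args i)) sel"
    and "\<And>i. i \<in> I \<Longrightarrow> length (args i) = m" "\<And>j. j \<in> set sel \<Longrightarrow> j < m"
  shows "ppt I args (\<lambda>i. g (h i))"
proof -
  let ?I = "{(i, w). i \<in> I \<and> w \<in> set_pmf (g (h i))}"
  have "ppt ?I (\<lambda>(i, w). args i @ [w]) (\<lambda>z. return_pmf ((\<lambda>(i, w). args i @ [w]) z ! m))"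
    by (rule ppt_arg[where m = "Suc m"]) (use assms(3) in auto)
  then have "ppt ?I (\<lambda>(i, w). args i @ [w]) (\<lambda>(i, w). return_pmf w)"
    by (rule ppt_reindex[where \<phi> = "\<lambda>z. z"]) (use assms(3) in \<open>auto simp: nth_append\<close>)
  from ppt_call[OF assms(1) this assms(2-4)] show ?thesis by (simp add: bind_return_pmf')
qed

lemma ppt_pad_power:
  "ppt UNIV (\<lambda>(\<kappa>, w). [unary \<kappa>, w]) (\<lambda>(\<kappa>, w). return_pmf (pad_string ((\<kappa> + 2) ^ e) w))"
proof -
  have "ppt UNIV (\<lambda>i. (case i of (\<kappa>, w) \<Rightarrow> [unary \<kappa>, w]) @ [unary ((fst i + 2) ^ e)])
    (\<lambda>i. (\<lambda>(w, T). return_pmf (pad_string T w)) (snd i, (fst i + 2) ^ e))"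
    by (rule ppt_select[OF ppt_pad_string, where sel = "[1, 2]" and m = 3]) auto
  then have "ppt UNIV (\<lambda>(\<kappa>, w). [unary \<kappa>, w]) (\<lambda>i. (\<lambda>(w, T). return_pmf (pad_string T w)) (snd i, (fst i + 2) ^ e))"
    by (rule ppt_call_det[OF ppt_unary_power, where h = fst and sel = "[0]" and m = 2]) auto
  then show ?thesis by (simp add: case_prod_unfold)
qed

text \<open>The inner padding meets the demand of the obfuscator for circuits of equal size, the
  outer one the demand of a keyed class for a common size of its members.\<close>

definition obf_pad :: "nat \<Rightarrow> nat \<Rightarrow> (nat \<Rightarrow> circuit \<Rightarrow> circuit pmf) \<Rightarrow> nat \<Rightarrow> circuit \<Rightarrow> circuit pmf" where
  "obf_pad d e obf \<kappa> C = map_pmf (pad_circuit ((\<kappa> + 2) ^ e)) (obf \<kappa> (pad_circuit ((\<kappa> + 2) ^ d) C))"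

lemma ppt_obf_pad:
  assumes "post_quantum_iO obf"
  shows "ppt {(\<kappa>, C). \<exists>n m. C \<in> circuits n m} (\<lambda>(\<kappa>, C). [unary \<kappa>, encode C])
    (\<lambda>(\<kappa>, C). map_pmf encode (obf_pad d e obf \<kappa> C))"
proof -
  let ?I = "{(\<kappa> :: nat, C). \<exists>n m. C \<in> circuits n m}"
  let ?g = "\<lambda>(\<kappa>, C). map_pmf encode (obf \<kappa> C)"
  let ?p = "\<lambda>i :: nat \<times> circuit. pad_circuit ((fst i + 2) ^ d) (snd i)"
  \<comment> \<open>Positions 0 and 1 hold the inputs and 2 the padded circuit; its obfuscation
    becomes position 3.\<close>
  let ?args = "\<lambda>i. (case i of (\<kappa>, C) \<Rightarrow> [unary \<kappa>, encode C]) @ [encode (?p i)]"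
  have obf: "ppt ?I (\<lambda>(\<kappa>, C). [unary \<kappa>, encode C]) ?g"
    using assms by (simp add: post_quantum_iO_def)
  have "ppt {(i, w). i \<in> ?I \<and> w \<in> set_pmf (?g (fst i, ?p i))} (\<lambda>(i, w). ?args i @ [w])
      (\<lambda>z. (\<lambda>(\<kappa>, w). return_pmf (pad_string ((\<kappa> + 2) ^ e) w)) (fst (fst z), snd z))"
    by (rule ppt_select[OF ppt_pad_power, where sel = "[0, 3]" and m = 4]) auto
  then have rest: "ppt {(i, w). i \<in> ?I \<and> w \<in> set_pmf (?g (fst i, ?p i))} (\<lambda>(i, w). ?args i @ [w])
      (\<lambda>(i, w). return_pmf (pad_string ((fst i + 2) ^ e) w))"
    by (simp add: case_prod_unfold)
  have "ppt ?I ?args (\<lambda>i. bind_pmf (?g (fst i, ?p i)) (\<lambda>w. return_pmf (pad_string ((fst i + 2) ^ e) w)))"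
    by (rule ppt_call[where h = "\<lambda>i. (fst i, ?p i)" and rest = "\<lambda>i w. return_pmf (pad_string ((fst i + 2) ^ e) w)"
        and sel = "[0, 2]" and m = 3, OF obf rest])
      (use pad_circuit_in_circuits in \<open>auto, blast\<close>)
  then have "ppt ?I (\<lambda>i. (case i of (\<kappa>, C) \<Rightarrow> [unary \<kappa>, encode C]) @ [(\<lambda>(\<kappa>, w). pad_string ((\<kappa> + 2) ^ d) w) (fst i, encode (snd i))])
      (\<lambda>(\<kappa>, C). map_pmf encode (obf_pad d e obf \<kappa> C))"
    by (rule ppt_reindex[where \<phi> = "\<lambda>i. i"])
      (auto simp: obf_pad_def encode_pad_circuit pmf.map_comp o_def bind_map_pmf map_pmf_def[symmetric])
  then show ?thesis
    by (rule ppt_call_det[where J = UNIV and h = "\<lambda>i. (fst i, encode (snd i))" and sel = "[0, 1]" and m = 2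
        and g = "\<lambda>(\<kappa>, w). pad_string ((\<kappa> + 2) ^ d) w" and sub_args = "\<lambda>(\<kappa>, w). [unary \<kappa>, w]", rotated])
      (use ppt_pad_power[of d] in \<open>auto simp: case_prod_unfold\<close>)
qed

lemma ppt_sample_obf_pad:
  assumes iO: "post_quantum_iO obf" and D: "efficiently_samplable_on K D" and C: "keyed_circuit_class n m K C"
  shows "ppt UNIV (\<lambda>\<kappa>. [unary \<kappa>]) (\<lambda>\<kappa>. bind_pmf (D \<kappa>) (\<lambda>k. map_pmf encode (obf_pad d e obf \<kappa> (C \<kappa> k))))"
proof -
  let ?I = "{(\<kappa>, k). \<kappa> \<in> UNIV \<and> k \<in> set_pmf (D \<kappa>)}"
  have sub: "set_pmf (D \<kappa>) \<subseteq> K \<kappa>" for \<kappa> using D by (simp add: efficiently_samplable_on_def)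
  have ins: "C \<kappa> k \<in> circuits (n \<kappa>) (m \<kappa>)" if "k \<in> set_pmf (D \<kappa>)" for \<kappa> k
    using C sub that unfolding keyed_circuit_class_def by blast
  have "ppt ?I (\<lambda>i. (case i of (\<kappa>, k) \<Rightarrow> [unary \<kappa>] @ [k]) @ [(\<lambda>(\<kappa>, k). encode (C \<kappa> k)) i])
    (\<lambda>i. (\<lambda>(\<kappa>, C). map_pmf encode (obf_pad d e obf \<kappa> C)) (fst i, C (fst i) (snd i)))"
    by (rule ppt_select[OF ppt_obf_pad[OF iO], where sel = "[0, 2]" and m = 3]) (use ins in \<open>auto, blast\<close>)
  then have "ppt ?I (\<lambda>(\<kappa>, k). [unary \<kappa>] @ [k])
    (\<lambda>i. (\<lambda>(\<kappa>, C). map_pmf encode (obf_pad d e obf \<kappa> C)) (fst i, C (fst i) (snd i)))"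
    by (rule ppt_call_det[where J = "{(\<kappa>, k). k \<in> K \<kappa>}" and h = "\<lambda>i. i" and sel = "[0, 1]" and m = 2
        and g = "\<lambda>(\<kappa>, k). encode (C \<kappa> k)" and sub_args = "\<lambda>(\<kappa>, k). [unary \<kappa>, k]", rotated])
      (use C sub in \<open>auto simp: case_prod_unfold keyed_circuit_class_def\<close>)
  then have "ppt ?I (\<lambda>(\<kappa>, k). [unary \<kappa>] @ [k]) (\<lambda>(\<kappa>, k). map_pmf encode (obf_pad d e obf \<kappa> (C \<kappa> k)))"
    by (simp add: case_prod_unfold)
  then show ?thesis
    by (rule ppt_call[where J = UNIV and h = "\<lambda>\<kappa>. \<kappa>" and sel = "[0]" and m = 1 and sub_args = "\<lambda>\<kappa>. [unary \<kappa>]", rotated])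
      (use D in \<open>auto simp: efficiently_samplable_on_def\<close>)
qed

section \<open>Generalized puncturing\<close>

definition puncture :: "circuit \<Rightarrow> bool list \<Rightarrow> bool list \<Rightarrow> circuit \<Rightarrow> circuit \<Rightarrow> circuit" where
  "puncture C x1 x2 \<mu>1 \<mu>2 = patch (patch C x2 (hd (eval_circuit \<mu>2 x2))) x1 (hd (eval_circuit \<mu>1 x1))"

lemma eval_circuit_1: "C \<in> circuits n 1 \<Longrightarrow> [hd (eval_circuit C x)] = eval_circuit C x"
  by (erule circuits_1E) (simp add: eval_circuit_wires)

lemma puncture_in_circuits:
  "C \<in> circuits n 1 \<Longrightarrow> x1 \<in> bits n \<Longrightarrow> x2 \<in> bits n \<Longrightarrow> puncture C x1 x2 \<mu>1 \<mu>2 \<in> circuits n 1"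
  by (simp add: puncture_def patch_in_circuits del: One_nat_def)

text \<open>The point \<open>x1\<close> is patched last and hence prevails if both points coincide,
  as generalized puncturing demands. Only the values of the two circuits at the points are
  hardwired, so the patch does not grow with these circuits.\<close>

lemma eval_puncture:
  assumes "C \<in> circuits n 1" "x1 \<in> bits n" "x2 \<in> bits n" "\<mu>1 \<in> circuits n 1" "\<mu>2 \<in> circuits n 1" "x \<in> bits n"
  shows "eval_circuit (puncture C x1 x2 \<mu>1 \<mu>2) x =
    (if x = x1 then eval_circuit \<mu>1 x1 else if x = x2 then eval_circuit \<mu>2 x2 else eval_circuit C x)"
  using assms(1-3,6) eval_circuit_1[OF assms(4)] eval_circuit_1[OF assms(5)]
  by (simp add: puncture_def eval_patch[where n = n] patch_in_circuits del: One_nat_def)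

lemma ppt_puncture:
  assumes C: "keyed_circuit_class n (\<lambda>_. 1) K C"
  shows "ppt {(\<kappa>, k, x1, x2, \<mu>1, \<mu>2). k \<in> K \<kappa> \<and> x1 \<in> bits (n \<kappa>) \<and> x2 \<in> bits (n \<kappa>)
            \<and> \<mu>1 \<in> circuits (n \<kappa>) 1 \<and> \<mu>2 \<in> circuits (n \<kappa>) 1}
         (\<lambda>(\<kappa>, k, x1, x2, \<mu>1, \<mu>2). [unary \<kappa>, k, x1, x2, encode \<mu>1, encode \<mu>2])
         (\<lambda>(\<kappa>, k, x1, x2, \<mu>1, \<mu>2). return_pmf (encode (puncture (C \<kappa> k) x1 x2 \<mu>1 \<mu>2)))"
    (is "ppt ?I ?args ?f")
proof -
  have ins: "C \<kappa> k \<in> circuits (n \<kappa>) 1" if "k \<in> K \<kappa>" for \<kappa> k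
    using C that unfolding keyed_circuit_class_def by blast
  \<comment> \<open>Positions in the growing argument list: 6 is the circuit \<open>c0\<close>, 7
    and 8 are the values \<open>b1\<close> and \<open>b2\<close>, and 9 is \<open>c1\<close>,
    already patched at \<open>x2\<close>. The calls are put together from the last one
    backwards.\<close>
  define c0 where "c0 = (\<lambda>(\<kappa>, k, x1 :: bool list, x2 :: bool list, \<mu>1 :: circuit, \<mu>2 :: circuit). encode (C \<kappa> k))"
  define b1 where "b1 = (\<lambda>(\<kappa> :: nat, k :: bool list, x1 :: bool list, x2 :: bool list, \<mu>1 :: circuit, \<mu>2 :: circuit). eval_circuit \<mu>1 x1)"
  define b2 where "b2 = (\<lambda>(\<kappa> :: nat, k :: bool list, x1 :: bool list, x2, \<mu>1 :: circuit, \<mu>2). eval_circuit \<mu>2 x2)"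
  define c1 where "c1 = (\<lambda>(\<kappa>, k, x1 :: bool list, x2, \<mu>1 :: circuit, \<mu>2). encode (patch (C \<kappa> k) x2 (hd (eval_circuit \<mu>2 x2))))"
  have ppt_patch': "ppt {(C, x, b). \<exists>n. C \<in> circuits n 1 \<and> x \<in> bits n} (\<lambda>(C, x, b). [encode C, x, [b]])
    (\<lambda>i. return_pmf (case i of (C, x, b) \<Rightarrow> encode (patch C x b)))"
    using ppt_patch by (simp add: case_prod_unfold)
  have ppt_eval': "ppt {(C, x). \<exists>n. C \<in> circuits n 1 \<and> x \<in> bits n} (\<lambda>(C, x). [encode C, x])
    (\<lambda>i. return_pmf (case i of (C, x) \<Rightarrow> eval_circuit C x))"
    using ppt_eval_circuit by (simp add: case_prod_unfold)
  have C': "ppt {(\<kappa>, k). k \<in> K \<kappa>} (\<lambda>(\<kappa>, k). [unary \<kappa>, k]) (\<lambda>i. return_pmf (case i of (\<kappa>, k) \<Rightarrow> encode (C \<kappa> k)))"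
    using C by (simp add: keyed_circuit_class_def case_prod_unfold)
  have "ppt ?I (\<lambda>i. (((?args i @ [c0 i]) @ [b1 i]) @ [b2 i]) @ [c1 i])
    (\<lambda>i. (\<lambda>i. return_pmf (case i of (C, x, b) \<Rightarrow> encode (patch C x b)))
      (case i of (\<kappa>, k, x1, x2, \<mu>1, \<mu>2) \<Rightarrow> (patch (C \<kappa> k) x2 (hd (eval_circuit \<mu>2 x2)), x1, hd (eval_circuit \<mu>1 x1))))"
    by (rule ppt_select[OF ppt_patch', where sel = "[9, 2, 7]" and m = 10])
      (auto simp: c0_def b1_def b2_def c1_def nth_append eval_circuit_1 simp del: One_nat_def intro!: patch_in_circuits ins)
  then have s4: "ppt ?I (\<lambda>i. (((?args i @ [c0 i]) @ [b1 i]) @ [b2 i]) @ [c1 i]) ?f"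
    by (rule ppt_reindex[where \<phi> = "\<lambda>i. i"]) (auto simp: puncture_def)
  have s3: "ppt ?I (\<lambda>i. ((?args i @ [c0 i]) @ [b1 i]) @ [b2 i]) ?f"
    by (rule ppt_call_det[OF ppt_patch', where sel = "[6, 3, 8]" and m = 9
        and h = "\<lambda>(\<kappa>, k, x1, x2, \<mu>1, \<mu>2). (C \<kappa> k, x2, hd (eval_circuit \<mu>2 x2))"],
        rule ppt_reindex[OF s4, where \<phi> = "\<lambda>i. i"])
      (auto simp: c0_def b1_def b2_def c1_def eval_circuit_1 simp del: One_nat_def intro!: ins)
  have s2: "ppt ?I (\<lambda>i. (?args i @ [c0 i]) @ [b1 i]) ?f"
    by (rule ppt_call_det[OF ppt_eval', where sel = "[5, 3]" and m = 8
        and h = "\<lambda>(\<kappa>, k, x1, x2, \<mu>1, \<mu>2). (\<mu>2, x2)"], rule ppt_reindex[OF s3, where \<phi> = "\<lambda>i. i"])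
      (auto simp: c0_def b1_def b2_def simp del: One_nat_def)
  have s1: "ppt ?I (\<lambda>i. ?args i @ [c0 i]) ?f"
    by (rule ppt_call_det[OF ppt_eval', where sel = "[4, 2]" and m = 7
        and h = "\<lambda>(\<kappa>, k, x1, x2, \<mu>1, \<mu>2). (\<mu>1, x1)"], rule ppt_reindex[OF s2, where \<phi> = "\<lambda>i. i"])
      (auto simp: c0_def b1_def simp del: One_nat_def)
  show "ppt ?I ?args ?f"
    by (rule ppt_call_det[OF C', where sel = "[0, 1]" and m = 6
        and h = "\<lambda>(\<kappa>, k, x1, x2, \<mu>1, \<mu>2). (\<kappa>, k)"], rule ppt_reindex[OF s1, where \<phi> = "\<lambda>i. i"])
      (auto simp: c0_def simp del: One_nat_def)
qed

lemma obf_pad_functional: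
  assumes "post_quantum_iO obf" "C \<in> circuits n m" "G \<in> set_pmf (obf_pad d e obf \<kappa> C)"
  shows "G \<in> circuits n m" "\<And>x. x \<in> bits n \<Longrightarrow> eval_circuit G x = eval_circuit C x"
proof -
  let ?C = "pad_circuit ((\<kappa> + 2) ^ d) C"
  obtain C' where C': "C' \<in> set_pmf (obf \<kappa> ?C)" "G = pad_circuit ((\<kappa> + 2) ^ e) C'"
    using assms(3) by (auto simp: obf_pad_def)
  have "?C \<in> circuits n m" by (rule pad_circuit_in_circuits[OF assms(2)])
  then have *: "C' \<in> circuits n m" "\<And>x. x \<in> bits n \<Longrightarrow> eval_circuit C' x = eval_circuit ?C x"
    using assms(1) C'(1) unfolding post_quantum_iO_def by blast+
  show "G \<in> circuits n m" unfolding C'(2) by (rule pad_circuit_in_circuits[OF *(1)])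
  show "eval_circuit G x = eval_circuit C x" if "x \<in> bits n" for x
    using that * assms(2) by (simp add: C'(2) eval_pad_circuit[where n = n and m = m])
qed

lemma gen_puncturing_obf_pad:
  assumes iO: "post_quantum_iO obf" and C: "keyed_circuit_class n (\<lambda>_. 1) K C"
  shows "gen_puncturing n (\<lambda>_. 1) K C (\<lambda>\<kappa> k x1 x2 \<mu>1 \<mu>2. obf_pad d e obf \<kappa> (puncture (C \<kappa> k) x1 x2 \<mu>1 \<mu>2))"
    (is "gen_puncturing _ _ _ _ ?P")
proof -
  let ?I = "{(\<kappa>, k, x1, x2, \<mu>1, \<mu>2). k \<in> K \<kappa> \<and> x1 \<in> bits (n \<kappa>) \<and> x2 \<in> bits (n \<kappa>)
            \<and> \<mu>1 \<in> circuits (n \<kappa>) 1 \<and> \<mu>2 \<in> circuits (n \<kappa>) 1}"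
  let ?args = "\<lambda>(\<kappa>, k, x1, x2, \<mu>1, \<mu>2). [unary \<kappa>, k, x1, x2, encode \<mu>1, encode \<mu>2]"
  let ?p = "\<lambda>(\<kappa>, k, x1, x2, \<mu>1, \<mu>2). encode (puncture (C \<kappa> k) x1 x2 \<mu>1 \<mu>2)"
  have ins: "C \<kappa> k \<in> circuits (n \<kappa>) 1" if "k \<in> K \<kappa>" for \<kappa> k
    using C that unfolding keyed_circuit_class_def by blast
  have p: "ppt ?I ?args (\<lambda>i. return_pmf (?p i))"
    using ppt_puncture[OF C] by (simp add: case_prod_unfold)
  have s1: "ppt ?I (\<lambda>i. ?args i @ [?p i]) (\<lambda>i. (\<lambda>(\<kappa>, C). map_pmf encode (obf_pad d e obf \<kappa> C))
      (case i of (\<kappa>, k, x1, x2, \<mu>1, \<mu>2) \<Rightarrow> (\<kappa>, puncture (C \<kappa> k) x1 x2 \<mu>1 \<mu>2)))"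
  proof (rule ppt_select[OF ppt_obf_pad[OF iO], where sel = "[0, 6]" and m = 7])
    fix i assume "i \<in> ?I"
    then show "(case i of (\<kappa>, k, x1, x2, \<mu>1, \<mu>2) \<Rightarrow> (\<kappa>, puncture (C \<kappa> k) x1 x2 \<mu>1 \<mu>2))
        \<in> {(\<kappa>, C). \<exists>n m. C \<in> circuits n m} \<and>
      (\<lambda>(\<kappa>, C). [unary \<kappa>, encode C]) (case i of (\<kappa>, k, x1, x2, \<mu>1, \<mu>2) \<Rightarrow> (\<kappa>, puncture (C \<kappa> k) x1 x2 \<mu>1 \<mu>2))
        = map ((!) (?args i @ [?p i])) [0, 6]"
      using puncture_in_circuits[OF ins] by (auto simp del: One_nat_def) blast
  qed auto
  have P: "ppt ?I ?args (\<lambda>(\<kappa>, k, x1, x2, \<mu>1, \<mu>2). map_pmf encode (?P \<kappa> k x1 x2 \<mu>1 \<mu>2))"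
    by (rule ppt_call_det[OF p, where sel = "[0, 1, 2, 3, 4, 5]" and m = 6 and h = "\<lambda>i. i"],
        rule ppt_reindex[OF s1, where \<phi> = "\<lambda>i. i"]) auto
  have Q: "G \<in> circuits (n \<kappa>) 1
        \<and> (\<forall>x \<in> bits (n \<kappa>) - {x1, x2}. eval_circuit G x = eval_circuit (C \<kappa> k) x)
        \<and> eval_circuit G x1 = eval_circuit \<mu>1 x1
        \<and> (x2 \<noteq> x1 \<longrightarrow> eval_circuit G x2 = eval_circuit \<mu>2 x2)"
    if "k \<in> K \<kappa>" "x1 \<in> bits (n \<kappa>)" "x2 \<in> bits (n \<kappa>)" "\<mu>1 \<in> circuits (n \<kappa>) 1" "\<mu>2 \<in> circuits (n \<kappa>) 1"
      "G \<in> set_pmf (?P \<kappa> k x1 x2 \<mu>1 \<mu>2)" for \<kappa> k x1 x2 \<mu>1 \<mu>2 G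
    using obf_pad_functional[OF iO puncture_in_circuits[OF ins[OF that(1)] that(2,3)] that(6)]
      eval_puncture[OF ins[OF that(1)] that(2-5)] that(2,3)
    by (simp del: One_nat_def)
  show ?thesis unfolding gen_puncturing_def by (rule conjI, rule P, intro allI ballI, rule Q)
qed

section \<open>Distinguishing advantages\<close>

abbreviation expect :: "'a pmf \<Rightarrow> ('a \<Rightarrow> real) \<Rightarrow> real" where
  "expect p \<equiv> measure_pmf.expectation p"

lemma negligible_mono:
  assumes "negligible f" "\<And>\<kappa>. \<bar>g \<kappa>\<bar> \<le> \<bar>f \<kappa>\<bar>"
  shows "negligible g"
  unfolding negligible_def
proof
  fix c
  show "\<forall>\<^sub>F \<kappa> in sequentially. \<bar>g \<kappa>\<bar> < 1 / real \<kappa> ^ c"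
    using assms(1)[unfolded negligible_def, rule_format, of c]
    by eventually_elim (use assms(2) le_less_trans in blast)
qed

lemma negligible_add:
  assumes "negligible f" "negligible g"
  shows "negligible (\<lambda>\<kappa>. f \<kappa> + g \<kappa>)"
  unfolding negligible_def
proof
  fix c
  show "\<forall>\<^sub>F \<kappa> in sequentially. \<bar>f \<kappa> + g \<kappa>\<bar> < 1 / real \<kappa> ^ c"
    using assms(1)[unfolded negligible_def, rule_format, of "Suc c"]
      assms(2)[unfolded negligible_def, rule_format, of "Suc c"] eventually_ge_at_top[of 2]
  proof eventually_elim
    case (elim \<kappa>)
    have "2 / real \<kappa> ^ Suc c = 1 / real \<kappa> ^ Suc c + 1 / real \<kappa> ^ Suc c"
      by (simp only: add_divide_distrib[symmetric] one_add_one)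
    then have "\<bar>f \<kappa> + g \<kappa>\<bar> < 2 / real \<kappa> ^ Suc c"
      using elim(1,2) abs_triangle_ineq[of "f \<kappa>" "g \<kappa>"] by linarith
    also have "\<dots> = (2 / real \<kappa>) * (1 / real \<kappa> ^ c)" by simp
    also have "\<dots> \<le> 1 * (1 / real \<kappa> ^ c)" using elim(3) by (intro mult_right_mono) auto
    finally show ?case by simp
  qed
qed

lemma negligible_double: "negligible f \<Longrightarrow> negligible (\<lambda>\<kappa>. 2 * f \<kappa>)"
  using negligible_add[of f f] by (simp only: mult_2)

lemma negligible_abs: "negligible f \<Longrightarrow> negligible (\<lambda>\<kappa>. \<bar>f \<kappa>\<bar>)"
  by (rule negligible_mono) auto

section \<open>Expectations of bounded functions\<close>

lemma integrable_pmf_bounded: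
  fixes h :: "'a \<Rightarrow> real"
  assumes "\<And>x. x \<in> set_pmf p \<Longrightarrow> \<bar>h x\<bar> \<le> b"
  shows "integrable (measure_pmf p) h"
  by (rule measure_pmf.integrable_const_bound[where B = b]) (use assms in \<open>auto simp: AE_measure_pmf_iff\<close>)

lemma abs_expectation_le:
  fixes h :: "'a \<Rightarrow> real"
  assumes "\<And>x. x \<in> set_pmf p \<Longrightarrow> \<bar>h x\<bar> \<le> b"
  shows "\<bar>expect p h\<bar> \<le> b"
proof -
  have i: "integrable (measure_pmf p) h" using integrable_pmf_bounded assms .
  have "\<bar>expect p h\<bar> \<le> expect p (\<lambda>x. \<bar>h x\<bar>)"
    by (rule integral_abs_bound)
  also have "\<dots> \<le> b"
    by (rule measure_pmf.integral_le_const) (use i assms in \<open>auto simp: AE_measure_pmf_iff\<close>)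
  finally show ?thesis .
qed

lemma expectation_unit_interval:
  fixes h :: "'a \<Rightarrow> real"
  assumes "\<And>x. x \<in> set_pmf p \<Longrightarrow> 0 \<le> h x \<and> h x \<le> 1"
  shows "0 \<le> expect p h \<and> expect p h \<le> 1"
proof
  show "0 \<le> expect p h"
    by (rule integral_nonneg_AE) (use assms in \<open>auto simp: AE_measure_pmf_iff\<close>)
  have "\<bar>expect p h\<bar> \<le> 1" by (rule abs_expectation_le) (use assms in force)
  then show "expect p h \<le> 1" by linarith
qed

text \<open>Supplies the worst pair of the reduction. Thanks to the factor 2 a weak inequality
  between integrals suffices: were all values at most half the mean in absolute value, the mean
  would be at most half of itself, hence 0.\<close>

lemma expectation_witness:
  fixes h :: "'a \<Rightarrow> real"
  shows "\<exists>x \<in> set_pmf p. \<bar>expect p h\<bar> \<le> 2 * \<bar>h x\<bar>"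
proof (rule ccontr)
  assume *: "\<not> ?thesis"
  have "\<bar>h x\<bar> \<le> \<bar>expect p h\<bar> / 2" if "x \<in> set_pmf p" for x
    using * that by force
  from abs_expectation_le[of p h, OF this] have "expect p h = 0" by simp
  with * set_pmf_not_empty[of p] show False by auto
qed

lemma nn_integral_unit_interval:
  fixes h :: "'a \<Rightarrow> real"
  assumes "\<And>x. 0 \<le> h x \<and> h x \<le> 1"
  shows "(\<integral>\<^sup>+x. ennreal (h x) \<partial>measure_pmf p) = ennreal (expect p h)"
  by (rule nn_integral_eq_integral)
    (use assms in \<open>auto intro!: integrable_pmf_bounded[where b = 1]\<close>)

text \<open>The tower rule, by way of nonnegative integrals, where integrability is no issue; values
  in the unit interval allow the return to real expectations.\<close>

lemma expectation_bind:
  fixes h :: "'b \<Rightarrow> real"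
  assumes "\<And>x. 0 \<le> h x \<and> h x \<le> 1"
  shows "expect (bind_pmf M N) h = expect M (\<lambda>x. expect (N x) h)"
proof -
  have u: "0 \<le> expect (N x) h \<and> expect (N x) h \<le> 1" for x
    by (rule expectation_unit_interval) (rule assms)
  have "ennreal (expect (bind_pmf M N) h) = (\<integral>\<^sup>+x. ennreal (h x) \<partial>bind_pmf M N)"
    by (rule nn_integral_unit_interval[OF assms, symmetric])
  also have "\<dots> = (\<integral>\<^sup>+x. ennreal (expect (N x) h) \<partial>measure_pmf M)"
    by (subst nn_integral_bind_pmf) (simp only: nn_integral_unit_interval[OF assms])
  also have "\<dots> = ennreal (expect M (\<lambda>x. expect (N x) h))"
    by (rule nn_integral_unit_interval) (rule u)
  finally show ?thesis
    using expectation_unit_interval[of "bind_pmf M N" h] expectation_unit_interval[of M "\<lambda>x. expect (N x) h"] assms u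
    by (simp add: ennreal_inj)
qed

text \<open>As \<open>h\<close> lies in the unit interval, the difference is at most the sum of all
  pointwise differences, which is twice the distance as normalized here. The set \<open>S\<close>,
  later a weight class, makes this sum finite.\<close>

lemma abs_expectation_diff_le_stat_dist:
  fixes h :: "'a \<Rightarrow> real"
  assumes "finite S" "set_pmf p \<subseteq> S" "set_pmf q \<subseteq> S" "\<And>x. 0 \<le> h x \<and> h x \<le> 1"
  shows "\<bar>expect p h - expect q h\<bar> \<le> 2 * stat_dist p q"
proof -
  have E: "expect r h = (\<Sum>x\<in>S. h x * pmf r x)" if "set_pmf r \<subseteq> S" for r
    by (rule integral_measure_pmf_real) (use that assms(1) in auto)
  have "stat_dist p q = (\<Sum>x\<in>S. \<bar>pmf p x - pmf q x\<bar>) / 2"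
  proof -
    have "(\<Sum>\<^sub>\<infinity>x. \<bar>pmf p x - pmf q x\<bar>) = (\<Sum>\<^sub>\<infinity>x\<in>S. \<bar>pmf p x - pmf q x\<bar>)"
    proof (rule infsum_cong_neutral)
      fix x assume "x \<in> UNIV - S"
      then have "pmf p x = 0" "pmf q x = 0" using assms(2,3) by (auto simp: pmf_eq_0_set_pmf)
      then show "\<bar>pmf p x - pmf q x\<bar> = 0" by simp
    qed auto
    then show ?thesis using assms(1) by (simp add: stat_dist_def)
  qed
  moreover have "\<bar>expect p h - expect q h\<bar> = \<bar>\<Sum>x\<in>S. h x * (pmf p x - pmf q x)\<bar>"
    using assms by (simp add: E sum_subtractf right_diff_distrib)
  moreover have "\<dots> \<le> (\<Sum>x\<in>S. \<bar>pmf p x - pmf q x\<bar>)"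
  proof (rule order_trans[OF sum_abs sum_mono])
    fix x
    show "\<bar>h x * (pmf p x - pmf q x)\<bar> \<le> \<bar>pmf p x - pmf q x\<bar>"
      using assms(4)[of x] mult_right_mono[of "h x" 1 "\<bar>pmf p x - pmf q x\<bar>"] by (simp add: abs_mult)
  qed
  ultimately show ?thesis by simp
qed

section \<open>Acceptance probabilities of quantum circuits\<close>

lemma finite_bits [simp]: "finite (bits n)"
  using finite_lists_length_eq[of "UNIV :: bool set" n] by (simp add: bits_def)

lemma card_bits: "card (bits n) = 2 ^ n"
  using card_lists_length_eq[of "UNIV :: bool set" n] by (simp add: bits_def)

lemma bits_nonempty [simp]: "bits n \<noteq> {}"
  using card_bits[of n] by auto

lemma bij_betw_flip: "i < n \<Longrightarrow> bij_betw (\<lambda>b. b[i := \<not> b ! i]) (bits n) (bits n)"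
  by (rule bij_betw_byWitness[where f' = "\<lambda>b. b[i := \<not> b ! i]"]) (auto simp: bits_def)

text \<open>Unitarity, which keeps acceptance probabilities below 1. \<open>Tgate\<close> multiplies
  by phases and \<open>Cnot\<close> permutes the basis; \<open>Had\<close> mixes only the two states
  that differ in bit \<open>i\<close>, and the parallelogram law settles each such pair.\<close>

lemma norm_apply_qgate:
  assumes "qgate_ok n g"
  shows "(\<Sum>b\<in>bits n. (cmod (apply_qgate g \<psi> b))\<^sup>2) = (\<Sum>b\<in>bits n. (cmod (\<psi> b))\<^sup>2)"
proof (cases g)
  case (Had i)
  let ?F = "\<lambda>b. (cmod (apply_qgate g \<psi> b))\<^sup>2" and ?G = "\<lambda>b. (cmod (\<psi> b))\<^sup>2"
  let ?\<sigma> = "\<lambda>b :: bool list. b[i := \<not> b ! i]"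
  have i: "i < n" using assms by (simp add: Had)
  \<comment> \<open>Flipping bit \<open>i\<close> is a bijection, so summing over a state and its
    partner counts every state twice.\<close>
  have double: "(\<Sum>b\<in>bits n. H b + H (?\<sigma> b)) = 2 * sum H (bits n)" for H :: "bool list \<Rightarrow> real"
    using sum.reindex_bij_betw[OF bij_betw_flip[OF i], of H] by (simp add: sum.distrib)
  have para: "(cmod ((u + v) / complex_of_real (sqrt 2)))\<^sup>2 + (cmod ((u - v) / complex_of_real (sqrt 2)))\<^sup>2
      = (cmod u)\<^sup>2 + (cmod v)\<^sup>2" for u v
  proof -
    have "(cmod (u + v))\<^sup>2 + (cmod (u - v))\<^sup>2 = 2 * (cmod u)\<^sup>2 + 2 * (cmod v)\<^sup>2"
      by (simp add: cmod_power2) (simp add: power2_eq_square algebra_simps)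
    then show ?thesis by (simp add: norm_divide power_divide)
  qed
  have "?F b + ?F (?\<sigma> b) = ?G b + ?G (?\<sigma> b)" if "b \<in> bits n" for b
  proof -
    have l: "i < length b" using that i by (simp add: bits_def)
    show ?thesis
    proof (cases "b ! i")
      case True
      then have "b[i := True] = b" by (metis list_update_id)
      then show ?thesis using para[of "\<psi> (b[i := False])" "\<psi> b"] l True by (simp add: Had add.commute)
    next
      case False
      then have "b[i := False] = b" by (metis list_update_id)
      then show ?thesis using para[of "\<psi> b" "\<psi> (b[i := True])"] l False by (simp add: Had add.commute)
    qed
  qed
  then have "2 * sum ?F (bits n) = 2 * sum ?G (bits n)" unfolding double[symmetric] by simp
  then show ?thesis by simp
next
  case (Tgate i)
  then show ?thesis by (auto intro!: sum.cong simp: norm_mult)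
next
  case (Cnot i j)
  have ij: "i < n" "j < n" "i \<noteq> j" using assms by (auto simp: Cnot)
  have "bij_betw (\<lambda>b. if b ! i then b[j := \<not> b ! j] else b) (bits n) (bits n)"
    by (rule bij_betw_byWitness[where f' = "\<lambda>b. if b ! i then b[j := \<not> b ! j] else b"])
      (use ij in \<open>auto simp: bits_def\<close>)
  from sum.reindex_bij_betw[OF this, of "\<lambda>b. (cmod (\<psi> b))\<^sup>2"] show ?thesis by (simp add: Cnot)
qed

lemma norm_fold_apply_qgate:
  assumes "\<forall>g \<in> set gs. qgate_ok n g"
  shows "(\<Sum>b\<in>bits n. (cmod (fold apply_qgate gs \<psi> b))\<^sup>2) = (\<Sum>b\<in>bits n. (cmod (\<psi> b))\<^sup>2)"
  using assms
proof (induction gs arbitrary: \<psi>)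
  case (Cons g gs)
  then show ?case using norm_apply_qgate[of n g \<psi>] by simp
qed simp

lemma accept_prob_unit_interval:
  assumes "qcircuit_ok (length w) Q"
  shows "0 \<le> accept_prob Q w \<and> accept_prob Q w \<le> 1"
proof
  define n where "n = length w + length (advice Q)"
  define \<psi> where "\<psi> = fold apply_qgate (qgates Q) (\<lambda>b. if b = w @ advice Q then 1 else 0)"
  have a: "accept_prob Q w = (\<Sum>b \<in> {b \<in> bits n. b ! 0}. (cmod (\<psi> b))\<^sup>2)"
    by (simp add: accept_prob_def Let_def n_def \<psi>_def)
  show "0 \<le> accept_prob Q w" unfolding a by (rule sum_nonneg) simp
  have "accept_prob Q w \<le> (\<Sum>b\<in>bits n. (cmod (\<psi> b))\<^sup>2)"
    unfolding a by (rule sum_mono2) auto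
  also have "\<dots> = (\<Sum>b\<in>bits n. (cmod (if b = w @ advice Q then 1 else 0))\<^sup>2)"
    unfolding \<psi>_def by (rule norm_fold_apply_qgate) (use assms in \<open>auto simp: qcircuit_ok_def n_def\<close>)
  also have "\<dots> = (\<Sum>b\<in>bits n. if b = w @ advice Q then 1 else 0)" by (rule sum.cong) auto
  also have "\<dots> = 1" by (simp add: sum.delta, simp add: bits_def n_def)
  finally show "accept_prob Q w \<le> 1" .
qed

section \<open>Hybrids\<close>

lemma bits_1: "v \<in> bits 1 \<longleftrightarrow> v = [True] \<or> v = [False]"
  by (auto simp: bits_def length_Suc_conv)

lemma finite_weight_class: "finite (weight_class n t \<kappa>)"
  by (rule finite_subset[of _ "bits (n \<kappa>) \<rightarrow>\<^sub>E bits 1"]) (auto simp: weight_class_def intro: finite_PiE)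

lemma finite_preimage1 [simp]: "finite (preimage1 n f)"
  by (simp add: preimage1_def)

lemma weight_class_extend:
  assumes "g \<in> weight_class n (\<lambda>\<kappa>. r \<kappa> - 1) \<kappa>" "y \<in> bits (n \<kappa>) - preimage1 (n \<kappa>) g" "1 \<le> r \<kappa>"
  shows "g(y := [True]) \<in> weight_class n r \<kappa>" "y \<in> preimage1 (n \<kappa>) (g(y := [True]))"
    "(g(y := [True]))(y := [False]) = g"
proof -
  have g: "g \<in> bits (n \<kappa>) \<rightarrow>\<^sub>E bits 1" "card (preimage1 (n \<kappa>) g) = r \<kappa> - 1"
    using assms(1) by (auto simp: weight_class_def)
  have "preimage1 (n \<kappa>) (g(y := [True])) = insert y (preimage1 (n \<kappa>) g)"
    using assms(2) by (auto simp: preimage1_def)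
  then have "card (preimage1 (n \<kappa>) (g(y := [True]))) = r \<kappa>"
    using g(2) assms(2,3) by simp
  moreover have "g(y := [True]) \<in> bits (n \<kappa>) \<rightarrow>\<^sub>E bits 1"
    using g(1) assms(2) by (auto simp: PiE_iff extensional_def bits_1 simp del: One_nat_def)
  ultimately show "g(y := [True]) \<in> weight_class n r \<kappa>" by (simp add: weight_class_def)
  show "y \<in> preimage1 (n \<kappa>) (g(y := [True]))" using assms(2) by (simp add: preimage1_def)
  have "g y \<in> bits 1" using g(1) assms(2) by auto
  then have "g y = [False]" using assms(2) by (auto simp: bits_1 preimage1_def simp del: One_nat_def)
  then show "(g(y := [True]))(y := [False]) = g" by auto
qed

lemma weight_class_restrict:
  assumes "f \<in> weight_class n r \<kappa>" "x \<in> preimage1 (n \<kappa>) f"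
  shows "f(x := [False]) \<in> weight_class n (\<lambda>\<kappa>. r \<kappa> - 1) \<kappa>"
    "x \<in> bits (n \<kappa>) - preimage1 (n \<kappa>) (f(x := [False]))" "(f(x := [False]))(x := [True]) = f"
proof -
  have f: "f \<in> bits (n \<kappa>) \<rightarrow>\<^sub>E bits 1" "card (preimage1 (n \<kappa>) f) = r \<kappa>"
    using assms(1) by (auto simp: weight_class_def)
  have x: "x \<in> bits (n \<kappa>)" "f x = [True]" using assms(2) by (auto simp: preimage1_def)
  have "preimage1 (n \<kappa>) (f(x := [False])) = preimage1 (n \<kappa>) f - {x}"
    using x by (auto simp: preimage1_def)
  then have "card (preimage1 (n \<kappa>) (f(x := [False]))) = r \<kappa> - 1"
    using f(2) assms(2) by simp
  moreover have "f(x := [False]) \<in> bits (n \<kappa>) \<rightarrow>\<^sub>E bits 1"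
    using f(1) x by (auto simp: PiE_iff extensional_def bits_1 simp del: One_nat_def)
  ultimately show "f(x := [False]) \<in> weight_class n (\<lambda>\<kappa>. r \<kappa> - 1) \<kappa>" by (simp add: weight_class_def)
  show "x \<in> bits (n \<kappa>) - preimage1 (n \<kappa>) (f(x := [False]))" using x by (simp add: preimage1_def)
  show "(f(x := [False]))(x := [True]) = f" using x by auto
qed

text \<open>Setting a bit where \<open>g\<close> is 0 and clearing a bit where \<open>f\<close> is 1
  undo each other. The point is carried along because the function alone does not tell which bit was
  changed.\<close>

lemma bij_betw_weight_class:
  assumes "1 \<le> r \<kappa>"
  shows "bij_betw (\<lambda>(g, y). (g(y := [True]), y))
    (SIGMA g:weight_class n (\<lambda>\<kappa>. r \<kappa> - 1) \<kappa>. bits (n \<kappa>) - preimage1 (n \<kappa>) g)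
    (SIGMA f:weight_class n r \<kappa>. preimage1 (n \<kappa>) f)"
proof (rule bij_betw_byWitness[where f' = "\<lambda>(f, x). (f(x := [False]), x)"])
  let ?X = "SIGMA g:weight_class n (\<lambda>\<kappa>. r \<kappa> - 1) \<kappa>. bits (n \<kappa>) - preimage1 (n \<kappa>) g"
  let ?Y = "SIGMA f:weight_class n r \<kappa>. preimage1 (n \<kappa>) f"
  show "\<forall>z \<in> ?X. (case case z of (g, y) \<Rightarrow> (g(y := [True]), y) of (f, x) \<Rightarrow> (f(x := [False]), x)) = z"
    using weight_class_extend(3)[where n = n and r = r and \<kappa> = \<kappa>] assms by (fastforce simp del: fun_upd_upd)
  show "\<forall>z \<in> ?Y. (case case z of (f, x) \<Rightarrow> (f(x := [False]), x) of (g, y) \<Rightarrow> (g(y := [True]), y)) = z"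
    using weight_class_restrict(3)[where n = n and r = r and \<kappa> = \<kappa>] by (fastforce simp del: fun_upd_upd)
  show "(\<lambda>(g, y). (g(y := [True]), y)) ` ?X \<subseteq> ?Y"
    using weight_class_extend(1,2)[where n = n and r = r and \<kappa> = \<kappa>] assms by fastforce
  show "(\<lambda>(f, x). (f(x := [False]), x)) ` ?Y \<subseteq> ?X"
    using weight_class_restrict(1,2)[where n = n and r = r and \<kappa> = \<kappa>] by fastforce
qed

text \<open>By the bijection the left mean runs over the pairs \<open>(g, y)\<close> with
  \<open>g y = [False]\<close>, the right one over all pairs. Each \<open>g\<close> excludes the
  same share of points, \<open>(r - 1) / 2 ^ n\<close>, so the two means differ by at most this
  share, whatever the function with values in the unit interval.\<close>

lemma weight_class_hybrid:
  fixes \<beta> :: "(bool list \<Rightarrow> bool list) \<Rightarrow> bool list \<Rightarrow> real"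
  assumes r: "1 \<le> r \<kappa>" and ne: "weight_class n r \<kappa> \<noteq> {}" "weight_class n (\<lambda>\<kappa>. r \<kappa> - 1) \<kappa> \<noteq> {}"
    and \<beta>: "\<And>f x. 0 \<le> \<beta> f x \<and> \<beta> f x \<le> 1"
  shows "\<bar>expect (uniform_weight n r \<kappa>)
        (\<lambda>f. expect (pmf_of_set (preimage1 (n \<kappa>) f)) (\<beta> f))
      - expect (uniform_weight n (\<lambda>\<kappa>. r \<kappa> - 1) \<kappa>)
        (\<lambda>g. expect (pmf_of_set (bits (n \<kappa>))) (\<lambda>y. \<beta> (g(y := [True])) y))\<bar>
    \<le> real (r \<kappa>) / 2 ^ n \<kappa>"
proof -
  let ?F = "weight_class n r \<kappa>" and ?G = "weight_class n (\<lambda>\<kappa>. r \<kappa> - 1) \<kappa>"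
  let ?pre = "preimage1 (n \<kappa>)" and ?B = "bits (n \<kappa>)"
  \<comment> \<open>\<open>Z\<close> collects the good pairs, seen from weight \<open>r\<close>.
    \<open>Y\<close> collects the pairs whose point already is a preimage of 1, where setting the
    bit changes nothing.\<close>
  define Z where "Z = (\<Sum>f\<in>?F. \<Sum>x\<in>?pre f. \<beta> f x)"
  define Y where "Y = (\<Sum>g\<in>?G. \<Sum>y\<in>?pre g. \<beta> (g(y := [True])) y)"
  define N where "N = (2::real) ^ n \<kappa>"
  define s where "s = real (r \<kappa> - 1)"
  define m where "m = real (card ?G)"
  have fin: "finite ?F" "finite ?G" by (rule finite_weight_class)+
  have cF: "card (?pre f) = r \<kappa>" if "f \<in> ?F" for f using that by (simp add: weight_class_def)
  have cG: "card (?pre g) = r \<kappa> - 1" if "g \<in> ?G" for g using that by (simp add: weight_class_def)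
  have sub: "?pre g \<subseteq> ?B" for g by (auto simp: preimage1_def)
  have cD: "real (card (?B - ?pre g)) = N - s" if "g \<in> ?G" for g
    using card_mono[OF finite_bits sub[of g]] cG[OF that]
    by (simp add: card_Diff_subset[OF _ sub] of_nat_diff card_bits N_def s_def)
  have N: "N > 0" by (simp add: N_def)
  have m: "m > 0" using fin ne(2) by (simp add: m_def card_gt_0_iff)
  have s: "0 \<le> s" "real (r \<kappa>) = s + 1" using r by (auto simp: s_def of_nat_diff)
  have bij: "bij_betw (\<lambda>(g, y). (g(y := [True]), y)) (SIGMA g:?G. ?B - ?pre g) (SIGMA f:?F. ?pre f)"
    by (rule bij_betw_weight_class) (rule r)
  have Z1: "Z = (\<Sum>g\<in>?G. \<Sum>y\<in>?B - ?pre g. \<beta> (g(y := [True])) y)"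
    using sum.reindex_bij_betw[OF bij, of "\<lambda>(f, x). \<beta> f x"] fin
    by (simp add: Z_def sum.Sigma case_prod_unfold)
  \<comment> \<open>Double counting: the same pairs as \<open>(f, x)\<close> and, through the
    bijection, as \<open>(g, y)\<close>.\<close>
  have card_eq: "real (card ?F) * real (r \<kappa>) = m * (N - s)"
  proof -
    have "real (card ?F) * real (r \<kappa>) = (\<Sum>f\<in>?F. real (card (?pre f)))" by (simp add: cF)
    also have "\<dots> = real (card (SIGMA f:?F. ?pre f))" using fin by (simp add: card_SigmaI)
    also have "card (SIGMA f:?F. ?pre f) = card (SIGMA g:?G. ?B - ?pre g)"
      using bij_betw_same_card[OF bij] by simp
    also have "real \<dots> = (\<Sum>g\<in>?G. real (card (?B - ?pre g)))" using fin by (simp add: card_SigmaI)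
    also have "\<dots> = m * (N - s)" by (simp add: cD m_def)
    finally show ?thesis .
  qed
  have cFpos: "real (card ?F) > 0" using fin ne(1) by (simp add: card_gt_0_iff)
  \<comment> \<open>A function of weight \<open>r\<close> exists, so weight \<open>r - 1\<close>
    cannot fill the whole cube.\<close>
  then have Ns: "N - s > 0" using card_eq s m by (metis add_pos_nonneg add.commute mult_pos_pos zero_less_mult_pos zero_less_one)
  have E1: "expect (uniform_weight n r \<kappa>)
        (\<lambda>f. expect (pmf_of_set (?pre f)) (\<beta> f)) = Z / (m * (N - s))"
  proof -
    have "expect (pmf_of_set (?pre f)) (\<beta> f) = (\<Sum>x\<in>?pre f. \<beta> f x) / real (r \<kappa>)" if "f \<in> ?F" for f
    proof -
      have "?pre f \<noteq> {}" using cF[OF that] r by auto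
      then show ?thesis using cF[OF that] by (simp add: integral_pmf_of_set)
    qed
    then have "expect (uniform_weight n r \<kappa>)
        (\<lambda>f. expect (pmf_of_set (?pre f)) (\<beta> f)) = (Z / real (r \<kappa>)) / real (card ?F)"
      using ne(1) fin(1) by (simp add: uniform_weight_def integral_pmf_of_set Z_def sum_divide_distrib)
    then show ?thesis by (simp add: card_eq[symmetric] mult.commute)
  qed
  have E2: "expect (uniform_weight n (\<lambda>\<kappa>. r \<kappa> - 1) \<kappa>)
        (\<lambda>g. expect (pmf_of_set ?B) (\<lambda>y. \<beta> (g(y := [True])) y)) = (Z + Y) / (m * N)"
  proof -
    have "(\<Sum>y\<in>?B. \<beta> (g(y := [True])) y) = (\<Sum>y\<in>?B - ?pre g. \<beta> (g(y := [True])) y) + (\<Sum>y\<in>?pre g. \<beta> (g(y := [True])) y)" for g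
      by (rule sum.subset_diff) (use sub in auto)
    then have "(\<Sum>g\<in>?G. \<Sum>y\<in>?B. \<beta> (g(y := [True])) y) = Z + Y"
      by (simp add: Z1 Y_def sum.distrib)
    then show ?thesis using ne(2) fin(2)
      by (simp add: uniform_weight_def integral_pmf_of_set sum_divide_distrib[symmetric] card_bits N_def m_def mult.commute)
  qed
  have sum_le: "0 \<le> (\<Sum>x\<in>A. \<beta> (h x) x) \<and> (\<Sum>x\<in>A. \<beta> (h x) x) \<le> real (card A)" for A h
  proof
    show "0 \<le> (\<Sum>x\<in>A. \<beta> (h x) x)" using \<beta> by (intro sum_nonneg) auto
    show "(\<Sum>x\<in>A. \<beta> (h x) x) \<le> real (card A)"
      using sum_bounded_above[of A "\<lambda>x. \<beta> (h x) x" 1] \<beta> by auto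
  qed
  have Z: "0 \<le> Z" "Z \<le> m * (N - s)"
  proof -
    show "0 \<le> Z" unfolding Z1 using \<beta> by (intro sum_nonneg) auto
    have "Z \<le> (\<Sum>g\<in>?G. real (card (?B - ?pre g)))" unfolding Z1 by (intro sum_mono conjunct2[OF sum_le])
    then show "Z \<le> m * (N - s)" by (simp add: cD m_def)
  qed
  have Y: "0 \<le> Y" "Y \<le> m * s"
  proof -
    show "0 \<le> Y" unfolding Y_def using \<beta> by (intro sum_nonneg) auto
    have "Y \<le> (\<Sum>g\<in>?G. real (card (?pre g)))" unfolding Y_def by (intro sum_mono conjunct2[OF sum_le])
    then show "Y \<le> m * s" by (simp add: cG m_def s_def)
  qed
  define u where "u = Z / (m * (N - s))"
  define v where "v = Y / (m * N)"
  have u: "0 \<le> u" "u \<le> 1" using Z m Ns by (auto simp: u_def field_simps)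
  have v: "0 \<le> v" "v \<le> s / N" using Y m N by (auto simp: v_def field_simps)
  \<comment> \<open>The good pairs have share \<open>1 - s / N\<close> and mean \<open>u\<close>;
    the others contribute \<open>v\<close>. The deviation from \<open>u\<close> is thus a difference
    of two numbers between 0 and \<open>s / N\<close>.\<close>
  have "(Z + Y) / (m * N) = u - u * (s / N) + v"
  proof -
    have "Z = u * (m * (N - s))" using m Ns by (simp add: u_def)
    then show ?thesis using m N by (simp add: v_def field_simps)
  qed
  moreover have "0 \<le> u * (s / N)" "u * (s / N) \<le> s / N"
    using u s N mult_right_mono[of u 1 "s / N"] by auto
  ultimately have "\<bar>Z / (m * (N - s)) - (Z + Y) / (m * N)\<bar> \<le> s / N"
    using v unfolding u_def[symmetric] by linarith
  also have "\<dots> \<le> real (r \<kappa>) / N" using s N by (simp add: divide_right_mono)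
  finally show ?thesis unfolding E1 E2 N_def .
qed

text \<open>Summed over all points, the probabilities of value 1 count the preimages of 1 and give
  \<open>r\<close>, so some point reaches the average \<open>r / 2 ^ n\<close>. Evasiveness is
  applied to a sequence of such points.\<close>

lemma negligible_density:
  assumes "evasive n (weight_class n r) (uniform_weight n r)" "\<And>\<kappa>. weight_class n r \<kappa> \<noteq> {}"
  shows "negligible (\<lambda>\<kappa>. real (r \<kappa>) / 2 ^ n \<kappa>)"
proof -
  have "\<exists>x \<in> bits (n \<kappa>). real (r \<kappa>) / 2 ^ n \<kappa> \<le> measure_pmf.prob (uniform_weight n r \<kappa>) {f. f x = [True]}" for \<kappa>
  proof (rule ccontr)
    let ?F = "weight_class n r \<kappa>" and ?B = "bits (n \<kappa>)"
    let ?P = "\<lambda>x. measure_pmf.prob (uniform_weight n r \<kappa>) {f. f x = [True]}"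
    assume "\<not> ?thesis"
    then have "(\<Sum>x\<in>?B. ?P x) < (\<Sum>x\<in>?B. real (r \<kappa>) / 2 ^ n \<kappa>)"
      by (intro sum_strict_mono) (auto simp: not_le)
    also have "\<dots> = real (r \<kappa>)" by (simp add: card_bits)
    finally have lt: "(\<Sum>x\<in>?B. ?P x) < real (r \<kappa>)" .
    have fin: "finite ?F" by (rule finite_weight_class)
    have "(\<Sum>x\<in>?B. ?P x) = (\<Sum>x\<in>?B. real (card (?F \<inter> {f. f x = [True]}))) / real (card ?F)"
      using fin assms(2) by (simp add: uniform_weight_def measure_pmf_of_set sum_divide_distrib)
    also have "(\<Sum>x\<in>?B. real (card (?F \<inter> {f. f x = [True]}))) = (\<Sum>x\<in>?B. \<Sum>f\<in>?F. if f x = [True] then 1 else 0)"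
      using fin by (simp add: sum.If_cases Int_def)
    also have "\<dots> = (\<Sum>f\<in>?F. \<Sum>x\<in>?B. if f x = [True] then 1 else 0)" by (rule sum.swap)
    also have "\<dots> = (\<Sum>f\<in>?F. real (card (preimage1 (n \<kappa>) f)))"
      by (simp add: sum.If_cases Int_def preimage1_def)
    also have "\<dots> = real (card ?F) * real (r \<kappa>)" by (simp add: weight_class_def)
    finally have "(\<Sum>x\<in>?B. ?P x) = real (r \<kappa>)" using fin assms(2)[of \<kappa>] by simp
    with lt show False by simp
  qed
  then obtain x where x: "\<And>\<kappa>. x \<kappa> \<in> bits (n \<kappa>)"
    "\<And>\<kappa>. real (r \<kappa>) / 2 ^ n \<kappa> \<le> measure_pmf.prob (uniform_weight n r \<kappa>) {f. f (x \<kappa>) = [True]}"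
    by metis
  have "negligible (\<lambda>\<kappa>. measure_pmf.prob (uniform_weight n r \<kappa>) {f. f (x \<kappa>) = [True]})"
    using assms(1) x(1) unfolding evasive_def by blast
  then show ?thesis by (rule negligible_mono) (use x(2) in \<open>auto intro: order_trans\<close>)
qed

section \<open>The reduction to the obfuscator\<close>

definition obf_accept ::
    "(nat \<Rightarrow> nat \<Rightarrow> qcircuit) \<Rightarrow> nat \<Rightarrow> nat \<Rightarrow> (nat \<Rightarrow> circuit \<Rightarrow> circuit pmf) \<Rightarrow> nat \<Rightarrow> circuit \<Rightarrow> bool list \<Rightarrow> real" where
  "obf_accept A d e obf \<kappa> G x = expect (obf_pad d e obf \<kappa> G)
     (\<lambda>G'. accept_prob (A \<kappa> (length (encode G' @ x))) (encode G' @ x))"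

lemma obf_accept_unit_interval:
  assumes "qpt_adversary A"
  shows "0 \<le> obf_accept A d e obf \<kappa> G x \<and> obf_accept A d e obf \<kappa> G x \<le> 1"
  unfolding obf_accept_def
  by (rule expectation_unit_interval, rule accept_prob_unit_interval) (use assms in \<open>simp add: qpt_adversary_def\<close>)

text \<open>The padding and the point \<open>x\<close> go into the advice of the reduction.\<close>

lemma obf_accept_negligible:
  assumes iO: "post_quantum_iO obf" and A: "qpt_adversary A" and n: "poly_bounded n"
    and G0: "\<And>\<kappa>. G0 \<kappa> \<in> circuits (n \<kappa>) 1 \<and> circuit_size (G0 \<kappa>) \<le> (\<kappa> + 2) ^ d"
    and G1: "\<And>\<kappa>. G1 \<kappa> \<in> circuits (n \<kappa>) 1 \<and> circuit_size (G1 \<kappa>) \<le> (\<kappa> + 2) ^ d"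
    and eq: "\<And>\<kappa>. functionality (n \<kappa>) (G0 \<kappa>) = functionality (n \<kappa>) (G1 \<kappa>)"
    and x: "\<And>\<kappa>. x \<kappa> \<in> bits (n \<kappa>)"
  shows "negligible (\<lambda>\<kappa>. obf_accept A d e obf \<kappa> (G0 \<kappa>) (x \<kappa>) - obf_accept A d e obf \<kappa> (G1 \<kappa>) (x \<kappa>))"
proof -
  define T where "T = (\<lambda>\<kappa>::nat. (\<kappa> + 2) ^ e)"
  \<comment> \<open>The length of the string that \<open>A\<close> receives if the obfuscator
    outputs \<open>m\<close> bits: these bits, padded, and then the point.\<close>
  define M where "M = (\<lambda>\<kappa> m. m + (T \<kappa> - m) + n \<kappa>)"
  \<comment> \<open>The circuit of \<open>A\<close> is chosen for the longer input. Since advice is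
    simply appended to the input, the initial basis state is literally the one of \<open>A\<close>,
    and the gates remain unchanged.\<close>
  define B where "B = (\<lambda>\<kappa> m. QCircuit (replicate (T \<kappa> - m) False @ x \<kappa> @ advice (A \<kappa> (M \<kappa> m))) (qgates (A \<kappa> (M \<kappa> m))))"
  have lx: "length (x \<kappa>) = n \<kappa>" for \<kappa> using x by (simp add: bits_def)
  have acc: "accept_prob (B \<kappa> (length w)) w = accept_prob (A \<kappa> (length (pad_string (T \<kappa>) w @ x \<kappa>))) (pad_string (T \<kappa>) w @ x \<kappa>)" for \<kappa> w
    by (simp add: accept_prob_def B_def M_def pad_string_def lx Let_def add.assoc)
  have "qpt_adversary B"
  proof -
    obtain c where c: "\<And>\<kappa> m. length (advice (A \<kappa> m)) + length (qgates (A \<kappa> m)) \<le> (\<kappa> + m) ^ c + c"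
      using A unfolding qpt_adversary_def by blast
    obtain a where a: "\<And>\<kappa>. n \<kappa> \<le> \<kappa> ^ a + a" using n unfolding poly_bounded_def by blast
    define S where "S = (\<lambda>L::nat. (L + 2) ^ e + (L ^ a + a))"
    have "poly_bounded (\<lambda>L. S L + ((L + S L) ^ c + c))"
      unfolding S_def by (intro poly_bounded_add poly_bounded_power poly_bounded_id poly_bounded_const)
    then obtain b where b: "\<And>L. S L + ((L + S L) ^ c + c) \<le> L ^ b + b" unfolding poly_bounded_def by blast
    have "length (advice (B \<kappa> m)) + length (qgates (B \<kappa> m)) \<le> (\<kappa> + m) ^ b + b" for \<kappa> m
    proof -
      have "T \<kappa> \<le> (\<kappa> + m + 2) ^ e" unfolding T_def by (rule power_mono) auto
      moreover have "n \<kappa> \<le> (\<kappa> + m) ^ a + a"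
        using a[of \<kappa>] power_mono[of \<kappa> "\<kappa> + m" a] by simp
      ultimately have S: "T \<kappa> + n \<kappa> \<le> S (\<kappa> + m)" unfolding S_def by (rule add_mono)
      have "length (advice (B \<kappa> m)) + length (qgates (B \<kappa> m)) \<le> (T \<kappa> + n \<kappa>) + ((\<kappa> + M \<kappa> m) ^ c + c)"
        using c[of \<kappa> "M \<kappa> m"] by (simp add: B_def lx)
      also have "\<dots> \<le> S (\<kappa> + m) + ((\<kappa> + m + S (\<kappa> + m)) ^ c + c)"
        by (rule add_mono[OF S add_right_mono[OF power_mono]]) (use S in \<open>auto simp: M_def\<close>)
      also have "\<dots> \<le> (\<kappa> + m) ^ b + b" by (rule b)
      finally show ?thesis .
    qed
    moreover have "qcircuit_ok m (B \<kappa> m)" for \<kappa> m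
    proof -
      have "m + length (advice (B \<kappa> m)) = M \<kappa> m + length (advice (A \<kappa> (M \<kappa> m)))"
        by (simp add: B_def M_def lx)
      moreover have "qcircuit_ok (M \<kappa> m) (A \<kappa> (M \<kappa> m))" using A by (simp add: qpt_adversary_def)
      moreover have "qgates (B \<kappa> m) = qgates (A \<kappa> (M \<kappa> m))" by (simp add: B_def)
      ultimately show ?thesis unfolding qcircuit_ok_def by simp
    qed
    ultimately show ?thesis unfolding qpt_adversary_def by blast
  qed
  define C0 where "C0 = (\<lambda>\<kappa>. pad_circuit ((\<kappa> + 2) ^ d) (G0 \<kappa>))"
  define C1 where "C1 = (\<lambda>\<kappa>. pad_circuit ((\<kappa> + 2) ^ d) (G1 \<kappa>))"
  have same: "C0 \<kappa> \<in> circuits (n \<kappa>) 1 \<and> C1 \<kappa> \<in> circuits (n \<kappa>) 1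
           \<and> circuit_size (C0 \<kappa>) = circuit_size (C1 \<kappa>)
           \<and> (\<forall>y \<in> bits (n \<kappa>). eval_circuit (C0 \<kappa>) y = eval_circuit (C1 \<kappa>) y)" for \<kappa>
  proof (intro conjI ballI)
    show "C0 \<kappa> \<in> circuits (n \<kappa>) 1" "C1 \<kappa> \<in> circuits (n \<kappa>) 1"
      using G0[of \<kappa>] G1[of \<kappa>] pad_circuit_in_circuits unfolding C0_def C1_def by blast+
    show "circuit_size (C0 \<kappa>) = circuit_size (C1 \<kappa>)"
      using G0[of \<kappa>] G1[of \<kappa>] by (simp add: C0_def C1_def circuit_size_pad_circuit)
    fix y assume y: "y \<in> bits (n \<kappa>)"
    have "eval_circuit (G0 \<kappa>) y = eval_circuit (G1 \<kappa>) y"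
      using fun_cong[OF eq[of \<kappa>], of y] y by (simp add: functionality_def)
    then show "eval_circuit (C0 \<kappa>) y = eval_circuit (C1 \<kappa>) y"
      unfolding C0_def C1_def using y eval_pad_circuit[OF conjunct1[OF G0[of \<kappa>]]] eval_pad_circuit[OF conjunct1[OF G1[of \<kappa>]]] by simp
  qed
  have size: "poly_bounded (\<lambda>\<kappa>. circuit_size (C0 \<kappa>))"
  proof (rule poly_bounded_mono)
    show "poly_bounded (\<lambda>\<kappa>. (\<kappa> + 2) ^ d)"
      by (intro poly_bounded_power poly_bounded_add poly_bounded_id poly_bounded_const)
    show "circuit_size (C0 \<kappa>) \<le> (\<kappa> + 2) ^ d" for \<kappa>
      using G0[of \<kappa>] by (simp add: C0_def circuit_size_pad_circuit)
  qed
  have "comp_indist (\<lambda>\<kappa>. map_pmf encode (obf \<kappa> (C0 \<kappa>))) (\<lambda>\<kappa>. map_pmf encode (obf \<kappa> (C1 \<kappa>)))"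
    using iO[unfolded post_quantum_iO_def, THEN conjunct2, THEN conjunct2, THEN spec[of _ n],
        THEN spec[of _ "\<lambda>_. 1"], THEN spec[of _ C0], THEN spec[of _ C1]] same size by blast
  then have "negligible (\<lambda>\<kappa>. expect (map_pmf encode (obf \<kappa> (C0 \<kappa>))) (\<lambda>w. accept_prob (B \<kappa> (length w)) w)
      - expect (map_pmf encode (obf \<kappa> (C1 \<kappa>))) (\<lambda>w. accept_prob (B \<kappa> (length w)) w))"
    using \<open>qpt_adversary B\<close> unfolding comp_indist_def by blast
  then show ?thesis
    by (simp only: acc) (simp add: obf_accept_def obf_pad_def C0_def C1_def T_def encode_pad_circuit)
qed

text \<open>The replacement \<open>c\<close> may be any function, computable or not: only its values
  at the worst pairs enter, as a second fixed sequence of circuits.\<close>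

lemma obf_accept_average_negligible:
  assumes iO: "post_quantum_iO obf" and A: "qpt_adversary A" and n: "poly_bounded n"
    and p: "\<And>\<kappa> G x. (G, x) \<in> set_pmf (p \<kappa>) \<Longrightarrow> G \<in> circuits (n \<kappa>) 1 \<and> circuit_size G \<le> (\<kappa> + 2) ^ d \<and> x \<in> bits (n \<kappa>)"
    and c: "\<And>\<kappa> G x. (G, x) \<in> set_pmf (p \<kappa>) \<Longrightarrow> c \<kappa> G \<in> circuits (n \<kappa>) 1 \<and> circuit_size (c \<kappa> G) \<le> (\<kappa> + 2) ^ d
        \<and> functionality (n \<kappa>) (c \<kappa> G) = functionality (n \<kappa>) G"
  shows "negligible (\<lambda>\<kappa>. expect (p \<kappa>) (\<lambda>(G, x). obf_accept A d e obf \<kappa> G x)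
    - expect (p \<kappa>) (\<lambda>(G, x). obf_accept A d e obf \<kappa> (c \<kappa> G) x))"
proof -
  define h where "h = (\<lambda>\<kappa> (G, x). obf_accept A d e obf \<kappa> G x - obf_accept A d e obf \<kappa> (c \<kappa> G) x)"
  have "\<exists>z \<in> set_pmf (p \<kappa>). \<bar>expect (p \<kappa>) (h \<kappa>)\<bar> \<le> 2 * \<bar>h \<kappa> z\<bar>" for \<kappa>
    by (rule expectation_witness)
  then obtain z where z: "\<And>\<kappa>. z \<kappa> \<in> set_pmf (p \<kappa>)"
    "\<And>\<kappa>. \<bar>expect (p \<kappa>) (h \<kappa>)\<bar> \<le> 2 * \<bar>h \<kappa> (z \<kappa>)\<bar>" by metis
  have zz: "(fst (z \<kappa>), snd (z \<kappa>)) \<in> set_pmf (p \<kappa>)" for \<kappa> using z(1) by simp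
  have "negligible (\<lambda>\<kappa>. obf_accept A d e obf \<kappa> (fst (z \<kappa>)) (snd (z \<kappa>)) - obf_accept A d e obf \<kappa> (c \<kappa> (fst (z \<kappa>))) (snd (z \<kappa>)))"
    by (rule obf_accept_negligible[OF iO A n]) (use p[OF zz] c[OF zz] in auto)
  from negligible_double[OF negligible_abs[OF this]]
  have "negligible (\<lambda>\<kappa>. expect (p \<kappa>) (h \<kappa>))"
    by (rule negligible_mono) (use z(2) in \<open>auto simp: h_def case_prod_unfold\<close>)
  moreover have "expect (p \<kappa>) (h \<kappa>) = expect (p \<kappa>) (\<lambda>(G, x). obf_accept A d e obf \<kappa> G x)
    - expect (p \<kappa>) (\<lambda>(G, x). obf_accept A d e obf \<kappa> (c \<kappa> G) x)" for \<kappa>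
  proof -
    have i: "integrable (measure_pmf (p \<kappa>)) (\<lambda>(G, x). obf_accept A d e obf \<kappa> (f G) x)" for f
      by (rule integrable_pmf_bounded[where b = 1])
        (use obf_accept_unit_interval[OF A, of d e obf \<kappa>] in \<open>auto simp: abs_le_iff intro: order_trans[of _ 0]\<close>)
    show ?thesis using Bochner_Integration.integral_diff[OF i[of "\<lambda>G. G"] i[of "c \<kappa>"]]
      by (simp add: h_def case_prod_unfold)
  qed
  ultimately show ?thesis by simp
qed

section \<open>Puncturing to the constant one, and circuit sizes\<close>

lemma const_one_in_circuits: "const_one n \<in> circuits n 1"
  by (auto simp: const_one_def circuits_iff)

lemma eval_const_one: "y \<in> bits n \<Longrightarrow> eval_circuit (const_one n) y = [True]"
  by (simp add: const_one_def eval_circuit_wires bits_def nth_append)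

lemma functionality_puncture_one:
  assumes "C \<in> circuits n 1" "y \<in> bits n"
  shows "functionality n (puncture C y y (const_one n) (const_one n)) = (functionality n C)(y := [True])"
proof
  fix x
  show "functionality n (puncture C y y (const_one n) (const_one n)) x = ((functionality n C)(y := [True])) x"
    using eval_puncture[OF assms(1,2,2) const_one_in_circuits const_one_in_circuits, of x] assms(2)
    by (auto simp: functionality_def eval_const_one)
qed

lemma preimage1_functionality: "preimage1 n (functionality n C) = preimage1 n (eval_circuit C)"
  by (auto simp: preimage1_def functionality_def)

text \<open>What a polynomial-time program writes has polynomial length, so the bound is read off
  from \<open>ppt_patch\<close> instead of the gates. One exponent serves all input lengths, because
  there is one program. The summand 3 is one bit for the new value plus the 2 of the length
  bound.\<close>

lemma circuit_size_patch:
  obtains e where "\<And>n C x b. C \<in> circuits n 1 \<Longrightarrow> x \<in> bits n \<Longrightarrow>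
    circuit_size (patch C x b) \<le> (circuit_size C + n + 3) ^ e"
proof -
  obtain e where e: "\<forall>i \<in> {(C, x, b). \<exists>n. C \<in> circuits n 1 \<and> x \<in> bits n}.
      \<forall>w \<in> set_pmf (case i of (C, x, b) \<Rightarrow> return_pmf (encode (patch C x b))).
        length w \<le> (args_size (case i of (C, x, b) \<Rightarrow> [encode C, x, [b]]) + 2) ^ e"
    using ppt_output_length[OF ppt_patch] by blast
  show thesis
  proof (rule that[of e])
    fix n C x and b :: bool assume *: "C \<in> circuits n 1" "x \<in> bits n"
    then have "(C, x, b) \<in> {(C, x, b). \<exists>n. C \<in> circuits n 1 \<and> x \<in> bits n}" by auto
    from bspec[OF e this] *(2)
    show "circuit_size (patch C x b) \<le> (circuit_size C + n + 3) ^ e"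
      by (simp add: circuit_size_def bits_def eval_nat_numeral)
  qed
qed

text \<open>Puncturing patches twice, hence the nested bound in the proof.\<close>

lemma circuit_size_puncture_poly:
  assumes "poly_bounded s" "poly_bounded n"
  obtains T where "poly_bounded T" "\<And>\<kappa> C y \<mu>1 \<mu>2. C \<in> circuits (n \<kappa>) 1 \<Longrightarrow> circuit_size C = s \<kappa> \<Longrightarrow> y \<in> bits (n \<kappa>)
    \<Longrightarrow> circuit_size (puncture C y y \<mu>1 \<mu>2) \<le> T \<kappa>"
proof -
  obtain e where e: "\<And>n C x b. C \<in> circuits n 1 \<Longrightarrow> x \<in> bits n \<Longrightarrow>
    circuit_size (patch C x b) \<le> (circuit_size C + n + 3) ^ e"
    using circuit_size_patch by blast
  define T where "T = (\<lambda>\<kappa>. ((s \<kappa> + n \<kappa> + 3) ^ e + n \<kappa> + 3) ^ e)"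
  have "poly_bounded T" unfolding T_def
    by (intro poly_bounded_add poly_bounded_power poly_bounded_const assms)
  moreover have "circuit_size (puncture C y y \<mu>1 \<mu>2) \<le> T \<kappa>"
    if *: "C \<in> circuits (n \<kappa>) 1" "circuit_size C = s \<kappa>" "y \<in> bits (n \<kappa>)" for \<kappa> C y \<mu>1 \<mu>2
  proof -
    let ?C = "patch C y (hd (eval_circuit \<mu>2 y))"
    have "circuit_size (puncture C y y \<mu>1 \<mu>2) \<le> (circuit_size ?C + n \<kappa> + 3) ^ e"
      unfolding puncture_def by (rule e[OF patch_in_circuits[OF *(1,3)] *(3)])
    also have "\<dots> \<le> T \<kappa>"
      unfolding T_def using e[OF *(1,3)] *(2) by (intro power_mono add_mono) auto
    finally show ?thesis .
  qed
  ultimately show thesis by (rule that)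
qed

text \<open>With the inner length fixed, the obfuscator runs in time polynomial in the security
  parameter; \<open>e\<close> is chosen so that the outer padding exceeds whatever it can output,
  which makes the final size exact.\<close>

lemma circuit_size_obf_pad:
  assumes "post_quantum_iO obf"
  obtains e where "\<And>\<kappa> n m C G. C \<in> circuits n m \<Longrightarrow> circuit_size C \<le> (\<kappa> + 2) ^ d
    \<Longrightarrow> G \<in> set_pmf (obf_pad d e obf \<kappa> C) \<Longrightarrow> circuit_size G = (\<kappa> + 2) ^ e"
proof -
  have "ppt {(\<kappa>, C). \<exists>n m. C \<in> circuits n m} (\<lambda>(\<kappa>, C). [unary \<kappa>, encode C]) (\<lambda>(\<kappa>, C). map_pmf encode (obf \<kappa> C))"
    using assms by (simp add: post_quantum_iO_def)
  from ppt_output_length[OF this] obtain a where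
    a: "\<And>\<kappa> C n m G. C \<in> circuits n m \<Longrightarrow> G \<in> set_pmf (obf \<kappa> C) \<Longrightarrow> circuit_size G \<le> (\<kappa> + circuit_size C + 2) ^ a"
    by (force simp: circuit_size_def)
  have "poly_bounded (\<lambda>\<kappa>. (\<kappa> + (\<kappa> + 2) ^ d + 2) ^ a)"
    by (intro poly_bounded_add poly_bounded_power poly_bounded_id poly_bounded_const)
  then obtain e where e: "\<And>\<kappa> :: nat. (\<kappa> + (\<kappa> + 2) ^ d + 2) ^ a \<le> (\<kappa> + 2) ^ e"
    unfolding poly_bounded_iff by blast
  show thesis
  proof (rule that[of e])
    fix \<kappa> n m C G
    assume C: "C \<in> circuits n m" "circuit_size C \<le> (\<kappa> + 2) ^ d" and G: "G \<in> set_pmf (obf_pad d e obf \<kappa> C)"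
    let ?C = "pad_circuit ((\<kappa> + 2) ^ d) C"
    obtain C' where C': "C' \<in> set_pmf (obf \<kappa> ?C)" "G = pad_circuit ((\<kappa> + 2) ^ e) C'"
      using G by (auto simp: obf_pad_def)
    have "circuit_size C' \<le> (\<kappa> + circuit_size ?C + 2) ^ a"
      by (rule a[OF pad_circuit_in_circuits[OF C(1)] C'(1)])
    also have "\<dots> \<le> (\<kappa> + 2) ^ e" using e[of \<kappa>] C(2) by (simp add: circuit_size_pad_circuit)
    finally show "circuit_size G = (\<kappa> + 2) ^ e" by (simp add: C'(2) circuit_size_pad_circuit)
  qed
qed

theorem theorem86:
  fixes n r :: "nat \<Rightarrow> nat"
  assumes r_range: "\<forall>\<kappa>. r \<kappa> \<in> {1..2 ^ n \<kappa>}"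
    and r_poly: "poly_bounded r"
    and evasive: "evasive n (weight_class n r) (uniform_weight n r)"
    and implementations: "\<forall>t \<in> {\<lambda>\<kappa>. r \<kappa> - 1, r}. \<exists>K C D.
           implementation n (\<lambda>_. 1) K C D (weight_class n t) (uniform_weight n t)"
    and iO: "\<exists>obf. post_quantum_iO obf"
  shows "preimage_samplable_evasive n (weight_class n r) (uniform_weight n r)"
proof -
  let ?F = "weight_class n r" and ?G = "weight_class n (\<lambda>\<kappa>. r \<kappa> - 1)"
  obtain obf where obf: "post_quantum_iO obf" using iO by blast
  obtain K0 C0 D0 where impl0: "implementation n (\<lambda>_. 1) K0 C0 D0 ?F (uniform_weight n r)"
    using implementations by blast
  obtain K1 C1 D1 where impl1: "implementation n (\<lambda>_. 1) K1 C1 D1 ?G (uniform_weight n (\<lambda>\<kappa>. r \<kappa> - 1))"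
    using implementations by blast
  have kc0: "keyed_circuit_class n (\<lambda>_. 1) K0 C0" and kc1: "keyed_circuit_class n (\<lambda>_. 1) K1 C1"
    and es0: "efficiently_samplable_on K0 D0" and es1: "efficiently_samplable_on K1 D1"
    and im0: "\<And>\<kappa>. functionality (n \<kappa>) ` C0 \<kappa> ` K0 \<kappa> = ?F \<kappa>"
    and im1: "\<And>\<kappa>. functionality (n \<kappa>) ` C1 \<kappa> ` K1 \<kappa> = ?G \<kappa>"
    and sc0: "stat_close (\<lambda>\<kappa>. map_pmf (\<lambda>k. functionality (n \<kappa>) (C0 \<kappa> k)) (D0 \<kappa>)) (uniform_weight n r)"
    and sc1: "stat_close (\<lambda>\<kappa>. map_pmf (\<lambda>k. functionality (n \<kappa>) (C1 \<kappa> k)) (D1 \<kappa>)) (uniform_weight n (\<lambda>\<kappa>. r \<kappa> - 1))"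
    using impl0 impl1 unfolding implementation_def by auto
  have sub0: "\<And>\<kappa> k. k \<in> set_pmf (D0 \<kappa>) \<Longrightarrow> k \<in> K0 \<kappa>" and sub1: "\<And>\<kappa> k. k \<in> set_pmf (D1 \<kappa>) \<Longrightarrow> k \<in> K1 \<kappa>"
    using es0 es1 unfolding efficiently_samplable_on_def by auto
  obtain s0 s1 where s0: "poly_bounded s0" "\<And>\<kappa> k. k \<in> K0 \<kappa> \<Longrightarrow> C0 \<kappa> k \<in> circuits (n \<kappa>) 1 \<and> circuit_size (C0 \<kappa> k) = s0 \<kappa>"
    and s1: "poly_bounded s1" "\<And>\<kappa> k. k \<in> K1 \<kappa> \<Longrightarrow> C1 \<kappa> k \<in> circuits (n \<kappa>) 1 \<and> circuit_size (C1 \<kappa> k) = s1 \<kappa>"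
    using kc0 kc1 unfolding keyed_circuit_class_def by blast
  \<comment> \<open>The class is the image of a key set that contains the support of a
    distribution.\<close>
  have neF: "?F \<kappa> \<noteq> {}" for \<kappa> using im0[of \<kappa>] sub0 set_pmf_not_empty[of "D0 \<kappa>"] by blast
  have neG: "?G \<kappa> \<noteq> {}" for \<kappa> using im1[of \<kappa>] sub1 set_pmf_not_empty[of "D1 \<kappa>"] by blast
  have r1: "1 \<le> r \<kappa>" for \<kappa> using r_range by auto
  have n: "poly_bounded n"
  proof (rule poly_bounded_mono[OF s0(1)])
    fix \<kappa>
    obtain k where "k \<in> set_pmf (D0 \<kappa>)" using set_pmf_not_empty[of "D0 \<kappa>"] by blast
    then show "n \<kappa> \<le> s0 \<kappa>" using s0(2)[OF sub0] arity_le_circuit_size by metis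
  qed
  obtain T where T: "poly_bounded T" "\<And>\<kappa> C y \<mu>1 \<mu>2. C \<in> circuits (n \<kappa>) 1 \<Longrightarrow> circuit_size C = s1 \<kappa> \<Longrightarrow> y \<in> bits (n \<kappa>)
    \<Longrightarrow> circuit_size (puncture C y y \<mu>1 \<mu>2) \<le> T \<kappa>"
    using circuit_size_puncture_poly[OF s1(1) n] by blast
  \<comment> \<open>One inner length for both sides: it accommodates the given circuits of weight
    \<open>r\<close> as well as the punctured ones of weight \<open>r - 1\<close>, so they can share
    representatives.\<close>
  obtain d where d: "\<And>\<kappa>. s0 \<kappa> + T \<kappa> \<le> (\<kappa> + 2) ^ d"
    using poly_bounded_add[OF s0(1) T(1)] unfolding poly_bounded_iff by blast
  obtain e where e: "\<And>\<kappa> n m C G. C \<in> circuits n m \<Longrightarrow> circuit_size C \<le> (\<kappa> + 2) ^ d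
    \<Longrightarrow> G \<in> set_pmf (obf_pad d e obf \<kappa> C) \<Longrightarrow> circuit_size G = (\<kappa> + 2) ^ e"
    using circuit_size_obf_pad[OF obf] by blast
  \<comment> \<open>All circuits of the right size and function, not only outputs of the obfuscator:
    the key set just has to contain the support and to map onto the class.\<close>
  define S where "S = (\<lambda>\<kappa>. {G \<in> circuits (n \<kappa>) 1. circuit_size G = (\<kappa> + 2) ^ e \<and> functionality (n \<kappa>) G \<in> ?F \<kappa>})"
  define K where "K = (\<lambda>\<kappa>. encode ` S \<kappa>)"
  \<comment> \<open>Only \<open>encode (C \<kappa> k)\<close> has to be computed from the key, and
    that is the key itself, so no decoder is programmed.\<close>
  define C where "C = (\<lambda>\<kappa>. inv_into (circuits (n \<kappa>) 1) encode)"
  define D where "D = (\<lambda>\<kappa>. bind_pmf (D0 \<kappa>) (\<lambda>k. map_pmf encode (obf_pad d e obf \<kappa> (C0 \<kappa> k))))"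
  define P where "P = (\<lambda>\<kappa> k x1 x2 \<mu>1 \<mu>2. obf_pad d e obf \<kappa> (puncture (C1 \<kappa> k) x1 x2 \<mu>1 \<mu>2))"
  have C_encode: "C \<kappa> (encode G) = G" if "G \<in> circuits (n \<kappa>) 1" for \<kappa> G
    unfolding C_def by (rule inv_into_f_f[OF inj_on_encode that])
  have C_S: "C \<kappa> k \<in> S \<kappa> \<and> encode (C \<kappa> k) = k" if k: "k \<in> K \<kappa>" for \<kappa> k
  proof -
    obtain G where "G \<in> S \<kappa>" "k = encode G" using k by (auto simp: K_def)
    then show ?thesis using C_encode[of G \<kappa>] by (simp add: S_def)
  qed
  have func0: "functionality (n \<kappa>) (C0 \<kappa> k) \<in> ?F \<kappa>" if "k \<in> K0 \<kappa>" for \<kappa> k using im0[of \<kappa>] that by blast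
  have func1: "functionality (n \<kappa>) (C1 \<kappa> k) \<in> ?G \<kappa>" if "k \<in> K1 \<kappa>" for \<kappa> k using im1[of \<kappa>] that by blast
  have size0: "circuit_size (C0 \<kappa> k) \<le> (\<kappa> + 2) ^ d" if "k \<in> K0 \<kappa>" for \<kappa> k
    using s0(2)[OF that] d[of \<kappa>] by simp
  have obf0: "G \<in> S \<kappa> \<and> functionality (n \<kappa>) G = functionality (n \<kappa>) (C0 \<kappa> k)"
    if "k \<in> K0 \<kappa>" "G \<in> set_pmf (obf_pad d e obf \<kappa> (C0 \<kappa> k))" for \<kappa> k G
  proof -
    have C0: "C0 \<kappa> k \<in> circuits (n \<kappa>) 1" using s0(2)[OF that(1)] by simp
    have f: "functionality (n \<kappa>) G = functionality (n \<kappa>) (C0 \<kappa> k)"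
      using obf_pad_functional(2)[OF obf C0 that(2)] by (auto simp: functionality_def)
    then show ?thesis
      using obf_pad_functional(1)[OF obf C0 that(2)] e[OF C0 size0[OF that(1)] that(2)] func0[OF that(1)]
      by (simp add: S_def)
  qed
  have impl: "implementation n (\<lambda>_. 1) K C D ?F (uniform_weight n r)"
    unfolding implementation_def
  proof (intro conjI allI)
    show "keyed_circuit_class n (\<lambda>_. 1) K C"
      unfolding keyed_circuit_class_def
    proof (intro conjI exI allI ballI)
      show "poly_bounded (\<lambda>\<kappa>. (\<kappa> + 2) ^ e)"
        by (intro poly_bounded_add poly_bounded_power poly_bounded_id poly_bounded_const)
      show "C \<kappa> k \<in> circuits (n \<kappa>) 1" "circuit_size (C \<kappa> k) = (\<kappa> + 2) ^ e" if "k \<in> K \<kappa>" for \<kappa> k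
        using C_S[OF that] by (auto simp: S_def)
      have "ppt {(\<kappa>, k). k \<in> K \<kappa>} (\<lambda>(\<kappa>, k). [unary \<kappa>, k]) (\<lambda>i. return_pmf ((case i of (\<kappa>, k) \<Rightarrow> [unary \<kappa>, k]) ! 1))"
        by (rule ppt_arg[where m = 2]) auto
      then show "ppt {(\<kappa>, k). k \<in> K \<kappa>} (\<lambda>(\<kappa>, k). [unary \<kappa>, k]) (\<lambda>(\<kappa>, k). return_pmf (encode (C \<kappa> k)))"
        by (rule ppt_reindex[where \<phi> = "\<lambda>i. i"]) (use C_S in auto)
    qed
    show "efficiently_samplable_on K D"
      unfolding efficiently_samplable_on_def
    proof (intro conjI allI)
      show "set_pmf (D \<kappa>) \<subseteq> K \<kappa>" for \<kappa> using obf0 sub0 by (fastforce simp: D_def K_def)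
      show "ppt UNIV (\<lambda>\<kappa>. [unary \<kappa>]) D" unfolding D_def by (rule ppt_sample_obf_pad[OF obf es0 kc0])
    qed
    show "functionality (n \<kappa>) ` C \<kappa> ` K \<kappa> = ?F \<kappa>" for \<kappa>
    proof
      show "functionality (n \<kappa>) ` C \<kappa> ` K \<kappa> \<subseteq> ?F \<kappa>" using C_S by (auto simp: S_def)
      show "?F \<kappa> \<subseteq> functionality (n \<kappa>) ` C \<kappa> ` K \<kappa>"
      proof
        fix f assume "f \<in> ?F \<kappa>"
        then obtain k where k: "k \<in> K0 \<kappa>" "f = functionality (n \<kappa>) (C0 \<kappa> k)" using im0[of \<kappa>] by blast
        obtain G where G: "G \<in> set_pmf (obf_pad d e obf \<kappa> (C0 \<kappa> k))" using set_pmf_not_empty[of "obf_pad d e obf \<kappa> (C0 \<kappa> k)"] by blast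
        have "G \<in> S \<kappa>" "f = functionality (n \<kappa>) G" using obf0[OF k(1) G] k(2) by auto
        moreover from this have "C \<kappa> (encode G) = G" using C_encode by (simp add: S_def)
        ultimately show "f \<in> functionality (n \<kappa>) ` C \<kappa> ` K \<kappa>" unfolding K_def by (metis image_eqI)
      qed
    qed
    \<comment> \<open>Obfuscation and padding keep the function, so the two laws agree exactly and
      closeness is inherited from the given implementation.\<close>
    have "map_pmf (\<lambda>k. functionality (n \<kappa>) (C \<kappa> k)) (D \<kappa>) = map_pmf (\<lambda>k. functionality (n \<kappa>) (C0 \<kappa> k)) (D0 \<kappa>)" for \<kappa>
    proof -
      have "map_pmf (\<lambda>k. functionality (n \<kappa>) (C \<kappa> k)) (D \<kappa>)
        = bind_pmf (D0 \<kappa>) (\<lambda>k. map_pmf (\<lambda>G. functionality (n \<kappa>) (C \<kappa> (encode G))) (obf_pad d e obf \<kappa> (C0 \<kappa> k)))"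
        by (simp add: D_def map_bind_pmf pmf.map_comp o_def)
      also have "\<dots> = bind_pmf (D0 \<kappa>) (\<lambda>k. map_pmf (\<lambda>G. functionality (n \<kappa>) (C0 \<kappa> k)) (obf_pad d e obf \<kappa> (C0 \<kappa> k)))"
        by (intro bind_pmf_cong pmf.map_cong refl) (use obf0[OF sub0] C_encode in \<open>auto simp: S_def\<close>)
      also have "\<dots> = map_pmf (\<lambda>k. functionality (n \<kappa>) (C0 \<kappa> k)) (D0 \<kappa>)"
        by (simp add: map_pmf_def[of "\<lambda>k. functionality (n \<kappa>) (C0 \<kappa> k)"])
      finally show ?thesis .
    qed
    then show "stat_close (\<lambda>\<kappa>. map_pmf (\<lambda>k. functionality (n \<kappa>) (C \<kappa> k)) (D \<kappa>)) (uniform_weight n r)"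
      using sc0 by simp
  qed
  have ne: "preimage1 (n \<kappa>) (eval_circuit (C \<kappa> k)) \<noteq> {}" if "k \<in> set_pmf (D \<kappa>)" for \<kappa> k
  proof -
    have "k \<in> K \<kappa>" using impl that unfolding implementation_def efficiently_samplable_on_def by blast
    then have "functionality (n \<kappa>) (C \<kappa> k) \<in> ?F \<kappa>" using C_S by (simp add: S_def)
    then have "card (preimage1 (n \<kappa>) (eval_circuit (C \<kappa> k))) = r \<kappa>"
      by (simp add: weight_class_def preimage1_functionality)
    then show ?thesis using r1[of \<kappa>] by auto
  qed
  have gp: "gen_puncturing n (\<lambda>_. 1) K1 C1 P"
    unfolding P_def by (rule gen_puncturing_obf_pad[OF obf kc1])
  define L where "L = (\<lambda>\<kappa>. map_pmf enc_pair (do {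
             k \<leftarrow> D \<kappa>;
             x \<leftarrow> pmf_of_set (preimage1 (n \<kappa>) (eval_circuit (C \<kappa> k)));
             return_pmf (C \<kappa> k, x) }))"
  define R where "R = (\<lambda>\<kappa>. map_pmf enc_pair (do {
             k' \<leftarrow> D1 \<kappa>;
             y \<leftarrow> pmf_of_set (bits (n \<kappa>));
             G \<leftarrow> P \<kappa> k' y y (const_one (n \<kappa>)) (const_one (n \<kappa>));
             return_pmf (G, y) }))"
  define punct where "punct = (\<lambda>\<kappa> k y. puncture (C1 \<kappa> k) y y (const_one (n \<kappa>)) (const_one (n \<kappa>)))"
  define p where "p = (\<lambda>\<kappa>. bind_pmf (D0 \<kappa>) (\<lambda>k. map_pmf (Pair (C0 \<kappa> k)) (pmf_of_set (preimage1 (n \<kappa>) (eval_circuit (C0 \<kappa> k))))))"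
  define q where "q = (\<lambda>\<kappa>. bind_pmf (D1 \<kappa>) (\<lambda>k. map_pmf (\<lambda>y. (punct \<kappa> k y, y)) (pmf_of_set (bits (n \<kappa>)))))"
  \<comment> \<open>The last stage is common to both sides: obfuscate the circuit of a pair and
    append the point. They differ only in the law of the pair, \<open>p\<close> or
    \<open>q\<close>.\<close>
  define \<Psi> where "\<Psi> = (\<lambda>\<kappa> (G, x). map_pmf (\<lambda>G'. encode G' @ x) (obf_pad d e obf \<kappa> G))"
  have L: "L \<kappa> = bind_pmf (p \<kappa>) (\<Psi> \<kappa>)" for \<kappa>
  proof -
    let ?pre = "\<lambda>C. pmf_of_set (preimage1 (n \<kappa>) (eval_circuit C))"
    have "L \<kappa> = bind_pmf (D0 \<kappa>) (\<lambda>k. bind_pmf (obf_pad d e obf \<kappa> (C0 \<kappa> k)) (\<lambda>G.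
        bind_pmf (?pre (C \<kappa> (encode G))) (\<lambda>x. return_pmf (encode (C \<kappa> (encode G)) @ x))))"
      by (simp add: L_def D_def bind_assoc_pmf map_bind_pmf bind_map_pmf enc_pair_def)
    \<comment> \<open>Obfuscation does not change the preimages of 1, so the point may be drawn from
      those of the original circuit; after that the two draws can be exchanged.\<close>
    also have "\<dots> = bind_pmf (D0 \<kappa>) (\<lambda>k. bind_pmf (obf_pad d e obf \<kappa> (C0 \<kappa> k)) (\<lambda>G.
        bind_pmf (?pre (C0 \<kappa> k)) (\<lambda>x. return_pmf (encode G @ x))))"
    proof (intro bind_pmf_cong refl)
      fix k G assume "k \<in> set_pmf (D0 \<kappa>)" and G: "G \<in> set_pmf (obf_pad d e obf \<kappa> (C0 \<kappa> k))"
      have *: "G \<in> S \<kappa>" "functionality (n \<kappa>) G = functionality (n \<kappa>) (C0 \<kappa> k)"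
        using obf0[OF sub0 G] \<open>k \<in> set_pmf (D0 \<kappa>)\<close> by auto
      have CG: "C \<kappa> (encode G) = G" using * C_encode by (simp add: S_def)
      show "?pre (C \<kappa> (encode G)) = ?pre (C0 \<kappa> k)"
        using *(2) by (simp add: CG preimage1_functionality[symmetric])
      show "return_pmf (encode (C \<kappa> (encode G)) @ x) = return_pmf (encode G @ x)" for x by (simp add: CG)
    qed
    also have "\<dots> = bind_pmf (D0 \<kappa>) (\<lambda>k. bind_pmf (?pre (C0 \<kappa> k)) (\<lambda>x.
        bind_pmf (obf_pad d e obf \<kappa> (C0 \<kappa> k)) (\<lambda>G. return_pmf (encode G @ x))))"
      by (subst bind_commute_pmf) (rule refl)
    also have "\<dots> = bind_pmf (p \<kappa>) (\<Psi> \<kappa>)"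
      by (simp add: p_def \<Psi>_def bind_assoc_pmf bind_map_pmf map_pmf_def[of "\<lambda>G. encode G @ _"])
    finally show ?thesis .
  qed
  have R: "R \<kappa> = bind_pmf (q \<kappa>) (\<Psi> \<kappa>)" for \<kappa>
    by (simp add: R_def q_def P_def punct_def \<Psi>_def bind_assoc_pmf bind_map_pmf map_bind_pmf enc_pair_def
        map_pmf_def[of "\<lambda>G. encode G @ _"])
  have p_supp: "G \<in> circuits (n \<kappa>) 1 \<and> circuit_size G \<le> (\<kappa> + 2) ^ d \<and> x \<in> bits (n \<kappa>)"
    if Gx: "(G, x) \<in> set_pmf (p \<kappa>)" for \<kappa> G x
  proof -
    obtain k where k: "k \<in> set_pmf (D0 \<kappa>)" "G = C0 \<kappa> k" "x \<in> set_pmf (pmf_of_set (preimage1 (n \<kappa>) (eval_circuit (C0 \<kappa> k))))"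
      using Gx by (auto simp: p_def)
    have "card (preimage1 (n \<kappa>) (eval_circuit (C0 \<kappa> k))) = r \<kappa>"
      using func0[OF sub0[OF k(1)]] by (simp add: weight_class_def preimage1_functionality)
    then have "preimage1 (n \<kappa>) (eval_circuit (C0 \<kappa> k)) \<noteq> {}" using r1[of \<kappa>] by auto
    then have "x \<in> bits (n \<kappa>)" using k(3) by (simp add: preimage1_def)
    then show ?thesis using k(2) s0(2)[OF sub0[OF k(1)]] size0[OF sub0[OF k(1)]] by simp
  qed
  have q_supp: "G \<in> circuits (n \<kappa>) 1 \<and> circuit_size G \<le> (\<kappa> + 2) ^ d \<and> x \<in> bits (n \<kappa>)"
    if Gx: "(G, x) \<in> set_pmf (q \<kappa>)" for \<kappa> G x
  proof -
    obtain k where k: "k \<in> set_pmf (D1 \<kappa>)" "G = punct \<kappa> k x" "x \<in> bits (n \<kappa>)"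
      using Gx by (auto simp: q_def)
    have C1: "C1 \<kappa> k \<in> circuits (n \<kappa>) 1" "circuit_size (C1 \<kappa> k) = s1 \<kappa>" using s1(2)[OF sub1[OF k(1)]] by auto
    have "circuit_size G \<le> T \<kappa>" unfolding k(2) punct_def by (rule T(2)[OF C1 k(3)])
    then have "circuit_size G \<le> (\<kappa> + 2) ^ d" using d[of \<kappa>] by simp
    then show ?thesis using puncture_in_circuits[OF C1(1) k(3) k(3)] k(2,3) by (simp add: punct_def)
  qed
  \<comment> \<open>The representative of a function. The size bound belongs to the choice, so that
    representatives fit the inner padding.\<close>
  define c where "c = (\<lambda>\<kappa> f. SOME G. G \<in> circuits (n \<kappa>) 1 \<and> circuit_size G \<le> (\<kappa> + 2) ^ d \<and> functionality (n \<kappa>) G = f)"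
  have c: "c \<kappa> (functionality (n \<kappa>) G) \<in> circuits (n \<kappa>) 1 \<and> circuit_size (c \<kappa> (functionality (n \<kappa>) G)) \<le> (\<kappa> + 2) ^ d
      \<and> functionality (n \<kappa>) (c \<kappa> (functionality (n \<kappa>) G)) = functionality (n \<kappa>) G"
    if "G \<in> circuits (n \<kappa>) 1" "circuit_size G \<le> (\<kappa> + 2) ^ d" for \<kappa> G
    unfolding c_def by (rule someI[where x = G]) (use that in simp)
  have "comp_indist L R"
    unfolding comp_indist_def
  proof (intro allI impI)
    fix A assume A: "qpt_adversary A"
    define acc where "acc = (\<lambda>\<kappa> w. accept_prob (A \<kappa> (length w)) w)"
    define \<alpha> where "\<alpha> = obf_accept A d e obf"
    define \<beta> where "\<beta> = (\<lambda>\<kappa> f. \<alpha> \<kappa> (c \<kappa> f))"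
    define h0 where "h0 = (\<lambda>\<kappa> f. expect (pmf_of_set (preimage1 (n \<kappa>) f)) (\<beta> \<kappa> f))"
    define h1 where "h1 = (\<lambda>\<kappa> g. expect (pmf_of_set (bits (n \<kappa>))) (\<lambda>y. \<beta> \<kappa> (g(y := [True])) y))"
    have acc: "0 \<le> acc \<kappa> w \<and> acc \<kappa> w \<le> 1" for \<kappa> w
      unfolding acc_def by (rule accept_prob_unit_interval) (use A in \<open>simp add: qpt_adversary_def\<close>)
    have \<alpha>: "0 \<le> \<alpha> \<kappa> G x \<and> \<alpha> \<kappa> G x \<le> 1" for \<kappa> G x unfolding \<alpha>_def by (rule obf_accept_unit_interval[OF A])
    have \<beta>: "0 \<le> \<beta> \<kappa> f x \<and> \<beta> \<kappa> f x \<le> 1" for \<kappa> f x unfolding \<beta>_def by (rule \<alpha>)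
    have h0: "0 \<le> h0 \<kappa> f \<and> h0 \<kappa> f \<le> 1" for \<kappa> f unfolding h0_def by (rule expectation_unit_interval) (rule \<beta>)
    have h1: "0 \<le> h1 \<kappa> f \<and> h1 \<kappa> f \<le> 1" for \<kappa> f unfolding h1_def by (rule expectation_unit_interval) (rule \<beta>)
    have \<Psi>: "expect (\<Psi> \<kappa> z) (acc \<kappa>) = (case z of (G, x) \<Rightarrow> \<alpha> \<kappa> G x)" for \<kappa> z
      by (simp add: \<Psi>_def \<alpha>_def obf_accept_def acc_def case_prod_unfold)
    have EL: "expect (L \<kappa>) (acc \<kappa>) = expect (p \<kappa>) (\<lambda>(G, x). \<alpha> \<kappa> G x)" for \<kappa>
      unfolding L expectation_bind[OF acc] \<Psi> ..
    have ER: "expect (R \<kappa>) (acc \<kappa>) = expect (q \<kappa>) (\<lambda>(G, x). \<alpha> \<kappa> G x)" for \<kappa>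
      unfolding R expectation_bind[OF acc] \<Psi> ..
    let ?X = "\<lambda>\<kappa>. map_pmf (\<lambda>k. functionality (n \<kappa>) (C0 \<kappa> k)) (D0 \<kappa>)"
    let ?Y = "\<lambda>\<kappa>. map_pmf (\<lambda>k. functionality (n \<kappa>) (C1 \<kappa> k)) (D1 \<kappa>)"
    have unit: "0 \<le> (case z of (G, x) \<Rightarrow> \<beta> \<kappa> (functionality (n \<kappa>) G) x) \<and> (case z of (G, x) \<Rightarrow> \<beta> \<kappa> (functionality (n \<kappa>) G) x) \<le> 1"
      for \<kappa> z using \<beta> by (cases z) simp
    have Ep: "expect (p \<kappa>) (\<lambda>(G, x). \<beta> \<kappa> (functionality (n \<kappa>) G) x) = expect (?X \<kappa>) (h0 \<kappa>)" for \<kappa>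
      unfolding p_def expectation_bind[OF unit] by (simp add: h0_def preimage1_functionality)
    have Eq: "expect (q \<kappa>) (\<lambda>(G, x). \<beta> \<kappa> (functionality (n \<kappa>) G) x) = expect (?Y \<kappa>) (h1 \<kappa>)" for \<kappa>
    proof -
      have "expect (q \<kappa>) (\<lambda>(G, x). \<beta> \<kappa> (functionality (n \<kappa>) G) x)
        = expect (D1 \<kappa>) (\<lambda>k. expect (pmf_of_set (bits (n \<kappa>))) (\<lambda>y. \<beta> \<kappa> (functionality (n \<kappa>) (punct \<kappa> k y)) y))"
        unfolding q_def expectation_bind[OF unit] by simp
      also have "\<dots> = expect (D1 \<kappa>) (\<lambda>k. h1 \<kappa> (functionality (n \<kappa>) (C1 \<kappa> k)))"
        unfolding h1_def
        by (intro integral_cong_AE) (use s1(2)[OF sub1] in \<open>auto simp: AE_measure_pmf_iff punct_def functionality_puncture_one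
            intro!: integral_cong_AE\<close>)
      finally show ?thesis by simp
    qed
    \<comment> \<open>The five gaps between the two sides: \<open>N1\<close> and \<open>N5\<close>
      exchange circuits for representatives, \<open>N2\<close> and \<open>N4\<close> exchange
      sampled functions for uniform ones, and \<open>N3\<close> passes from weight \<open>r\<close>
      to weight \<open>r - 1\<close> with one added point.\<close>
    define N1 where "N1 = (\<lambda>\<kappa>. expect (p \<kappa>) (\<lambda>(G, x). \<alpha> \<kappa> G x) - expect (p \<kappa>) (\<lambda>(G, x). \<beta> \<kappa> (functionality (n \<kappa>) G) x))"
    define N2 where "N2 = (\<lambda>\<kappa>. stat_dist (?X \<kappa>) (uniform_weight n r \<kappa>))"
    define N3 where "N3 = (\<lambda>\<kappa>. real (r \<kappa>) / 2 ^ n \<kappa>)"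
    define N4 where "N4 = (\<lambda>\<kappa>. stat_dist (?Y \<kappa>) (uniform_weight n (\<lambda>\<kappa>. r \<kappa> - 1) \<kappa>))"
    define N5 where "N5 = (\<lambda>\<kappa>. expect (q \<kappa>) (\<lambda>(G, x). \<alpha> \<kappa> G x) - expect (q \<kappa>) (\<lambda>(G, x). \<beta> \<kappa> (functionality (n \<kappa>) G) x))"
    have N1: "negligible N1"
      unfolding N1_def \<alpha>_def \<beta>_def
      by (rule obf_accept_average_negligible[where c = "\<lambda>\<kappa> G. c \<kappa> (functionality (n \<kappa>) G)", OF obf A n])
        (use p_supp c in blast)+
    have N5: "negligible N5"
      unfolding N5_def \<alpha>_def \<beta>_def
      by (rule obf_accept_average_negligible[where c = "\<lambda>\<kappa> G. c \<kappa> (functionality (n \<kappa>) G)", OF obf A n])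
        (use q_supp c in blast)+
    have N2: "negligible N2" using sc0 by (simp add: stat_close_def N2_def)
    have N4: "negligible N4" using sc1 by (simp add: stat_close_def N4_def)
    have N3: "negligible N3" unfolding N3_def by (rule negligible_density[OF evasive neF])
    have "\<bar>expect (L \<kappa>) (acc \<kappa>) - expect (R \<kappa>) (acc \<kappa>)\<bar> \<le> \<bar>N1 \<kappa>\<bar> + 2 * \<bar>N2 \<kappa>\<bar> + \<bar>N3 \<kappa>\<bar> + 2 * \<bar>N4 \<kappa>\<bar> + \<bar>N5 \<kappa>\<bar>" for \<kappa>
    proof -
      have "\<bar>expect (?X \<kappa>) (h0 \<kappa>) - expect (uniform_weight n r \<kappa>) (h0 \<kappa>)\<bar> \<le> 2 * N2 \<kappa>"
        unfolding N2_def
        by (rule abs_expectation_diff_le_stat_dist[OF finite_weight_class[of n r \<kappa>]])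
          (use func0 sub0 neF[of \<kappa>] h0 finite_weight_class in \<open>auto simp: uniform_weight_def\<close>)
      moreover have "\<bar>expect (?Y \<kappa>) (h1 \<kappa>) - expect (uniform_weight n (\<lambda>\<kappa>. r \<kappa> - 1) \<kappa>) (h1 \<kappa>)\<bar> \<le> 2 * N4 \<kappa>"
        unfolding N4_def
        by (rule abs_expectation_diff_le_stat_dist[OF finite_weight_class[of n "\<lambda>\<kappa>. r \<kappa> - 1" \<kappa>]])
          (use func1 sub1 neG[of \<kappa>] h1 finite_weight_class in \<open>auto simp: uniform_weight_def\<close>)
      moreover have "\<bar>expect (uniform_weight n r \<kappa>) (h0 \<kappa>) - expect (uniform_weight n (\<lambda>\<kappa>. r \<kappa> - 1) \<kappa>) (h1 \<kappa>)\<bar> \<le> N3 \<kappa>"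
        unfolding h0_def h1_def N3_def by (rule weight_class_hybrid[OF r1 neF neG \<beta>])
      ultimately show ?thesis
        unfolding EL ER N1_def N5_def Ep Eq by linarith
    qed
    moreover have "negligible (\<lambda>\<kappa>. \<bar>N1 \<kappa>\<bar> + 2 * \<bar>N2 \<kappa>\<bar> + \<bar>N3 \<kappa>\<bar> + 2 * \<bar>N4 \<kappa>\<bar> + \<bar>N5 \<kappa>\<bar>)"
      by (intro negligible_add negligible_double negligible_abs N1 N2 N3 N4 N5)
    ultimately have "negligible (\<lambda>\<kappa>. expect (L \<kappa>) (acc \<kappa>) - expect (R \<kappa>) (acc \<kappa>))"
      by (elim negligible_mono) simp
    then show "negligible (\<lambda>\<kappa>. expect (L \<kappa>) (\<lambda>w. accept_prob (A \<kappa> (length w)) w) - expect (R \<kappa>) (\<lambda>w. accept_prob (A \<kappa> (length w)) w))"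
      unfolding acc_def .
  qed
  then show ?thesis
    unfolding preimage_samplable_evasive_def L_def R_def using evasive impl ne kc1 gp es1 by blast
qed

end
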